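(* Let $\mathbf{u}_\alpha$ and $\mathbf{u}^*_\alpha$ ($\alpha>0$) be controls, measurable functions of time with values in a compact subset of $\mathbb{R}^d$, and suppose that $$\lim_{\alpha\to0}\mathbf{u}_\alpha(t)=\bar{\mathbf{u}}(t),\qquad \lim_{\alpha\to0}\mathbf{u}^*_\alpha(t)=\bar{\mathbf{u}}^*(t).$$ Consider weak solutions, with initial datum $\mu_0(x)$, of the Boltzmann-type equation $\partial_t\mu=\mathbb{Q}_\alpha(\mu,\mu)$ associated with the binary interaction $$\hat x=x+\alpha H(x-y)(1-\Theta)(1-\Theta^* )+\alpha\Big[\sum_{\ell=1}^dG^\ell(x-y)(u^*_\alpha)_\ell(1-\Theta)\Theta^*+\mathbf{u}_\alpha\Theta\Big].$$ Introduce the scaling $\alpha=\epsilon$, $\eta=\frac1\epsilon$ and denote by $\mu^\epsilon(x,t)$ a weak solution, with initial datum $\mu_0$, of the scaled equation. Then for $\epsilon\to0$, $\mu^\epsilon(x,t)$ converges pointwise, up to a subsequence, to $\mu(x,t)$, where $\mu$ satisfies (in weak form) $$\partial_t\mu+\mathrm{div}\Big[\Big(\int_{\mathbb{R}^d}\big\langle K(x,y,\bar{\mathbf{u}},\bar{\mathbf{u}}^* )\big\rangle\mu(y,t)\,dy\Big)\mu\Big]=0,$$ with $$\big\langle K(x,y,\bar{\mathbf{u}},\bar{\mathbf{u}}^* )\big\rangle=(1-p)^2H(x-y)+p(1-p)\sum_{\ell=1}^dG^\ell(x-y)\bar u^*_\ell+p\,\bar{\mathbf{u}} .$$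
   Context: Standing assumption: $H,G^1,\dots,G^d:\mathbb{R}^d\to\mathbb{R}^d$ are bounded, locally Lipschitz and of sub-linear growth ($|H(\xi)|\le C_H(1+|\xi|)$, $|G^\ell(\xi)|\le C_G^\ell(1+|\xi|)$). $\alpha>0$ is the interaction strength (characteristic interaction time), $\eta>0$ the interaction frequency. $\Theta,\Theta^*$ are independent Bernoulli random variables with $\mathcal{P}\{\Theta=1\}=\mathcal{P}\{\Theta^*=1\}=p\in[0,1]$ (they encode whether agent $x$, respectively $y$, is controlled, by $\mathbf{u}_\alpha$, respectively $\mathbf{u}^*_\alpha$); $\langle\cdot\rangle$ is the expectation with respect to $(\Theta,\Theta^* )$. $\hat y$ is obtained from $\hat x$ by exchanging the roles of the two agents. $\mu(x,t)$ is the density of agents at $x\in\mathbb{R}^d$ at time $t$. The interaction operator is $$\mathbb{Q}_\alpha(\mu,\mu)(x,t)=\eta\Big\langle\int_{\mathbb{R}^d}\frac1{\mathcal{J}_\alpha}\mu(\hat x,t)\mu(\hat y,t)-\mu(x,t)\mu(y,t)\,dy\Big\rangle,$$ with $\mathcal{J}_\alpha$ the Jacobian of $(x,y)\mapsto(\hat x,\hat y)$. It is understood in weak form: $\mu$ is a weak solution with initial datum $\mu_0\in\mathcal{P}_1(\mathbb{R}^d)$ (probability measures of finite first moment) if $\mu\in L^2([0,T],\mathcal{P}_1(\mathbb{R}^d))$, $\mu(x,0)=\mu_0$, and for all $t\in[0,T]$ and $\varphi\in C_c^\infty(\mathbb{R}^d,\mathbb{R})$ $$\frac{d}{dt}\int_{\mathbb{R}^d}\varphi(x)\mu(x,t)\,dx=\eta\Big\langle\int_{\mathbb{R}^d}\int_{\mathbb{R}^d}(\varphi(\hat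 x)-\varphi(x))\,\mu(x,t)\mu(y,t)\,dx\,dy\Big\rangle.$$ *)

theory Defs
  imports "HOL-Probability.Probability"
begin

section \<open>Test functions\<close>

definition partial_derivative :: "'d \<Rightarrow> (real ^ 'd::finite \<Rightarrow> real) \<Rightarrow> real ^ 'd \<Rightarrow> real" where
  "partial_derivative i f x = frechet_derivative f (at x) (axis i 1)"

definition gradient :: "(real ^ 'd::finite \<Rightarrow> real) \<Rightarrow> real ^ 'd \<Rightarrow> real ^ 'd" where
  "gradient f x = (\<chi> i. partial_derivative i f x)"

text \<open>\<open>fold partial_derivative is f\<close> is the iterated partial derivative of \<open>f\<close> along the
  multi-index listed by \<open>is\<close>.  That all of these are (Frechet) differentiable says that \<open>f\<close> is of
  class \<open>C\<close>-infinity: continuity of the partials follows from their differentiability.\<close>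

definition smooth_fun :: "(real ^ 'd::finite \<Rightarrow> real) \<Rightarrow> bool" where
  "smooth_fun f \<longleftrightarrow> (\<forall>is. fold partial_derivative is f differentiable_on UNIV)"

definition test_functions :: "(real ^ 'd::finite \<Rightarrow> real) set" where
  "test_functions = {\<phi>. smooth_fun \<phi> \<and> compact (closure {x. \<phi> x \<noteq> 0})}"


section \<open>Regularity of the interaction functions\<close>

text \<open>The library notion is for time-dependent functions; here it is used for a constant family.\<close>

definition locally_lipschitz :: "('a::metric_space \<Rightarrow> 'b::metric_space) \<Rightarrow> bool" where
  "locally_lipschitz f \<longleftrightarrow> local_lipschitz (UNIV :: real set) UNIV (\<lambda>_. f)"

definition sublinear_growth :: "('a::real_normed_vector \<Rightarrow> 'b::real_normed_vector) \<Rightarrow> bool" where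
  "sublinear_growth f \<longleftrightarrow> (\<exists>C. \<forall>\<xi>. norm (f \<xi>) \<le> C * (1 + norm \<xi>))"

definition admissible_interaction ::
    "('a::real_normed_vector \<Rightarrow> 'b::real_normed_vector) \<Rightarrow> bool" where
  "admissible_interaction f \<longleftrightarrow>
     bounded (range f) \<and> locally_lipschitz f \<and> sublinear_growth f"


section \<open>Probability measures with finite first moment\<close>

definition P1 :: "'a::euclidean_space measure set" where
  "P1 = {\<mu>. prob_space \<mu> \<and> sets \<mu> = sets borel \<and> integrable \<mu> norm}"

text \<open>Convergence in the metric (the 1-Wasserstein distance) of \<^term>\<open>P1\<close>, in its usual
  formulation as weak convergence tested on continuous functions of at most linear growth.  It is
  narrow convergence together with convergence of first moments.\<close>

definition P1_tendsto :: "(nat \<Rightarrow> 'a::euclidean_space measure) \<Rightarrow> 'a measure \<Rightarrow> bool" where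
  "P1_tendsto \<mu>s \<mu> \<longleftrightarrow>
     (\<forall>f :: 'a \<Rightarrow> real. continuous_on UNIV f \<and> sublinear_growth f \<longrightarrow>
        (\<lambda>n. \<integral>x. f x \<partial>\<mu>s n) \<longlonglongrightarrow> (\<integral>x. f x \<partial>\<mu>))"

text \<open>Square integrable curves on \<open>[0,T]\<close> with values in \<^term>\<open>P1\<close>.  The first moment of \<open>\<mu> t\<close> is its
  1-Wasserstein distance to the Dirac mass at the origin.\<close>

definition L2_P1 :: "real \<Rightarrow> (real \<Rightarrow> 'a::euclidean_space measure) set" where
  "L2_P1 T = {\<mu>. \<mu> \<in> lebesgue_on {0..T} \<rightarrow>\<^sub>M prob_algebra borel \<and> (\<forall>t\<in>{0..T}. \<mu> t \<in> P1) \<and>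
     integrable (lebesgue_on {0..T}) (\<lambda>t. (\<integral>x. norm x \<partial>\<mu> t)\<^sup>2)}"


section \<open>Time derivatives\<close>

text \<open>The controls are only measurable in time, so an equation \<open>d/dt F = f\<close> on \<open>[0,T]\<close> is read in the
  sense of Caratheodory: \<open>F\<close> is a primitive of \<open>f\<close>.  The two lemmas relate this to the classical
  reading: it is implied by differentiability at every time, and gives it back if \<open>f\<close> is continuous.\<close>

definition has_time_derivative :: "real \<Rightarrow> (real \<Rightarrow> real) \<Rightarrow> (real \<Rightarrow> real) \<Rightarrow> bool" where
  "has_time_derivative T F f \<longleftrightarrow> (\<forall>t\<in>{0..T}. (f has_integral (F t - F 0)) {0..t})"

lemma has_time_derivative_classical:
  assumes "\<And>t. t \<in> {0..T} \<Longrightarrow> (F has_real_derivative f t) (at t within {0..T})"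
  shows "has_time_derivative T F f"
  unfolding has_time_derivative_def
proof
  fix t assume t: "t \<in> {0..T}"
  show "(f has_integral (F t - F 0)) {0..t}"
  proof (rule fundamental_theorem_of_calculus)
    show "0 \<le> t" using t by simp
    fix s assume s: "s \<in> {0..t}"
    have "(F has_vector_derivative f s) (at s within {0..T})"
      using assms[of s] s t by (auto simp: has_real_derivative_iff_has_vector_derivative)
    then show "(F has_vector_derivative f s) (at s within {0..t})"
      by (rule has_vector_derivative_within_subset) (use t in auto)
  qed
qed

lemma has_time_derivative_continuous:
  assumes "has_time_derivative T F f" and "continuous_on {0..T} f" and t: "t \<in> {0..T}"
  shows "(F has_real_derivative f t) (at t within {0..T})"
proof (rule has_field_derivative_transform_within[OF _ zero_less_one t])
  have "((\<lambda>s. integral {0..s} f) has_real_derivative f t) (at t within {0..T})"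
    using assms by (intro integral_has_real_derivative)
  from DERIV_add[OF DERIV_const this]
  show "((\<lambda>s. F 0 + integral {0..s} f) has_real_derivative f t) (at t within {0..T})"
    by simp
next
  fix s assume "s \<in> {0..T}"
  then show "F 0 + integral {0..s} f = F s"
    using integral_unique[of f "F s - F 0" "{0..s}"] assms(1)
    unfolding has_time_derivative_def by simp
qed


section \<open>The binary interaction and the Boltzmann-type equation\<close>

definition bernoulli_rv :: "'w measure \<Rightarrow> real \<Rightarrow> ('w \<Rightarrow> real) \<Rightarrow> bool" where
  "bernoulli_rv P p \<Theta> \<longleftrightarrow>
     \<Theta> \<in> borel_measurable P \<and> (\<forall>\<omega>\<in>space P. \<Theta> \<omega> \<in> {0, 1}) \<and>
     measure P {\<omega> \<in> space P. \<Theta> \<omega> = 1} = p"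

text \<open>\<open>\<theta>\<close>, \<open>\<theta>'\<close> are values of the Bernoulli variables, \<open>v\<close> and \<open>v'\<close> the controls acting on the agents
  at \<open>x\<close> and \<open>y\<close>.\<close>

definition interaction_kernel ::
    "(real ^ 'd \<Rightarrow> real ^ 'd) \<Rightarrow> ('d::finite \<Rightarrow> real ^ 'd \<Rightarrow> real ^ 'd) \<Rightarrow>
     real \<Rightarrow> real \<Rightarrow> real ^ 'd \<Rightarrow> real ^ 'd \<Rightarrow> real ^ 'd \<Rightarrow> real ^ 'd \<Rightarrow> real ^ 'd" where
  "interaction_kernel H G \<theta> \<theta>' v v' x y =
     ((1 - \<theta>) * (1 - \<theta>')) *\<^sub>R H (x - y)
     + (((1 - \<theta>) * \<theta>') *\<^sub>R (\<Sum>l\<in>UNIV. (v' $ l) *\<^sub>R G l (x - y)) + \<theta> *\<^sub>R v)"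

definition post_interaction ::
    "(real ^ 'd \<Rightarrow> real ^ 'd) \<Rightarrow> ('d::finite \<Rightarrow> real ^ 'd \<Rightarrow> real ^ 'd) \<Rightarrow> real \<Rightarrow>
     real \<Rightarrow> real \<Rightarrow> real ^ 'd \<Rightarrow> real ^ 'd \<Rightarrow> real ^ 'd \<Rightarrow> real ^ 'd \<Rightarrow> real ^ 'd" where
  "post_interaction H G \<alpha> \<theta> \<theta>' v v' x y = x + \<alpha> *\<^sub>R interaction_kernel H G \<theta> \<theta>' v v' x y"

text \<open>The equation is understood in weak form, in which only the post-interaction state of the
  agent at \<open>x\<close> occurs.\<close>

definition boltzmann_weak_solution ::
    "'w measure \<Rightarrow> ('w \<Rightarrow> real) \<Rightarrow> ('w \<Rightarrow> real) \<Rightarrow>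
     (real ^ 'd \<Rightarrow> real ^ 'd) \<Rightarrow> ('d::finite \<Rightarrow> real ^ 'd \<Rightarrow> real ^ 'd) \<Rightarrow> real \<Rightarrow> real \<Rightarrow>
     (real \<Rightarrow> real ^ 'd) \<Rightarrow> (real \<Rightarrow> real ^ 'd) \<Rightarrow> real \<Rightarrow>
     (real ^ 'd) measure \<Rightarrow> (real \<Rightarrow> (real ^ 'd) measure) \<Rightarrow> bool" where
  "boltzmann_weak_solution P \<Theta> \<Theta>' H G \<alpha> \<eta> u u' T \<mu>0 \<mu> \<longleftrightarrow>
     \<mu> \<in> L2_P1 T \<and> \<mu> 0 = \<mu>0 \<and>
     (\<forall>\<phi>\<in>test_functions.
        has_time_derivative T (\<lambda>t. \<integral>x. \<phi> x \<partial>\<mu> t)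
          (\<lambda>t. \<eta> * (\<integral>\<omega>. (\<integral>y. (\<integral>x.
             (\<phi> (post_interaction H G \<alpha> (\<Theta> \<omega>) (\<Theta>' \<omega>) (u t) (u' t) x y) - \<phi> x)
               \<partial>\<mu> t) \<partial>\<mu> t) \<partial>P)))"


section \<open>The mean-field equation\<close>

definition averaged_kernel ::
    "'w measure \<Rightarrow> ('w \<Rightarrow> real) \<Rightarrow> ('w \<Rightarrow> real) \<Rightarrow>
     (real ^ 'd \<Rightarrow> real ^ 'd) \<Rightarrow> ('d::finite \<Rightarrow> real ^ 'd \<Rightarrow> real ^ 'd) \<Rightarrow>
     real ^ 'd \<Rightarrow> real ^ 'd \<Rightarrow> real ^ 'd \<Rightarrow> real ^ 'd \<Rightarrow> real ^ 'd" where
  "averaged_kernel P \<Theta> \<Theta>' H G v v' x y =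
     (\<integral>\<omega>. interaction_kernel H G (\<Theta> \<omega>) (\<Theta>' \<omega>) v v' x y \<partial>P)"

text \<open>Weak form of the nonlocal transport equation with velocity field \<open>\<integral> \<kappa> t x y \<mu>(dy,t)\<close>.\<close>

definition mean_field_weak_solution ::
    "(real \<Rightarrow> real ^ 'd \<Rightarrow> real ^ 'd \<Rightarrow> real ^ 'd) \<Rightarrow> real \<Rightarrow>
     (real ^ 'd::finite) measure \<Rightarrow> (real \<Rightarrow> (real ^ 'd) measure) \<Rightarrow> bool" where
  "mean_field_weak_solution \<kappa> T \<mu>0 \<mu> \<longleftrightarrow>
     \<mu> \<in> L2_P1 T \<and> \<mu> 0 = \<mu>0 \<and>
     (\<forall>\<phi>\<in>test_functions.
        has_time_derivative T (\<lambda>t. \<integral>x. \<phi> x \<partial>\<mu> t)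
          (\<lambda>t. \<integral>x. gradient \<phi> x \<bullet> (\<integral>y. \<kappa> t x y \<partial>\<mu> t) \<partial>\<mu> t))"

end

theory Submission
  imports Defs
begin

text \<open>With collision strength \<open>\<epsilon>\<close> and frequency \<open>1 / \<epsilon>\<close>, an agent undergoes frequent small jumps.  The kernel is
bounded by a constant \<open>C\<close>, because \<open>H\<close> and \<open>G\<close> are bounded and the controls stay in a compact set; so a
jump has length at most \<open>\<epsilon> * C\<close>, and the mean of a test function \<open>\<phi>\<close> changes at a rate of at most \<open>C\<close> times
the Lipschitz constant of \<open>\<phi>\<close>, whatever \<open>\<epsilon>\<close> is.  The theorem follows from compactness, and from the Taylor
expansion of \<open>\<phi>\<close> along a jump, which turns the collision integral into the transport term.

Compactness in space needs uniform integrability of the first moments.  It is obtained by testing with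
\<open>soft_norm R\<close>, that is \<open>sqrt (R\<^sup>2 + x \<bullet> x) - R\<close>: it behaves like the norm far away, but, given a bound
on the first moment, the jumps raise its mean at a rate of order \<open>1 / R\<close> only
(\<open>boltzmann_moment_estimate\<close>, \<open>boltzmann_uniform_tails\<close>).  Tightness yields weak limits, by a reduction
to Helly's theorem on the real line along a space-filling curve
(\<open>tight_imp_weakly_convergent_subsequence\<close>), and uniform integrability upgrades weak convergence to
convergence in \<^term>\<open>P1\<close>.

Compactness in time is the diagonal argument of Arzela and Ascoli (\<open>P1_curves_compact\<close>): one subsequence
serves all times, since the curves of integrals of a fixed test function are equi-Lipschitz
(\<open>boltzmann_time_lipschitz\<close>).

To identify the limit, fix a time.  The expectation over \<open>\<Theta>\<close> and \<open>\<Theta>'\<close> is a sum of four terms, each of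
which converges (\<open>collision_limit\<close>): the Taylor remainder and the deviation of the controls from their
limits tend to \<open>0\<close> uniformly in space, and integrals of a bounded continuous function against the product
measures converge (\<open>P1_tendsto_pair\<close>).  Dominated convergence then passes to the limit in the equation
integrated over \<open>[0, t]\<close>.\<close>

section \<open>A class of smooth functions\<close>

text \<open>The case \<open>n = 0\<close> is the classical flat function \<open>exp (- 1 / s)\<close>.  The negative powers make the family
closed under differentiation up to linear combinations.\<close>

definition exp_flat :: "nat \<Rightarrow> real \<Rightarrow> real" where
  "exp_flat n s = (if 0 < s then exp (- 1 / s) / s ^ n else 0)"

text \<open>Exponential decay beats every power: one term of the series of \<open>exp (1 / s)\<close> gives the bound.  The
quadratic order at \<open>0\<close> is what differentiability of all members of the family at \<open>0\<close> requires.\<close>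

lemma exp_flat_bound: "\<bar>exp_flat n s\<bar> \<le> fact (n + 2) * s\<^sup>2"
proof (cases "0 < s")
  case True
  have "(1 / s) ^ (n + 2) / fact (n + 2) \<le> exp (1 / s)"
  proof -
    have "(1 / s) ^ (n + 2) /\<^sub>R fact (n + 2) \<le> (\<Sum>k. (1 / s) ^ k /\<^sub>R fact k)"
      using True sum_le_suminf[of "\<lambda>k. (1 / s) ^ k /\<^sub>R fact k" "{n + 2}"] summable_exp_generic[of "1 / s"]
      by simp
    then show ?thesis by (simp add: exp_def divide_inverse mult.commute)
  qed
  then have "1 / (s ^ n * exp (1 / s)) \<le> fact (n + 2) * s\<^sup>2"
    using True by (simp add: field_simps power_add power2_eq_square del: fact_Suc)
  then show ?thesis
    using True by (simp add: exp_flat_def exp_minus field_simps del: fact_Suc)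
qed (simp add: exp_flat_def)

lemma exp_flat_has_derivative:
  "(exp_flat n has_real_derivative (exp_flat (n + 2) s - real n * exp_flat (n + 1) s)) (at s)"
proof -
  consider "s < 0" | "s = 0" | "0 < s" by linarith
  then show ?thesis
  proof cases
    case 1
    have "(exp_flat n has_real_derivative 0) (at s)"
      by (rule has_field_derivative_transform_within_open[OF DERIV_const[of 0] open_lessThan[of 0]])
        (use 1 in \<open>auto simp: exp_flat_def\<close>)
    then show ?thesis using 1 by (simp add: exp_flat_def)
  next
    case 2
    have "((\<lambda>h. (exp_flat n (0 + h) - exp_flat n 0) / h) \<longlongrightarrow> 0) (at 0)"
    proof (rule Lim_null_comparison)
      show "\<forall>\<^sub>F h in at 0. norm ((exp_flat n (0 + h) - exp_flat n 0) / h) \<le> fact (n + 2) * \<bar>h\<bar>"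
      proof (rule eventually_at_filter[THEN iffD2], rule always_eventually, safe)
        fix h :: real assume "h \<noteq> 0"
        then show "norm ((exp_flat n (0 + h) - exp_flat n 0) / h) \<le> fact (n + 2) * \<bar>h\<bar>"
          using exp_flat_bound[of n h]
          by (simp add: exp_flat_def[of n 0] pos_divide_le_eq power2_eq_square mult.assoc del: fact_Suc)
      qed
      show "((\<lambda>h::real. fact (n + 2) * \<bar>h\<bar>) \<longlongrightarrow> 0) (at 0)"
        by (auto intro!: tendsto_eq_intros)
    qed
    then show ?thesis using 2 by (simp add: DERIV_def exp_flat_def)
  next
    case 3
    have "((\<lambda>s. exp (- 1 / s) / s ^ n) has_real_derivative (exp_flat (n + 2) s - real n * exp_flat (n + 1) s)) (at s)"
    proof (cases n)
      case (Suc m)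
      have "((\<lambda>s. exp (- 1 / s)) has_real_derivative exp (- 1 / s) / s\<^sup>2) (at s)"
        using 3 by (auto intro!: derivative_eq_intros simp: power2_eq_square)
      from DERIV_divide[OF this DERIV_power_Suc[OF DERIV_ident, of m]]
      have "((\<lambda>s. exp (- 1 / s) / s ^ n) has_real_derivative
          (exp (- 1 / s) / s\<^sup>2 * s ^ n - exp (- 1 / s) * (real n * s ^ m)) / (s ^ n * s ^ n)) (at s)"
        using 3 Suc by (simp add: mult_ac)
      also have "(exp (- 1 / s) / s\<^sup>2 * s ^ n - exp (- 1 / s) * (real n * s ^ m)) / (s ^ n * s ^ n) =
          exp_flat (n + 2) s - real n * exp_flat (n + 1) s"
        using 3 Suc by (simp add: exp_flat_def divide_simps power2_eq_square) (simp add: algebra_simps)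
      finally show ?thesis .
    qed (use 3 in \<open>auto intro!: derivative_eq_intros simp: exp_flat_def field_simps power2_eq_square\<close>)
    from has_field_derivative_transform_within_open[OF this open_greaterThan[of 0]] 3
    show ?thesis by (simp add: exp_flat_def)
  qed
qed

lemma exp_flat_0_bounds: "0 \<le> exp_flat 0 s" "exp_flat 0 s \<le> 1"
  by (auto simp: exp_flat_def)

lemma exp_flat_0_lipschitz: "\<bar>exp_flat 0 s - exp_flat 0 r\<bar> \<le> 2 * \<bar>s - r\<bar>"
proof -
  have "\<bar>exp_flat (0 + 2) x - real 0 * exp_flat (0 + 1) x\<bar> \<le> 2" for x
  proof (cases "0 < x")
    case True
    have "(1 / x)\<^sup>2 / 2 \<le> exp (1 / x)"
      using exp_lower_Taylor_quadratic[of "1 / x"] True zero_less_divide_1_iff[of x] by linarith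
    then have "1 \<le> 2 * x\<^sup>2 * exp (1 / x)"
      using True by (simp add: field_simps)
    then show ?thesis
      using True by (simp add: exp_flat_def exp_minus field_simps power2_eq_square)
  qed (simp add: exp_flat_def)
  then show ?thesis
    using field_differentiable_bound[where S = UNIV and f = "exp_flat 0" and B = 2 and x = s and y = r]
      exp_flat_has_derivative[of 0] by (auto simp: norm_minus_commute)
qed

text \<open>A class that contains every explicit function used for testing below, and all partial derivatives of its
members.  This closure replaces a calculus of higher derivatives in proofs of smoothness.  The
constructor \<open>inv_root\<close> serves the functions \<open>soft_norm\<close>, the constructor \<open>bump\<close> cuts off at finite
distance.\<close>

inductive_set elementary :: "(real ^ 'd::finite \<Rightarrow> real) set" where
  const: "(\<lambda>x. c) \<in> elementary"
| coord: "(\<lambda>x. x $ i) \<in> elementary"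
| add: "f \<in> elementary \<Longrightarrow> g \<in> elementary \<Longrightarrow> (\<lambda>x. f x + g x) \<in> elementary"
| mult: "f \<in> elementary \<Longrightarrow> g \<in> elementary \<Longrightarrow> (\<lambda>x. f x * g x) \<in> elementary"
| inv_root: "0 < c \<Longrightarrow> (\<lambda>x. 1 / sqrt (c + x \<bullet> x)) \<in> elementary"
| bump: "(\<lambda>x. exp_flat n (1 - k * (x \<bullet> x))) \<in> elementary"

lemma elementary_sum:
  "finite I \<Longrightarrow> (\<And>i. i \<in> I \<Longrightarrow> f i \<in> elementary) \<Longrightarrow> (\<lambda>x. \<Sum>i\<in>I. f i x) \<in> elementary"
  by (induction I rule: finite_induct) (auto intro: elementary.intros)

lemma elementary_inner: "(\<lambda>x. x \<bullet> x) \<in> elementary"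
  unfolding inner_vec_def inner_real_def by (intro elementary_sum elementary.intros) auto

text \<open>Since the gradient \<open>g\<close> is found inside the class again, differentiation can be iterated.\<close>

lemma elementary_has_derivative:
  fixes f :: "real ^ 'd::finite \<Rightarrow> real"
  assumes "f \<in> elementary"
  shows "\<exists>g. (\<forall>i. g i \<in> elementary) \<and>
    (\<forall>x. (f has_derivative (\<lambda>h. \<Sum>i\<in>UNIV. g i x * h $ i)) (at x))"
  using assms
proof induction
  case (const c)
  show ?case
    by (rule exI[of _ "\<lambda>i x. 0"]) (simp add: elementary.const)
next
  case (coord j)
  have "((\<lambda>x. x $ j) has_derivative (\<lambda>h. \<Sum>i\<in>UNIV. (if i = j then 1 else 0) * h $ i)) (at x)"
    for x :: "real ^ 'd"
    using bounded_linear.has_derivative[OF bounded_linear_vec_nth has_derivative_ident]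
    by (simp add: if_distrib[where f = "\<lambda>c. c * _"] sum.delta' cong: if_cong)
  then show ?case
    by (intro exI[of _ "\<lambda>i x. if i = j then 1 else 0"]) (auto simp: elementary.const)
next
  case (add f1 f2)
  obtain g1 where g1: "\<And>i. g1 i \<in> elementary"
    "\<And>x. (f1 has_derivative (\<lambda>h. \<Sum>i\<in>UNIV. g1 i x * h $ i)) (at x)"
    using add.IH(1) by blast
  obtain g2 where g2: "\<And>i. g2 i \<in> elementary"
    "\<And>x. (f2 has_derivative (\<lambda>h. \<Sum>i\<in>UNIV. g2 i x * h $ i)) (at x)"
    using add.IH(2) by blast
  show ?case
  proof (rule exI[of _ "\<lambda>i x. g1 i x + g2 i x"], intro conjI allI)
    fix x
    show "((\<lambda>x. f1 x + f2 x) has_derivative (\<lambda>h. \<Sum>i\<in>UNIV. (g1 i x + g2 i x) * h $ i)) (at x)"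
      using has_derivative_add[OF g1(2) g2(2), of x] by (simp add: algebra_simps sum.distrib)
  qed (intro elementary.intros g1 g2)
next
  case (mult f1 f2)
  obtain g1 where g1: "\<And>i. g1 i \<in> elementary"
    "\<And>x. (f1 has_derivative (\<lambda>h. \<Sum>i\<in>UNIV. g1 i x * h $ i)) (at x)"
    using mult.IH(1) by blast
  obtain g2 where g2: "\<And>i. g2 i \<in> elementary"
    "\<And>x. (f2 has_derivative (\<lambda>h. \<Sum>i\<in>UNIV. g2 i x * h $ i)) (at x)"
    using mult.IH(2) by blast
  show ?case
  proof (rule exI[of _ "\<lambda>i x. f1 x * g2 i x + g1 i x * f2 x"], intro conjI allI)
    fix x
    show "((\<lambda>x. f1 x * f2 x) has_derivative
        (\<lambda>h. \<Sum>i\<in>UNIV. (f1 x * g2 i x + g1 i x * f2 x) * h $ i)) (at x)"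
      using has_derivative_mult[OF g1(2) g2(2), of x]
      by (simp add: algebra_simps sum.distrib sum_distrib_left)
  qed (intro elementary.intros g1 g2 mult)
next
  case (inv_root c)
  let ?r = "\<lambda>x :: real ^ 'd. 1 / sqrt (c + x \<bullet> x)"
  show ?case
  proof (rule exI[of _ "\<lambda>i x. (-1) * (x $ i * (?r x * (?r x * ?r x)))"], intro conjI allI)
    fix x :: "real ^ 'd"
    have pos: "0 < c + x \<bullet> x" using inv_root inner_ge_zero[of x] by linarith
    have "(?r has_derivative (\<lambda>h. - ((x \<bullet> h) * (?r x * (?r x * ?r x))))) (at x)"
      using pos by (auto intro!: derivative_eq_intros simp: inner_commute field_simps)
    moreover have "(\<lambda>h. - ((x \<bullet> h) * (?r x * (?r x * ?r x)))) =
        (\<lambda>h. \<Sum>i\<in>UNIV. ((-1) * (x $ i * (?r x * (?r x * ?r x)))) * h $ i)"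
    proof
      fix h :: "real ^ 'd"
      have "- ((x \<bullet> h) * m) = (\<Sum>i\<in>UNIV. ((-1) * (x $ i * m)) * h $ i)" for m
        by (simp add: inner_vec_def sum_distrib_left sum_negf mult_ac)
      then show "- ((x \<bullet> h) * (?r x * (?r x * ?r x))) =
          (\<Sum>i\<in>UNIV. ((-1) * (x $ i * (?r x * (?r x * ?r x)))) * h $ i)" .
    qed
    ultimately show "(?r has_derivative
        (\<lambda>h. \<Sum>i\<in>UNIV. ((-1) * (x $ i * (?r x * (?r x * ?r x)))) * h $ i)) (at x)"
      by simp
  qed (intro elementary.intros inv_root)
next
  case (bump n k)
  let ?d = "\<lambda>x :: real ^ 'd. exp_flat (n + 2) (1 - k * (x \<bullet> x)) + (- real n) * exp_flat (n + 1) (1 - k * (x \<bullet> x))"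
  show ?case
  proof (rule exI[of _ "\<lambda>i x. ((- 2 * k) * x $ i) * ?d x"], intro conjI allI)
    fix x :: "real ^ 'd"
    have 1: "((\<lambda>x. 1 - k * (x \<bullet> x)) has_derivative (\<lambda>h. (- 2 * k) * (x \<bullet> h))) (at x)"
      by (auto intro!: derivative_eq_intros simp: inner_commute)
    have 2: "(exp_flat n has_derivative (\<lambda>h. ?d x * h)) (at (1 - k * (x \<bullet> x)))"
      using exp_flat_has_derivative[of n "1 - k * (x \<bullet> x)"]
      by (simp add: has_field_derivative_def)
    have "((\<lambda>x. exp_flat n (1 - k * (x \<bullet> x))) has_derivative
        (\<lambda>h. ?d x * ((- 2 * k) * (x \<bullet> h)))) (at x)"
      using has_derivative_compose[OF 1 2] by simp
    moreover have "(\<lambda>h. ?d x * ((- 2 * k) * (x \<bullet> h))) =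
        (\<lambda>h. \<Sum>i\<in>UNIV. (((- 2 * k) * x $ i) * ?d x) * h $ i)"
    proof
      fix h :: "real ^ 'd"
      have "m * ((- 2 * k) * (x \<bullet> h)) = (\<Sum>i\<in>UNIV. (((- 2 * k) * x $ i) * m) * h $ i)" for m
        by (simp add: inner_vec_def sum_distrib_left mult_ac)
      then show "?d x * ((- 2 * k) * (x \<bullet> h)) = (\<Sum>i\<in>UNIV. (((- 2 * k) * x $ i) * ?d x) * h $ i)" .
    qed
    ultimately show "((\<lambda>x. exp_flat n (1 - k * (x \<bullet> x))) has_derivative
        (\<lambda>h. \<Sum>i\<in>UNIV. (((- 2 * k) * x $ i) * ?d x) * h $ i)) (at x)"
      by simp
  qed (intro elementary.intros)
qed

lemma elementary_differentiable: "f \<in> elementary \<Longrightarrow> f differentiable_on UNIV"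
  using elementary_has_derivative[of f]
  by (auto simp: differentiable_on_def differentiable_def)

lemma elementary_partial_derivative:
  assumes "f \<in> elementary"
  shows "partial_derivative i f \<in> elementary"
proof -
  obtain g where g: "\<And>i. g i \<in> elementary"
    "\<And>x. (f has_derivative (\<lambda>h. \<Sum>i\<in>UNIV. g i x * h $ i)) (at x)"
    using elementary_has_derivative[OF assms] by metis
  have "partial_derivative i f x = g i x" for x
    unfolding partial_derivative_def frechet_derivative_at[OF g(2), symmetric]
    by (simp add: axis_def if_distrib[where f = "\<lambda>c. _ * c"] sum.delta cong: if_cong)
  then have "partial_derivative i f = g i" by blast
  then show ?thesis using g(1) by simp
qed

lemma elementary_smooth:
  assumes "f \<in> elementary"
  shows "smooth_fun f"
proof -
  have "fold partial_derivative is f \<in> elementary" for "is"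
    using assms by (induction "is" arbitrary: f) (auto intro: elementary_partial_derivative)
  then show ?thesis
    unfolding smooth_fun_def by (auto intro: elementary_differentiable)
qed

lemma elementary_polynomial:
  assumes "real_polynomial_function q"
  shows "q \<in> elementary"
  using assms
proof induction
  case (linear f)
  then interpret bounded_linear f .
  have "f x = (\<Sum>i\<in>UNIV. f (axis i 1) * x $ i)" for x
  proof -
    have "x = (\<Sum>i\<in>UNIV. x $ i *\<^sub>R axis i 1)"
      by (simp add: vec_eq_iff axis_def if_distrib sum.delta cong: if_cong)
    then have "f x = (\<Sum>i\<in>UNIV. f (x $ i *\<^sub>R axis i 1))"
      using sum by metis
    then show ?thesis by (simp add: scaleR mult.commute)
  qed
  then have "f = (\<lambda>x. \<Sum>i\<in>UNIV. f (axis i 1) * x $ i)" by blast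
  then show ?case
    using elementary_sum[of UNIV "\<lambda>i x. f (axis i 1) * x $ i"]
    by (simp add: elementary.intros)
qed (auto intro: elementary.intros)

section \<open>Test functions\<close>

lemma test_function_bump_times:
  assumes "f \<in> elementary" "k > 0"
  shows "(\<lambda>x. exp_flat n (1 - k * (x \<bullet> x)) * f x) \<in> test_functions"
  unfolding test_functions_def
proof (intro CollectI conjI)
  show "smooth_fun (\<lambda>x. exp_flat n (1 - k * (x \<bullet> x)) * f x)"
    using assms by (intro elementary_smooth elementary.intros)
  have "{x. exp_flat n (1 - k * (x \<bullet> x)) * f x \<noteq> 0} \<subseteq> cball 0 (1 / sqrt k)"
  proof
    fix x assume "x \<in> {x. exp_flat n (1 - k * (x \<bullet> x)) * f x \<noteq> 0}"
    then have "0 < 1 - k * (x \<bullet> x)" by (auto simp: exp_flat_def split: if_splits)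
    then have "(sqrt k * norm x)\<^sup>2 \<le> 1\<^sup>2"
      using assms(2) by (simp add: dot_square_norm power_mult_distrib)
    then have "sqrt k * norm x \<le> 1" by (rule power2_le_imp_le) simp
    then show "x \<in> cball 0 (1 / sqrt k)"
      using assms(2) by (simp add: field_simps)
  qed
  then have "bounded {x. exp_flat n (1 - k * (x \<bullet> x)) * f x \<noteq> 0}"
    by (rule bounded_subset[OF bounded_cball])
  then show "compact (closure {x. exp_flat n (1 - k * (x \<bullet> x)) * f x \<noteq> 0})"
    by (simp add: compact_closure)
qed

text \<open>Divide \<open>f\<close> by a bump \<open>\<zeta>\<close> that is positive on a ball of twice the radius of the support, approximate
the quotient there by a polynomial (Stone-Weierstrass), and multiply back: since \<open>\<zeta>\<close> is at most \<open>1\<close>,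
the error does not grow, and outside that ball both functions vanish.\<close>

lemma test_functions_dense:
  fixes f :: "real ^ 'd::finite \<Rightarrow> real"
  assumes f: "continuous_on UNIV f" and supp: "\<And>x. R \<le> norm x \<Longrightarrow> f x = 0"
    and R: "R > 0" and e: "e > 0"
  obtains \<phi> where "\<phi> \<in> test_functions" "\<And>x. \<bar>f x - \<phi> x\<bar> < e"
proof -
  define k where "k = 1 / (4 * R\<^sup>2)"
  have k: "k > 0" using R by (simp add: k_def)
  define \<zeta> :: "real ^ 'd \<Rightarrow> real" where "\<zeta> x = exp_flat 0 (1 - k * (x \<bullet> x))" for x
  have \<zeta>: "0 \<le> \<zeta> x" "\<zeta> x \<le> 1" for x
    using exp_flat_0_bounds by (auto simp: \<zeta>_def)
  have pos: "0 < \<zeta> x" if "norm x < 2 * R" for x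
  proof -
    have "(norm x)\<^sup>2 < (2 * R)\<^sup>2" using that by (intro power_strict_mono) auto
    then have "k * (x \<bullet> x) < 1"
      using R by (simp add: k_def dot_square_norm power_mult_distrib)
    then show ?thesis by (simp add: \<zeta>_def exp_flat_def)
  qed
  have zero: "\<zeta> x = 0" if "2 * R \<le> norm x" for x
  proof -
    have "(2 * R)\<^sup>2 \<le> (norm x)\<^sup>2" using that R by (intro power_mono) auto
    then have "1 \<le> k * (x \<bullet> x)"
      using R by (simp add: k_def dot_square_norm power_mult_distrib)
    then show ?thesis by (simp add: \<zeta>_def exp_flat_def)
  qed
  have "continuous_on UNIV (exp_flat 0)"
    using exp_flat_has_derivative by (intro continuous_at_imp_continuous_on ballI DERIV_isCont) blast
  then have cont_\<zeta>: "continuous_on S \<zeta>" for S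
    unfolding \<zeta>_def
    by (rule continuous_on_compose2[of UNIV "exp_flat 0" S "\<lambda>x. 1 - k * (x \<bullet> x)"])
      (intro continuous_intros subset_UNIV)+
  define h where "h x = f x / \<zeta> x" for x
  have h0: "h x = 0" if "R \<le> norm x" for x using supp[OF that] by (simp add: h_def)
  have "continuous_on (ball 0 (2 * R) \<union> {x. R < norm x}) h"
  proof (rule continuous_on_open_Un)
    show "continuous_on (ball 0 (2 * R)) h"
      unfolding h_def
    proof (intro continuous_on_divide cont_\<zeta> continuous_on_subset[OF f] subset_UNIV ballI)
      fix x :: "real ^ 'd" assume "x \<in> ball 0 (2 * R)"
      then show "\<zeta> x \<noteq> 0" using pos[of x] by simp
    qed
    show "continuous_on {x. R < norm x} h"
      by (rule continuous_on_eq[OF continuous_on_const[of _ 0]]) (simp add: h0)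
    show "open {x::real ^ 'd. R < norm x}"
      by (intro open_Collect_less continuous_intros)
  qed auto
  moreover have "ball 0 (2 * R) \<union> {x::real ^ 'd. R < norm x} = UNIV"
    using R by auto
  ultimately have "continuous_on (cball 0 (2 * R)) h"
    by (metis continuous_on_subset subset_UNIV)
  then obtain q where q: "real_polynomial_function q"
    "\<And>x. x \<in> cball 0 (2 * R) \<Longrightarrow> \<bar>h x - q x\<bar> < e"
    using Stone_Weierstrass_real_polynomial_function[OF compact_cball _ e] by metis
  show thesis
  proof (rule that)
    show "(\<lambda>x. \<zeta> x * q x) \<in> test_functions"
      unfolding \<zeta>_def using k q by (intro test_function_bump_times elementary_polynomial)
    fix x
    show "\<bar>f x - \<zeta> x * q x\<bar> < e"
    proof (cases "norm x < 2 * R")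
      case True
      then have "f x - \<zeta> x * q x = \<zeta> x * (h x - q x)"
        using pos[OF True] by (simp add: h_def field_simps)
      then have "\<bar>f x - \<zeta> x * q x\<bar> \<le> 1 * \<bar>h x - q x\<bar>"
        using \<zeta>[of x] by (simp only: abs_mult) (intro mult_right_mono, auto)
      then show ?thesis using q(2)[of x] True by simp
    next
      case False
      then show ?thesis using zero[of x] supp[of x] R e by simp
    qed
  qed
qed

lemma test_function_partial_derivative:
  assumes "\<phi> \<in> test_functions"
  shows "partial_derivative i \<phi> \<in> test_functions"
proof -
  have sm: "fold partial_derivative is \<phi> differentiable_on UNIV" for "is"
    using assms by (auto simp: test_functions_def smooth_fun_def)
  have "fold partial_derivative is (partial_derivative i \<phi>) differentiable_on UNIV" for "is"
    using sm[of "i # is"] by simp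
  moreover have "partial_derivative i \<phi> x = 0" if "x \<notin> closure {x. \<phi> x \<noteq> 0}" for x
  proof -
    have "(\<phi> has_derivative (\<lambda>h. 0)) (at x)"
      by (rule has_derivative_transform_within_open[of "\<lambda>x. 0" _ _ _ "- closure {x. \<phi> x \<noteq> 0}"])
        (use that closure_subset[of "{x. \<phi> x \<noteq> 0}"] in auto)
    then show ?thesis
      unfolding partial_derivative_def by (simp add: frechet_derivative_at[symmetric])
  qed
  then have "closure {x. partial_derivative i \<phi> x \<noteq> 0} \<subseteq> closure {x. \<phi> x \<noteq> 0}"
    by (intro closure_minimal) auto
  moreover have "compact (closure {x. \<phi> x \<noteq> 0})"
    using assms by (simp add: test_functions_def)
  ultimately show ?thesis
    unfolding test_functions_def smooth_fun_def
    by (auto dest: bounded_subset compact_imp_bounded simp: compact_eq_bounded_closed)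
qed

lemma test_function_continuous: "\<phi> \<in> test_functions \<Longrightarrow> continuous_on UNIV \<phi>"
  using differentiable_imp_continuous_on[of \<phi> UNIV]
  by (auto simp: test_functions_def smooth_fun_def dest: spec[of _ "[]"])

lemma test_function_bounded:
  assumes "\<phi> \<in> test_functions"
  shows "\<exists>B. \<forall>x. \<bar>\<phi> x\<bar> \<le> B"
proof -
  let ?S = "closure {x. \<phi> x \<noteq> 0}"
  have "compact (\<phi> ` ?S)"
    using assms test_function_continuous[OF assms]
    by (intro compact_continuous_image) (auto simp: test_functions_def intro: continuous_on_subset)
  then obtain B where B: "\<And>y. y \<in> \<phi> ` ?S \<Longrightarrow> norm y \<le> B"
    using compact_imp_bounded bounded_iff by metis
  show ?thesis
  proof (intro exI[of _ "max B 0"] allI)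
    fix x show "\<bar>\<phi> x\<bar> \<le> max B 0"
      using B[of "\<phi> x"] closure_subset[of "{x. \<phi> x \<noteq> 0}"] by (cases "\<phi> x = 0") force+
  qed
qed

lemma test_function_has_derivative:
  assumes "\<phi> \<in> test_functions"
  shows "(\<phi> has_derivative (\<lambda>h. gradient \<phi> x \<bullet> h)) (at x)"
proof -
  have d: "(\<phi> has_derivative frechet_derivative \<phi> (at x)) (at x)"
    using assms unfolding frechet_derivative_works[symmetric]
    by (auto simp: test_functions_def smooth_fun_def differentiable_on_def dest: spec[of _ "[]"])
  then interpret bounded_linear "frechet_derivative \<phi> (at x)"
    by (rule has_derivative_bounded_linear)
  have "frechet_derivative \<phi> (at x) h = gradient \<phi> x \<bullet> h" for h
  proof -
    have "h = (\<Sum>i\<in>UNIV. h $ i *\<^sub>R axis i 1)"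
      by (simp add: vec_eq_iff axis_def if_distrib sum.delta cong: if_cong)
    then have "frechet_derivative \<phi> (at x) h = (\<Sum>i\<in>UNIV. frechet_derivative \<phi> (at x) (h $ i *\<^sub>R axis i 1))"
      using sum by metis
    then show ?thesis
      by (simp add: scaleR gradient_def partial_derivative_def inner_vec_def mult.commute)
  qed
  then have "frechet_derivative \<phi> (at x) = (\<lambda>h. gradient \<phi> x \<bullet> h)" by blast
  then show ?thesis using d by simp
qed

text \<open>The components of the gradient are test functions, hence bounded.\<close>

lemma test_function_lipschitz:
  assumes "\<phi> \<in> test_functions"
  shows "\<exists>L\<ge>0. (\<forall>x. norm (gradient \<phi> x) \<le> L) \<and> (\<forall>x y. \<bar>\<phi> x - \<phi> y\<bar> \<le> L * norm (x - y))"
proof -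
  have "\<exists>B. \<forall>x. \<bar>partial_derivative i \<phi> x\<bar> \<le> B" for i
    using test_function_bounded[OF test_function_partial_derivative[OF assms, of i]] by metis
  then obtain B where B: "\<And>i x. \<bar>partial_derivative i \<phi> x\<bar> \<le> B i" by metis
  define L where "L = (\<Sum>i\<in>UNIV. B i)"
  have L: "norm (gradient \<phi> x) \<le> L" for x
    using norm_le_l1_cart[of "gradient \<phi> x"] sum_mono[of UNIV "\<lambda>i. \<bar>gradient \<phi> x $ i\<bar>" B]
    by (auto simp: L_def gradient_def B)
  show ?thesis
  proof (intro exI[of _ L] conjI allI)
    show "0 \<le> L" using L[of 0] norm_ge_zero order_trans by blast
    fix x y
    have "onorm (\<lambda>h. gradient \<phi> z \<bullet> h) \<le> L" for z
      using L[of z] by (intro onorm_bound order_trans[OF Cauchy_Schwarz_ineq2[unfolded real_norm_def[symmetric]]])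
        (auto intro: mult_right_mono order_trans[OF norm_ge_zero])
    then show "\<bar>\<phi> x - \<phi> y\<bar> \<le> L * norm (x - y)"
      using differentiable_bound[of UNIV \<phi> "\<lambda>x h. gradient \<phi> x \<bullet> h" L x y]
        test_function_has_derivative[OF assms] by simp
  qed (rule L)
qed

text \<open>The components of the gradient are test functions, hence Lipschitz; this makes the remainder uniform
in \<open>x\<close>.\<close>

lemma test_function_taylor:
  assumes "\<phi> \<in> test_functions"
  shows "\<exists>M\<ge>0. \<forall>x h. \<bar>\<phi> (x + h) - \<phi> x - gradient \<phi> x \<bullet> h\<bar> \<le> M * (norm h)\<^sup>2"
proof -
  have "\<exists>L. \<forall>x y. \<bar>partial_derivative i \<phi> x - partial_derivative i \<phi> y\<bar> \<le> L * norm (x - y)" for i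
    using test_function_lipschitz[OF test_function_partial_derivative[OF assms, of i]] by metis
  then obtain L where L: "\<And>i x y. \<bar>partial_derivative i \<phi> x - partial_derivative i \<phi> y\<bar> \<le> L i * norm (x - y)"
    by metis
  define M where "M = \<bar>\<Sum>i\<in>UNIV. L i\<bar>"
  have M: "norm (gradient \<phi> x - gradient \<phi> y) \<le> M * norm (x - y)" for x y
  proof -
    have "norm (gradient \<phi> x - gradient \<phi> y) \<le> (\<Sum>i\<in>UNIV. \<bar>(gradient \<phi> x - gradient \<phi> y) $ i\<bar>)"
      by (rule norm_le_l1_cart)
    also have "\<dots> \<le> (\<Sum>i\<in>UNIV. L i * norm (x - y))"
      by (intro sum_mono) (simp add: gradient_def L)
    also have "\<dots> \<le> M * norm (x - y)"
      unfolding sum_distrib_right[symmetric] M_def by (intro mult_right_mono) auto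
    finally show ?thesis .
  qed
  show ?thesis
  proof (intro exI[of _ M] conjI allI)
    show "0 \<le> M" by (simp add: M_def)
    fix x h
    have "norm (\<phi> (x + h) - \<phi> x - gradient \<phi> x \<bullet> (x + h - x)) \<le> norm (x + h - x) * (M * norm h)"
    proof (rule differentiable_bound_linearization[where S = "closed_segment x (x + h)"
          and f' = "\<lambda>x h. gradient \<phi> x \<bullet> h"])
      show "(\<phi> has_derivative (\<lambda>h. gradient \<phi> z \<bullet> h)) (at z within closed_segment x (x + h))" for z
        by (rule has_derivative_at_withinI[OF test_function_has_derivative[OF assms]])
      fix z assume z: "z \<in> closed_segment x (x + h)"
      have "norm (z - x) \<le> norm h"
        using segment_bound(1)[OF z] by simp
      then have "M * norm (z - x) \<le> M * norm h"
        by (intro mult_left_mono) (auto simp: M_def)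
      then have *: "norm (gradient \<phi> z - gradient \<phi> x) \<le> M * norm h"
        using M[of z x] by linarith
      have "norm (gradient \<phi> z \<bullet> v - gradient \<phi> x \<bullet> v) \<le> M * norm h * norm v" for v
        using Cauchy_Schwarz_ineq2[of "gradient \<phi> z - gradient \<phi> x" v] mult_right_mono[OF * norm_ge_zero[of v]]
        by (simp add: inner_diff_left)
      then show "onorm ((\<lambda>v. gradient \<phi> z \<bullet> v) - (\<lambda>v. gradient \<phi> x \<bullet> v)) \<le> M * norm h"
        unfolding fun_diff_def by (intro onorm_bound) (auto simp: M_def)
    next
      fix t :: real assume "t \<in> {0..1}"
      then show "x + t *\<^sub>R (x + h - x) \<in> closed_segment x (x + h)"
        by (auto simp: in_segment algebra_simps)
    qed auto
    then show "\<bar>\<phi> (x + h) - \<phi> x - gradient \<phi> x \<bullet> h\<bar> \<le> M * (norm h)\<^sup>2"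
      by (simp add: power2_eq_square mult_ac)
  qed
qed

section \<open>A space-filling curve with a Borel section\<close>

text \<open>A continuous function of period \<open>2\<close> that reads off a ternary digit: it is \<open>0\<close> on \<open>[0, 1/3]\<close> and \<open>1\<close> on
\<open>[2/3, 1]\<close>.\<close>

definition digit_wave :: "real \<Rightarrow> real" where
  "digit_wave y = max 0 (min 1 (1 / 2 - cos (pi * y)))"

lemma digit_wave_bounds: "0 \<le> digit_wave y" "digit_wave y \<le> 1"
  by (auto simp: digit_wave_def)

lemma continuous_on_digit_wave: "continuous_on S digit_wave"
  unfolding digit_wave_def by (intro continuous_intros)

lemma digit_wave_even_shift: "digit_wave (2 * real m + s) = digit_wave s"
proof -
  have "pi * (2 * real m + s) = 2 * real m * pi + pi * s" by (simp add: algebra_simps)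
  then have "cos (pi * (2 * real m + s)) = cos (pi * s)"
    by (simp only: cos_add cos_2npi sin_2npi)
  then show ?thesis by (simp only: digit_wave_def)
qed

lemma digit_wave_low: "0 \<le> s \<Longrightarrow> s \<le> 1 / 3 \<Longrightarrow> digit_wave s = 0"
  using cos_monotone_0_pi_le[of "pi * s" "pi / 3"] mult_left_mono[of s "1/3" pi]
  by (auto simp: digit_wave_def cos_60)

lemma digit_wave_high: "2 / 3 \<le> s \<Longrightarrow> s \<le> 1 \<Longrightarrow> digit_wave s = 1"
  using cos_monotone_0_pi_le[of "2 * pi / 3" "pi * s"] mult_left_mono[of "2/3" s pi] mult_left_mono[of s 1 pi]
  by (auto simp: digit_wave_def cos_120)

text \<open>The point of the Cantor set with ternary digits \<open>2 * a n\<close> has this property: up to an even integer,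
\<open>3 ^ n * t\<close> is the point \<open>T n\<close> of the Cantor set whose digits are those of \<open>t\<close> from position \<open>n\<close> on.\<close>

lemma digit_wave_prescribed:
  fixes a :: "nat \<Rightarrow> bool"
  obtains t where "t \<in> {0..1}" "\<And>n. digit_wave (3 ^ n * t) = of_bool (a n)"
proof -
  define T where "T n = (\<Sum>k. 2 * of_bool (a (n + k)) / 3 ^ Suc k :: real)" for n
  have geo: "(\<lambda>k. 2 / 3 * (1 / 3) ^ k) sums (1::real)"
    using sums_mult[OF geometric_sums[of "1/3::real"], of "2/3"] by simp
  have le: "2 * of_bool (a (n + k)) / 3 ^ Suc k \<le> 2 / 3 * (1 / 3 :: real) ^ k" for n k
    by (simp add: power_one_over field_simps)
  have summ: "summable (\<lambda>k. 2 * of_bool (a (n + k)) / 3 ^ Suc k :: real)" for n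
    by (rule summable_comparison_test'[OF sums_summable[OF geo], of 0]) (use le in auto)
  have T_nonneg: "0 \<le> T n" for n
    unfolding T_def by (rule suminf_nonneg[OF summ]) auto
  have T_le: "T n \<le> 1" for n
    unfolding T_def using suminf_le[OF le summ sums_summable[OF geo]] sums_unique[OF geo] by simp
  have T_step: "T n = 2 * of_bool (a n) / 3 + T (Suc n) / 3" for n
  proof -
    have "T n = (\<Sum>k. 2 * of_bool (a (n + Suc k)) / 3 ^ Suc (Suc k)) + 2 * of_bool (a n) / 3"
      unfolding T_def using suminf_split_head[OF summ[of n]] by simp
    also have "(\<Sum>k. 2 * of_bool (a (n + Suc k)) / 3 ^ Suc (Suc k)) = T (Suc n) / (3::real)"
      unfolding T_def using suminf_divide[OF summ[of "Suc n"], of 3] by (simp add: mult_ac)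
    finally show ?thesis by simp
  qed
  have shift: "\<exists>m. 3 ^ n * T 0 = 2 * real m + T n" for n
  proof (induction n)
    case (Suc n)
    then obtain m where "3 ^ n * T 0 = 2 * real m + T n" by blast
    then have "3 ^ Suc n * T 0 = 2 * real (3 * m + of_bool (a n)) + T (Suc n)"
      using T_step[of n] by (cases "a n") auto
    then show ?case by blast
  qed (auto intro: exI[of _ 0])
  show thesis
  proof (rule that)
    show "T 0 \<in> {0..1}" using T_nonneg T_le by simp
    fix n
    obtain m where "3 ^ n * T 0 = 2 * real m + T n" using shift by blast
    then have "digit_wave (3 ^ n * T 0) = digit_wave (T n)"
      by (simp only: digit_wave_even_shift)
    also have "\<dots> = of_bool (a n)"
      using T_step[of n] T_nonneg[of "Suc n"] T_le[of "Suc n"]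
      by (cases "a n") (auto intro!: digit_wave_low digit_wave_high)
    finally show "digit_wave (3 ^ n * T 0) = of_bool (a n)" .
  qed
qed

lemma binary_expansion:
  fixes x :: real
  assumes "0 \<le> x" "x < 1"
  shows "(\<lambda>j. of_bool (odd \<lfloor>2 ^ Suc j * x\<rfloor>) / 2 ^ Suc j) sums x"
proof -
  have partial: "(\<Sum>j<n. of_bool (odd \<lfloor>2 ^ Suc j * x\<rfloor>) / 2 ^ Suc j) = real_of_int \<lfloor>2 ^ n * x\<rfloor> / 2 ^ n" for n
  proof (induction n)
    case 0
    then show ?case using assms by (simp add: floor_eq_iff)
  next
    case (Suc n)
    define k where "k = \<lfloor>2 ^ Suc n * x\<rfloor>"
    have "k div 2 = \<lfloor>2 ^ n * x\<rfloor>"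
      using floor_divide_real_eq_div[of 2 "2 ^ Suc n * x"] by (simp add: k_def)
    moreover have "k = 2 * (k div 2) + of_bool (odd k)"
      by (cases "odd k") auto
    ultimately have "real_of_int k = 2 * real_of_int \<lfloor>2 ^ n * x\<rfloor> + of_bool (odd k)"
      by (metis of_int_add of_int_mult of_int_numeral of_int_of_bool)
    then have "real_of_int k / 2 ^ Suc n = real_of_int \<lfloor>2 ^ n * x\<rfloor> / 2 ^ n + of_bool (odd k) / 2 ^ Suc n"
      by (simp add: add_divide_distrib)
    then show ?case using Suc by (simp only: sum.lessThan_Suc k_def)
  qed
  have "(\<lambda>n. real_of_int \<lfloor>2 ^ n * x\<rfloor> / 2 ^ n) \<longlonglongrightarrow> x"
  proof (rule tendsto_sandwich)
    show "\<forall>\<^sub>F n in sequentially. x - (1 / 2) ^ n \<le> real_of_int \<lfloor>2 ^ n * x\<rfloor> / 2 ^ n"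
    proof (intro always_eventually allI)
      fix n
      have "(2 ^ n * x - 1) / 2 ^ n \<le> real_of_int \<lfloor>2 ^ n * x\<rfloor> / 2 ^ n"
        using real_of_int_floor_gt_diff_one[of "2 ^ n * x"] by (intro divide_right_mono) auto
      then show "x - (1 / 2) ^ n \<le> real_of_int \<lfloor>2 ^ n * x\<rfloor> / 2 ^ n"
        by (simp add: diff_divide_distrib power_one_over)
    qed
    show "\<forall>\<^sub>F n in sequentially. real_of_int \<lfloor>2 ^ n * x\<rfloor> / 2 ^ n \<le> x"
      using of_int_floor_le[of "2 ^ _ * x"]
      by (intro always_eventually) (auto simp: field_simps)
    show "(\<lambda>n. x - (1 / 2) ^ n) \<longlonglongrightarrow> x"
      using LIMSEQ_realpow_zero[of "1/2::real"] by (auto intro!: tendsto_eq_intros)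
  qed auto
  then show ?thesis unfolding sums_def partial .
qed

text \<open>Schoenberg's curve.  The ternary digits of \<open>t\<close> are distributed over the \<open>D\<close> coordinates: coordinate
\<open>i\<close> has as binary digits those at the positions \<open>D * j + idx i\<close>.  It is a uniform limit of continuous
functions, and \<open>digit_wave_prescribed\<close> yields a parameter for any choice of digits.\<close>

lemma space_filling_cube:
  "\<exists>X :: real \<Rightarrow> real ^ 'd::finite. continuous_on UNIV X \<and>
    (\<forall>x. (\<forall>i. 0 \<le> x $ i \<and> x $ i < 1) \<longrightarrow> (\<exists>t\<in>{0..1}. X t = x))"
proof -
  define D where "D = CARD('d)"
  have D: "D > 0" by (simp add: D_def)
  obtain idx :: "'d \<Rightarrow> nat" where idx: "bij_betw idx UNIV {0..<D}"
    using ex_bij_betw_finite_nat[OF finite_class.finite_UNIV] unfolding D_def by blast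
  define X :: "real \<Rightarrow> real ^ 'd" where
    "X t = (\<chi> i. \<Sum>j. digit_wave (3 ^ (D * j + idx i) * t) / 2 ^ Suc j)" for t
  \<comment> \<open>the majorant of the series that defines a coordinate\<close>
  have geo: "summable (\<lambda>j. 1 / 2 * (1 / 2 :: real) ^ j)"
    by (intro summable_mult summable_geometric) simp
  have "continuous_on UNIV (\<lambda>t. \<Sum>j. digit_wave (3 ^ (D * j + idx i) * t) / 2 ^ Suc j)" for i
  proof (rule uniform_limit_theorem)
    show "uniform_limit UNIV (\<lambda>n t. \<Sum>j<n. digit_wave (3 ^ (D * j + idx i) * t) / 2 ^ Suc j)
        (\<lambda>t. \<Sum>j. digit_wave (3 ^ (D * j + idx i) * t) / 2 ^ Suc j) sequentially"
      using digit_wave_bounds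
      by (intro Weierstrass_m_test[OF _ geo]) (auto simp: power_one_over field_simps)
    show "\<forall>\<^sub>F n in sequentially. continuous_on UNIV
        (\<lambda>t. \<Sum>j<n. digit_wave (3 ^ (D * j + idx i) * t) / 2 ^ Suc j)"
      by (intro always_eventually allI continuous_intros
          continuous_on_compose2[OF continuous_on_digit_wave[of UNIV]]) auto
  qed auto
  then have cont: "continuous_on UNIV X"
    unfolding X_def by (intro continuous_on_vec_lambda)
  show ?thesis
  proof (intro exI[of _ X] conjI allI impI cont)
    fix x :: "real ^ 'd" assume x: "\<forall>i. 0 \<le> x $ i \<and> x $ i < 1"
    define a where "a n = odd \<lfloor>2 ^ Suc (n div D) * (x $ inv_into UNIV idx (n mod D))\<rfloor>" for n
    obtain t where t: "t \<in> {0..1}" "\<And>n. digit_wave (3 ^ n * t) = of_bool (a n)"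
      using digit_wave_prescribed by blast
    have "X t $ i = x $ i" for i
    proof -
      have "idx i < D" using idx by (auto simp: bij_betw_def)
      then have "(D * j + idx i) div D = j" "(D * j + idx i) mod D = idx i" for j
        using D by auto
      moreover have "inv_into UNIV idx (idx i) = i"
        using idx by (auto simp: bij_betw_def inv_into_f_f)
      ultimately have "a (D * j + idx i) = odd \<lfloor>2 ^ Suc j * x $ i\<rfloor>" for j
        unfolding a_def by simp
      then have "X t $ i = (\<Sum>j. of_bool (odd \<lfloor>2 ^ Suc j * x $ i\<rfloor>) / 2 ^ Suc j)"
        unfolding X_def by (simp add: t(2))
      also have "\<dots> = x $ i"
        using sums_unique[OF binary_expansion[of "x $ i"]] x by simp
      finally show ?thesis .
    qed
    then have "X t = x" by (simp add: vec_eq_iff)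
    then show "\<exists>t\<in>{0..1}. X t = x" using t(1) by blast
  qed
qed

text \<open>The triangle wave \<open>s\<close> traverses \<open>[0, 1]\<close> on the interval \<open>[2 m, 2 m + 1]\<close>, on which \<open>\<tau> - s \<tau>\<close> has the
constant value \<open>2 m\<close>.  During that interval \<open>F\<close> runs through a cube of half side \<open>2 m\<close>.\<close>

lemma space_filling_euclidean:
  "\<exists>F :: real \<Rightarrow> real ^ 'd::finite. continuous_on UNIV F \<and> (\<forall>r. \<exists>a. cball 0 r \<subseteq> F ` {0..a})"
proof -
  obtain X :: "real \<Rightarrow> real ^ 'd" where X: "continuous_on UNIV X"
    and surj: "\<And>x. \<forall>i. 0 \<le> x $ i \<and> x $ i < 1 \<Longrightarrow> \<exists>t\<in>{0..1}. X t = x"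
    using space_filling_cube[where 'd = 'd] by auto
  define s where "s \<tau> = arccos (cos (pi * \<tau>)) / pi" for \<tau>
  define F where "F \<tau> = (\<tau> - s \<tau>) *\<^sub>R (2 *\<^sub>R X (s \<tau>) - (\<chi> i. 1))" for \<tau>
  have s: "continuous_on UNIV s"
    unfolding s_def by (intro continuous_intros) auto
  have "continuous_on UNIV F"
    unfolding F_def by (intro continuous_intros s continuous_on_compose2[OF X s]) auto
  moreover have "\<exists>a. cball 0 r \<subseteq> F ` {0..a}" for r
  proof -
    obtain m :: nat where m: "max r 0 < real m" using reals_Archimedean2 by blast
    have "cball 0 r \<subseteq> F ` {0..2 * real m + 1}"
    proof
      fix x :: "real ^ 'd" assume "x \<in> cball 0 r"
      then have "norm x < real m" using m by simp
      then have xi: "\<bar>x $ i\<bar> < real m" for i using component_le_norm_cart[of x i] by linarith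
      define y :: "real ^ 'd" where "y = (\<chi> i. (x $ i / (2 * real m) + 1) / 2)"
      have "0 \<le> y $ i \<and> y $ i < 1" for i
        using xi[of i] m by (simp add: y_def field_simps abs_less_iff)
      then have "\<forall>i. 0 \<le> y $ i \<and> y $ i < 1" by blast
      then obtain t where t: "t \<in> {0..1}" "X t = y" using surj by blast
      have "pi * (2 * real m + t) = 2 * real m * pi + pi * t" by (simp add: algebra_simps)
      then have "cos (pi * (2 * real m + t)) = cos (pi * t)"
        by (simp only: cos_add cos_2npi sin_2npi)
      then have "s (2 * real m + t) = t"
        unfolding s_def using t(1) by (simp add: arccos_cos)
      then have "F (2 * real m + t) = x"
        using m by (simp add: F_def t(2) y_def vec_eq_iff field_simps)
      moreover have "2 * real m + t \<in> {0..2 * real m + 1}" using t(1) by simp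
      ultimately show "x \<in> F ` {0..2 * real m + 1}" by blast
    qed
    then show ?thesis by blast
  qed
  ultimately show ?thesis by blast
qed

text \<open>The first time at which the curve visits \<open>x\<close> is a Borel function of \<open>x\<close>, because its sublevel sets are
the images of compact intervals under \<open>F\<close>.\<close>

lemma space_filling_section:
  "\<exists>(F :: real \<Rightarrow> real ^ 'd::finite) s. continuous_on UNIV F \<and> s \<in> borel_measurable borel \<and>
    (\<forall>x. F (s x) = x) \<and> (\<forall>r. \<exists>a. \<forall>x. norm x \<le> r \<longrightarrow> s x \<in> {0..a})"
proof -
  obtain F :: "real \<Rightarrow> real ^ 'd" where F: "continuous_on UNIV F"
    and balls: "\<And>r. \<exists>a. cball 0 r \<subseteq> F ` {0..a}"
    using space_filling_euclidean[where 'd = 'd] by auto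
  define S where "S x = {\<tau>. 0 \<le> \<tau> \<and> F \<tau> = x}" for x
  define s where "s x = Inf (S x)" for x
  have bdd: "bdd_below (S x)" for x by (auto simp: S_def)
  have mem: "s x \<in> S x" for x
  proof -
    have "S x = F -` {x} \<inter> {0..}" by (auto simp: S_def)
    moreover have "closed (F -` {x} \<inter> {0..})"
      by (intro closed_Int continuous_closed_vimage closed_atLeast) (use F in \<open>auto simp: continuous_on_eq_continuous_at\<close>)
    ultimately have "closed (S x)" by simp
    moreover have "S x \<noteq> {}"
      using balls[of "norm x"] by (fastforce simp: S_def)
    ultimately show ?thesis
      unfolding s_def by (intro closed_contains_Inf bdd)
  qed
  have sublevel: "{x. s x \<le> a} = F ` {0..a}" for a
  proof (intro equalityI subsetI)
    fix x assume "x \<in> {x. s x \<le> a}"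
    then show "x \<in> F ` {0..a}" using mem[of x] by (intro image_eqI[of _ _ "s x"]) (auto simp: S_def)
  next
    fix x assume "x \<in> F ` {0..a}"
    then obtain \<tau> where "\<tau> \<in> S x" "\<tau> \<le> a" by (auto simp: S_def)
    then show "x \<in> {x. s x \<le> a}"
      unfolding s_def using cInf_lower[OF _ bdd] by force
  qed
  have "closed (F ` {0..a})" for a
    by (intro compact_imp_closed compact_continuous_image continuous_on_subset[OF F]) auto
  then have "s \<in> borel_measurable borel"
    unfolding borel_measurable_iff_le by (simp add: sublevel)
  moreover have "\<exists>a. \<forall>x. norm x \<le> r \<longrightarrow> s x \<in> {0..a}" for r
  proof -
    obtain a where "cball 0 r \<subseteq> F ` {0..a}" using balls by blast
    then have "norm x \<le> r \<Longrightarrow> s x \<le> a" for x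
      unfolding sublevel[symmetric] by auto
    moreover have "0 \<le> s x" for x using mem[of x] by (simp add: S_def)
    ultimately show ?thesis by auto
  qed
  moreover have "F (s x) = x" for x using mem[of x] by (simp add: S_def)
  ultimately show ?thesis using F by blast
qed

section \<open>Weak compactness of tight sequences\<close>

text \<open>One half of Prokhorov's theorem in Euclidean space, reduced to Helly's selection theorem on the line:
the Borel section \<open>s\<close> of the space-filling curve \<open>F\<close> lifts the measures to the line, where a subsequence
converges weakly, and the continuous map \<open>F\<close> projects the limit back.\<close>

theorem tight_imp_weakly_convergent_subsequence:
  fixes \<mu> :: "nat \<Rightarrow> (real ^ 'd::finite) measure"
  assumes prob: "\<And>n. prob_space (\<mu> n)" and sets: "\<And>n. sets (\<mu> n) = sets borel"
    and tight: "\<And>\<delta>. \<delta> > 0 \<Longrightarrow> \<exists>R. \<forall>n. measure (\<mu> n) {x. R < norm x} \<le> \<delta>"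
  obtains r \<nu> where "strict_mono (r :: nat \<Rightarrow> nat)" "prob_space \<nu>" "sets \<nu> = sets borel"
    "\<And>f :: real ^ 'd \<Rightarrow> real. continuous_on UNIV f \<Longrightarrow> bounded (range f) \<Longrightarrow>
      (\<lambda>n. \<integral>x. f x \<partial>\<mu> (r n)) \<longlonglongrightarrow> (\<integral>x. f x \<partial>\<nu>)"
proof -
  obtain F :: "real \<Rightarrow> real ^ 'd" and s where F: "continuous_on UNIV F"
    and s[measurable]: "s \<in> borel_measurable borel" and Fs: "\<And>x. F (s x) = x"
    and bdd: "\<And>r. \<exists>a. \<forall>x. norm x \<le> r \<longrightarrow> s x \<in> {0..a}"
    using space_filling_section[where 'd = 'd] by auto
  have F_meas[measurable]: "F \<in> borel_measurable borel"
    using F by (rule borel_measurable_continuous_onI)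
  have s_meas[measurable]: "s \<in> borel_measurable (\<mu> n)" for n
    using s by (simp add: measurable_cong_sets[OF sets])
  define \<nu>s where "\<nu>s n = distr (\<mu> n) borel s" for n
  have rd: "real_distribution (\<nu>s n)" for n
    unfolding \<nu>s_def real_distribution_def real_distribution_axioms_def
    using prob_space.prob_space_distr[OF prob s_meas] by simp
  have "tight \<nu>s"
    unfolding tight_def
  proof (intro conjI allI impI rd)
    fix \<delta> :: real assume "\<delta> > 0"
    then obtain R where R: "\<And>n. measure (\<mu> n) {x. R < norm x} \<le> \<delta> / 2"
      using tight[of "\<delta> / 2"] by auto
    obtain a where a: "\<And>x. norm x \<le> R \<Longrightarrow> s x \<in> {0..a}" using bdd[of R] by auto
    have "measure (\<nu>s n) {-1<..max a 0} > 1 - \<delta>" for n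
    proof -
      interpret prob_space "\<mu> n" by (rule prob)
      have sp: "space (\<mu> n) = UNIV" using sets_eq_imp_space_eq[OF sets, of n] by simp
      have ev: "{x. R < norm x} \<in> events" unfolding sets by measurable
      have "1 - \<delta> / 2 \<le> 1 - prob {x. R < norm x}" using R[of n] by simp
      also have "\<dots> = prob (UNIV - {x. R < norm x})"
        using prob_compl[OF ev] sp by simp
      also have "\<dots> \<le> prob (s -` {-1<..max a 0} \<inter> space (\<mu> n))"
      proof (intro finite_measure_mono measurable_sets[OF s_meas])
        show "UNIV - {x :: real ^ 'd. R < norm x} \<subseteq> s -` {-1<..max a 0} \<inter> space (\<mu> n)"
        proof
          fix x :: "real ^ 'd" assume "x \<in> UNIV - {x. R < norm x}"
          then have "s x \<in> {0..a}" using a by simp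
          then show "x \<in> s -` {-1<..max a 0} \<inter> space (\<mu> n)" by (simp add: sp)
        qed
      qed simp
      also have "\<dots> = measure (\<nu>s n) {-1<..max a 0}"
        unfolding \<nu>s_def by (simp add: measure_distr[OF s_meas])
      finally show ?thesis using \<open>\<delta> > 0\<close> by simp
    qed
    moreover have "-1 < max a 0" by simp
    ultimately show "\<exists>a b. a < b \<and> (\<forall>n. 1 - \<delta> < measure (\<nu>s n) {a<..b})" by blast
  qed
  from tight_imp_convergent_subsubsequence[OF this strict_mono_id]
  obtain r M where r: "strict_mono r" and M: "real_distribution M"
    and conv: "weak_conv_m (\<lambda>n. \<nu>s (r n)) M"
    by (auto simp: comp_def)
  interpret M: real_distribution M by (rule M)
  have F_M[measurable]: "F \<in> borel_measurable M" by simp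
  show thesis
  proof (rule that[OF r])
    show "prob_space (distr M borel F)" by (rule M.prob_space_distr) simp
    show "sets (distr M borel F) = sets borel" by simp
    fix f :: "real ^ 'd \<Rightarrow> real" assume f: "continuous_on UNIV f" "bounded (range f)"
    have [measurable]: "f \<in> borel_measurable borel"
      using f(1) by (rule borel_measurable_continuous_onI)
    obtain B where B: "\<And>x. norm (f x) \<le> B" using f(2) by (auto simp: bounded_iff)
    have "isCont (\<lambda>\<tau>. f (F \<tau>)) \<tau>" for \<tau>
      using continuous_on_compose2[OF f(1) F] by (auto simp: continuous_on_eq_continuous_at)
    from weak_conv_imp_integral_bdd_continuous_conv[OF rd M conv this B]
    have "(\<lambda>n. \<integral>\<tau>. f (F \<tau>) \<partial>\<nu>s (r n)) \<longlonglongrightarrow> (\<integral>\<tau>. f (F \<tau>) \<partial>M)" .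
    moreover have "(\<integral>\<tau>. f (F \<tau>) \<partial>\<nu>s n) = (\<integral>x. f x \<partial>\<mu> n)" for n
      unfolding \<nu>s_def by (subst integral_distr) (simp_all add: Fs)
    moreover have "(\<integral>\<tau>. f (F \<tau>) \<partial>M) = (\<integral>x. f x \<partial>distr M borel F)"
      by (subst integral_distr) simp_all
    ultimately show "(\<lambda>n. \<integral>x. f x \<partial>\<mu> (r n)) \<longlonglongrightarrow> (\<integral>x. f x \<partial>distr M borel F)"
      by simp
  qed
qed

section \<open>Convergence in the Wasserstein space\<close>

lemma P1_simps:
  assumes "\<mu> \<in> P1"
  shows "prob_space \<mu>" "sets \<mu> = sets borel" "space \<mu> = UNIV" "integrable \<mu> norm"
  using assms sets_eq_imp_space_eq[of \<mu> borel] by (auto simp: P1_def)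

lemma P1_measurable:
  assumes "\<mu> \<in> P1" "f \<in> borel_measurable borel"
  shows "f \<in> borel_measurable \<mu>"
  using assms by (simp add: P1_def cong: measurable_cong_sets)

lemma P1_integrable:
  fixes f :: "'a::euclidean_space \<Rightarrow> 'b::{banach, second_countable_topology}"
  assumes \<mu>: "\<mu> \<in> P1" and f: "continuous_on UNIV f" and le: "\<And>x. norm (f x) \<le> C * (1 + norm x)"
  shows "integrable \<mu> f"
proof -
  interpret prob_space \<mu> using P1_simps[OF \<mu>] by simp
  show ?thesis
  proof (rule Bochner_Integration.integrable_bound)
    show "integrable \<mu> (\<lambda>x. C * (1 + norm x))"
      using P1_simps(4)[OF \<mu>] by simp
    show "f \<in> borel_measurable \<mu>"
      by (intro P1_measurable[OF \<mu>] borel_measurable_continuous_onI f)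
    show "AE x in \<mu>. norm (f x) \<le> norm (C * (1 + norm x))"
      using le by (intro AE_I2) (auto intro: order_trans[OF _ abs_ge_self])
  qed
qed

lemma P1_integrable_bounded:
  fixes f :: "'a::euclidean_space \<Rightarrow> 'b::{banach, second_countable_topology}"
  assumes \<mu>: "\<mu> \<in> P1" and f: "continuous_on UNIV f" and le: "\<And>x. norm (f x) \<le> B"
  shows "integrable \<mu> f"
proof (rule P1_integrable[OF \<mu> f])
  fix x
  have "0 \<le> B" using le[of x] norm_ge_zero order_trans by blast
  then show "norm (f x) \<le> B * (1 + norm x)"
    using le[of x] by (simp add: algebra_simps add_increasing2)
qed

definition excess :: "real \<Rightarrow> 'a::real_normed_vector \<Rightarrow> real" where
  "excess R x = max 0 (norm x - R)"

lemma excess_nonneg: "0 \<le> excess R x"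
  by (simp add: excess_def)

lemma continuous_on_excess: "continuous_on S (excess R)"
  unfolding excess_def by (intro continuous_intros)

lemma P1_integrable_excess:
  assumes "\<mu> \<in> P1"
  shows "integrable \<mu> (excess R)"
proof (rule P1_integrable[OF assms continuous_on_excess, of _ "1 + \<bar>R\<bar>"])
  fix x :: 'a
  have "(1 + \<bar>R\<bar>) * (1 + norm x) = 1 + norm x + \<bar>R\<bar> + \<bar>R\<bar> * norm x"
    by (simp add: algebra_simps)
  moreover have "0 \<le> \<bar>R\<bar> * norm x" by simp
  ultimately have "norm x - R \<le> (1 + \<bar>R\<bar>) * (1 + norm x)" by linarith
  moreover have "0 \<le> (1 + \<bar>R\<bar>) * (1 + norm x)" by (intro mult_nonneg_nonneg) auto
  ultimately show "norm (excess R x) \<le> (1 + \<bar>R\<bar>) * (1 + norm x)"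
    unfolding excess_def by simp
qed

text \<open>Uniform integrability of the norm, expressed by a continuous integrand so that it passes to weak
limits.\<close>

definition uniform_tails :: "'a::euclidean_space measure set \<Rightarrow> bool" where
  "uniform_tails A \<longleftrightarrow> (\<forall>\<delta>>0. \<exists>R\<ge>1. \<forall>\<mu>\<in>A. (\<integral>x. excess R x \<partial>\<mu>) \<le> \<delta>)"

lemma uniform_tails_subset: "uniform_tails B \<Longrightarrow> A \<subseteq> B \<Longrightarrow> uniform_tails A"
  unfolding uniform_tails_def by (meson subsetD)

lemma uniform_tails_moment_bound:
  assumes "uniform_tails A" "A \<subseteq> P1"
  obtains M where "M \<ge> 0" "\<And>\<mu>. \<mu> \<in> A \<Longrightarrow> (\<integral>x. norm x \<partial>\<mu>) \<le> M"
proof -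
  obtain R where R: "R \<ge> 1" "\<And>\<mu>. \<mu> \<in> A \<Longrightarrow> (\<integral>x. excess R x \<partial>\<mu>) \<le> 1"
    using assms(1) unfolding uniform_tails_def by (meson zero_less_one)
  show thesis
  proof (rule that)
    show "0 \<le> R + 1" using R(1) by simp
    fix \<mu> assume \<mu>: "\<mu> \<in> A"
    then have P1: "\<mu> \<in> P1" using assms(2) by blast
    interpret prob_space \<mu> using P1_simps[OF P1] by simp
    have "(\<integral>x. norm x \<partial>\<mu>) \<le> (\<integral>x. R + excess R x \<partial>\<mu>)"
      using P1_simps(4)[OF P1] P1_integrable_excess[OF P1]
      by (intro integral_mono) (auto simp: excess_def)
    also have "\<dots> = R + (\<integral>x. excess R x \<partial>\<mu>)"
      using P1_integrable_excess[OF P1] by (simp add: prob_space)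
    also have "\<dots> \<le> R + 1" using R(2)[OF \<mu>] by simp
    finally show "(\<integral>x. norm x \<partial>\<mu>) \<le> R + 1" .
  qed
qed

lemma uniform_tails_tight:
  assumes "uniform_tails A" "A \<subseteq> P1" "\<delta> > 0"
  shows "\<exists>R. \<forall>\<mu>\<in>A. measure \<mu> {x. R < norm x} \<le> \<delta>"
proof -
  obtain R where R: "R \<ge> 1" "\<And>\<mu>. \<mu> \<in> A \<Longrightarrow> (\<integral>x. excess R x \<partial>\<mu>) \<le> \<delta>"
    using assms(1,3) unfolding uniform_tails_def by meson
  have "measure \<mu> {x. R + 1 < norm x} \<le> \<delta>" if \<mu>: "\<mu> \<in> A" for \<mu>
  proof -
    have P1: "\<mu> \<in> P1" using assms(2) \<mu> by blast
    interpret prob_space \<mu> using P1_simps[OF P1] by simp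
    have ev: "{x. R + 1 < norm x} \<in> events"
      unfolding P1_simps(2)[OF P1] by measurable
    have "measure \<mu> {x. R + 1 < norm x} = (\<integral>x. indicator {x. R + 1 < norm x} x \<partial>\<mu>)"
      using ev by simp
    also have "\<dots> \<le> (\<integral>x. excess R x \<partial>\<mu>)"
      using P1_integrable_excess[OF P1] ev
      by (intro integral_mono) (auto simp: emeasure_eq_measure, auto simp: excess_def indicator_def)
    also have "\<dots> \<le> \<delta>" by (rule R(2)[OF \<mu>])
    finally show ?thesis .
  qed
  then show ?thesis by blast
qed

text \<open>Lower semicontinuity: \<open>min g k\<close> is bounded and continuous, so weak convergence applies to it, and
monotone convergence removes the truncation.\<close>

lemma weak_limit_integral_le:
  fixes g :: "'a::euclidean_space \<Rightarrow> real"
  assumes \<mu>: "\<And>n. \<mu> n \<in> P1" and \<nu>: "prob_space \<nu>" "sets \<nu> = sets borel"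
    and conv: "\<And>f :: 'a \<Rightarrow> real. continuous_on UNIV f \<Longrightarrow> bounded (range f) \<Longrightarrow>
      (\<lambda>n. \<integral>x. f x \<partial>\<mu> n) \<longlonglongrightarrow> (\<integral>x. f x \<partial>\<nu>)"
    and g: "continuous_on UNIV g" "\<And>x. 0 \<le> g x" "\<And>n. integrable (\<mu> n) g"
    and le: "\<And>n. (\<integral>x. g x \<partial>\<mu> n) \<le> c"
  shows "integrable \<nu> g" "(\<integral>x. g x \<partial>\<nu>) \<le> c"
proof -
  interpret \<nu>: prob_space \<nu> by (rule \<nu>)
  have g_meas: "g \<in> borel_measurable \<nu>"
    using borel_measurable_continuous_onI[OF g(1)] \<nu>(2) by (simp cong: measurable_cong_sets)
  have c: "0 \<le> c" using order_trans[OF Bochner_Integration.integral_nonneg le, of 0] g(2) by blast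
  define gk where "gk k x = min (g x) (real k)" for k x
  have gk_meas: "gk k \<in> borel_measurable \<nu>" for k
    unfolding gk_def using g_meas by measurable
  have gk_int: "integrable \<nu> (gk k)" for k
    by (rule \<nu>.integrable_const_bound[of _ "real k"]) (use g(2) gk_meas in \<open>auto simp: gk_def\<close>)
  have gk_le: "(\<integral>x. gk k x \<partial>\<nu>) \<le> c" for k
  proof (rule LIMSEQ_le_const2[OF conv])
    show "continuous_on UNIV (gk k)" unfolding gk_def by (intro continuous_intros g(1))
    have "norm (gk k x) \<le> real k" for x using g(2)[of x] by (simp add: gk_def)
    then show "bounded (range (gk k))" unfolding bounded_iff by blast
    have "(\<integral>x. gk k x \<partial>\<mu> n) \<le> c" for n
    proof -
      have "(\<integral>x. gk k x \<partial>\<mu> n) \<le> (\<integral>x. g x \<partial>\<mu> n)"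
      proof (rule integral_mono[OF P1_integrable_bounded[OF \<mu>] g(3)])
        show "continuous_on UNIV (gk k)" by fact
        show "norm (gk k x) \<le> real k" for x using g(2)[of x] by (simp add: gk_def)
      qed (simp add: gk_def)
      then show ?thesis using le[of n] by simp
    qed
    then show "\<exists>N. \<forall>n\<ge>N. (\<integral>x. gk k x \<partial>\<mu> n) \<le> c" by blast
  qed
  have "(\<integral>\<^sup>+x. ennreal (g x) \<partial>\<nu>) = (\<integral>\<^sup>+x. (SUP k. ennreal (gk k x)) \<partial>\<nu>)"
  proof (rule nn_integral_cong)
    fix x
    have "(SUP k. ennreal (gk k x)) = ennreal (g x)"
    proof (rule antisym)
      show "(SUP k. ennreal (gk k x)) \<le> ennreal (g x)"
        by (intro SUP_least ennreal_leI) (simp add: gk_def)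
      obtain k :: nat where "g x \<le> real k" using real_arch_simple by blast
      then have "ennreal (g x) = ennreal (gk k x)" by (simp add: gk_def)
      then show "ennreal (g x) \<le> (SUP k. ennreal (gk k x))" by (metis SUP_upper UNIV_I)
    qed
    then show "ennreal (g x) = (SUP k. ennreal (gk k x))" by simp
  qed
  also have "\<dots> = (SUP k. \<integral>\<^sup>+x. ennreal (gk k x) \<partial>\<nu>)"
  proof (rule nn_integral_monotone_convergence_SUP)
    show "incseq (\<lambda>k x. ennreal (gk k x))"
      by (auto simp: incseq_def le_fun_def gk_def intro!: ennreal_leI)
    show "(\<lambda>x. ennreal (gk k x)) \<in> borel_measurable \<nu>" for k
      using gk_meas by measurable
  qed
  also have "\<dots> \<le> ennreal c"
  proof (rule SUP_least)
    fix k
    have "(\<integral>\<^sup>+x. ennreal (gk k x) \<partial>\<nu>) = ennreal (\<integral>x. gk k x \<partial>\<nu>)"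
      using g(2) by (intro nn_integral_eq_integral[OF gk_int]) (simp add: gk_def)
    then show "(\<integral>\<^sup>+x. ennreal (gk k x) \<partial>\<nu>) \<le> ennreal c"
      using gk_le[of k] by (simp add: ennreal_leI)
  qed
  finally have *: "(\<integral>\<^sup>+x. ennreal (g x) \<partial>\<nu>) \<le> ennreal c" .
  show int: "integrable \<nu> g"
    using * g(2) g_meas by (intro integrableI_bounded) (auto simp: le_less_trans[OF _ ennreal_less_top])
  have "ennreal (\<integral>x. g x \<partial>\<nu>) \<le> ennreal c"
    using * nn_integral_eq_integral[OF int] g(2) by auto
  then show "(\<integral>x. g x \<partial>\<nu>) \<le> c" using c by simp
qed

text \<open>Cut \<open>f\<close> off at distance \<open>3 * R\<close>.  The inner part is uniformly close to a test function; the outer part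
is at most a multiple of \<open>excess R\<close>, whose integrals are small for all measures at once.\<close>

lemma P1_tendstoI:
  fixes \<mu> :: "nat \<Rightarrow> (real ^ 'd::finite) measure"
  assumes \<mu>: "\<And>n. \<mu> n \<in> P1" and \<nu>: "\<nu> \<in> P1"
    and tails: "uniform_tails (insert \<nu> (range \<mu>))"
    and conv: "\<And>\<phi>. \<phi> \<in> test_functions \<Longrightarrow> (\<lambda>n. \<integral>x. \<phi> x \<partial>\<mu> n) \<longlonglongrightarrow> (\<integral>x. \<phi> x \<partial>\<nu>)"
  shows "P1_tendsto \<mu> \<nu>"
  unfolding P1_tendsto_def
proof (intro allI impI, elim conjE)
  fix f :: "real ^ 'd \<Rightarrow> real" assume f: "continuous_on UNIV f" "sublinear_growth f"
  obtain C0 where C0: "\<And>x. norm (f x) \<le> C0 * (1 + norm x)"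
    using f(2) unfolding sublinear_growth_def by blast
  define C where "C = max C0 1"
  have C: "norm (f x) \<le> C * (1 + norm x)" "C \<ge> 1" for x
    using order_trans[OF C0 mult_right_mono[of C0 C "1 + norm x"]] by (auto simp: C_def)
  have f_int: "integrable \<kappa> f" if "\<kappa> \<in> P1" for \<kappa>
    by (rule P1_integrable[OF that f(1) C(1)])
  show "(\<lambda>n. \<integral>x. f x \<partial>\<mu> n) \<longlonglongrightarrow> (\<integral>x. f x \<partial>\<nu>)"
  proof (rule LIMSEQ_I)
    fix \<delta> :: real assume \<delta>: "\<delta> > 0"
    \<comment> \<open>chosen such that \<open>\<delta> / 16 + 4 * C * \<delta>'\<close>, the error of replacing \<open>f\<close> by \<open>\<phi>\<close>, is at most \<open>3 * \<delta> / 8\<close>\<close>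
    define \<delta>' where "\<delta>' = \<delta> / (16 * C)"
    have "\<delta>' > 0" using \<delta> C(2) by (simp add: \<delta>'_def)
    then obtain R where R: "R \<ge> 1" "\<And>\<kappa>. \<kappa> \<in> insert \<nu> (range \<mu>) \<Longrightarrow> (\<integral>x. excess R x \<partial>\<kappa>) \<le> \<delta>'"
      using tails unfolding uniform_tails_def by meson
    define \<zeta> :: "real ^ 'd \<Rightarrow> real" where "\<zeta> x = max 0 (min 1 (3 - norm x / R))" for x
    have \<zeta>: "0 \<le> \<zeta> x" "\<zeta> x \<le> 1" "continuous_on UNIV \<zeta>" for x
      unfolding \<zeta>_def using R(1) by (auto intro!: continuous_intros)
    have f\<zeta>: "continuous_on UNIV (\<lambda>x. f x * \<zeta> x)" by (intro continuous_intros f \<zeta>)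
    have supp: "f x * \<zeta> x = 0" if "3 * R \<le> norm x" for x
      using that R(1) by (simp add: \<zeta>_def field_simps)
    have "3 * R > 0" "\<delta> / 16 > 0" using R(1) \<delta> by auto
    from test_functions_dense[OF f\<zeta> supp this]
    obtain \<phi> where \<phi>: "\<phi> \<in> test_functions" "\<And>x. \<bar>f x * \<zeta> x - \<phi> x\<bar> < \<delta> / 16" by blast
    have close: "\<bar>(\<integral>x. f x \<partial>\<kappa>) - (\<integral>x. \<phi> x \<partial>\<kappa>)\<bar> \<le> 3 * \<delta> / 8" if "\<kappa> \<in> insert \<nu> (range \<mu>)" for \<kappa>
    proof -
      have \<kappa>: "\<kappa> \<in> P1" using that \<mu> \<nu> by auto
      interpret prob_space \<kappa> using P1_simps[OF \<kappa>] by simp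
      have pt: "\<bar>f x - \<phi> x\<bar> \<le> \<delta> / 16 + 4 * C * excess R x" for x
      proof (cases "norm x \<le> 2 * R")
        case True
        then have "\<zeta> x = 1" using R(1) by (simp add: \<zeta>_def field_simps)
        then show ?thesis using \<phi>(2)[of x] C(2) excess_nonneg[of R x] by (simp add: add_increasing2)
      next
        case False
        have "\<bar>f x - f x * \<zeta> x\<bar> = \<bar>f x\<bar> * (1 - \<zeta> x)"
          using \<zeta>(1,2)[of x] abs_mult[of "f x" "1 - \<zeta> x"] by (simp add: right_diff_distrib)
        also have "\<dots> \<le> \<bar>f x\<bar>" using \<zeta>(1,2)[of x] by (simp add: mult_left_le)
        also have "\<dots> \<le> C * (1 + norm x)" using C(1)[of x] by simp
        also have "\<dots> \<le> C * (4 * excess R x)"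
          using False R(1) C(2) by (intro mult_left_mono) (auto simp: excess_def)
        finally show ?thesis using \<phi>(2)[of x] by linarith
      qed
      have \<phi>_int: "integrable \<kappa> \<phi>"
        using test_function_bounded[OF \<phi>(1)] P1_integrable_bounded[OF \<kappa> test_function_continuous[OF \<phi>(1)]]
        by (metis real_norm_def)
      have "\<bar>(\<integral>x. f x \<partial>\<kappa>) - (\<integral>x. \<phi> x \<partial>\<kappa>)\<bar> = \<bar>\<integral>x. f x - \<phi> x \<partial>\<kappa>\<bar>"
        using f_int[OF \<kappa>] \<phi>_int by simp
      also have "\<dots> \<le> (\<integral>x. \<bar>f x - \<phi> x\<bar> \<partial>\<kappa>)" by (rule integral_abs_bound)
      also have "\<dots> \<le> (\<integral>x. \<delta> / 16 + 4 * C * excess R x \<partial>\<kappa>)"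
        using f_int[OF \<kappa>] \<phi>_int P1_integrable_excess[OF \<kappa>] pt by (intro integral_mono) auto
      also have "\<dots> = \<delta> / 16 + 4 * C * (\<integral>x. excess R x \<partial>\<kappa>)"
        using P1_integrable_excess[OF \<kappa>] by (simp add: prob_space)
      also have "\<dots> \<le> \<delta> / 16 + 4 * C * \<delta>'"
        using R(2)[OF that] C(2) by simp
      also have "\<dots> \<le> 3 * \<delta> / 8" using \<delta> C(2) by (simp add: \<delta>'_def)
      finally show ?thesis .
    qed
    obtain N where N: "\<And>n. n \<ge> N \<Longrightarrow> \<bar>(\<integral>x. \<phi> x \<partial>\<mu> n) - (\<integral>x. \<phi> x \<partial>\<nu>)\<bar> < \<delta> / 8"
      using LIMSEQ_D[OF conv[OF \<phi>(1)], of "\<delta> / 8"] \<delta> by auto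
    have "norm ((\<integral>x. f x \<partial>\<mu> n) - (\<integral>x. f x \<partial>\<nu>)) < \<delta>" if "n \<ge> N" for n
      using N[OF that] close[of "\<mu> n"] close[of \<nu>] \<delta>
      unfolding real_norm_def abs_less_iff abs_le_iff by simp
    then show "\<exists>N. \<forall>n\<ge>N. norm ((\<integral>x. f x \<partial>\<mu> n) - (\<integral>x. f x \<partial>\<nu>)) < \<delta>" by blast
  qed
qed

text \<open>Tightness provides a weak limit along a subsequence.  It inherits the tail bounds, and it is the limit
of the whole sequence since the integrals of test functions converge along the whole sequence.\<close>

lemma P1_limit_exists:
  fixes \<mu> :: "nat \<Rightarrow> (real ^ 'd::finite) measure"
  assumes \<mu>: "\<And>n. \<mu> n \<in> P1" and tails: "uniform_tails (range \<mu>)"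
    and conv: "\<And>\<phi>. \<phi> \<in> test_functions \<Longrightarrow> convergent (\<lambda>n. \<integral>x. \<phi> x \<partial>\<mu> n)"
  obtains \<nu> where "\<nu> \<in> P1" "P1_tendsto \<mu> \<nu>"
proof -
  have sub: "range \<mu> \<subseteq> P1" using \<mu> by blast
  have "\<exists>R. \<forall>n. measure (\<mu> n) {x. R < norm x} \<le> \<delta>" if "\<delta> > 0" for \<delta>
    using uniform_tails_tight[OF tails sub that] by auto
  from tight_imp_weakly_convergent_subsequence[of \<mu>, OF P1_simps(1)[OF \<mu>] P1_simps(2)[OF \<mu>] this]
  obtain r \<nu> where r: "strict_mono r" and \<nu>: "prob_space \<nu>" "sets \<nu> = sets borel"
    and weak: "\<And>f :: real ^ 'd \<Rightarrow> real. continuous_on UNIV f \<Longrightarrow> bounded (range f) \<Longrightarrow>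
      (\<lambda>n. \<integral>x. f x \<partial>\<mu> (r n)) \<longlonglongrightarrow> (\<integral>x. f x \<partial>\<nu>)"
    by metis
  obtain M where M: "\<And>n. (\<integral>x. norm x \<partial>\<mu> n) \<le> M"
    using uniform_tails_moment_bound[OF tails sub] by (metis rangeI)
  note portmanteau = weak_limit_integral_le[where \<mu> = "\<lambda>n. \<mu> (r n)", OF \<mu> \<nu> weak]
  have "integrable \<nu> norm"
    by (rule portmanteau(1)[of norm M]) (auto intro: continuous_intros M P1_simps(4)[OF \<mu>])
  then have \<nu>_P1: "\<nu> \<in> P1" using \<nu> by (simp add: P1_def)
  have "uniform_tails (insert \<nu> (range \<mu>))"
    unfolding uniform_tails_def
  proof (intro allI impI)
    fix \<delta> :: real assume "\<delta> > 0"
    then obtain R where R: "R \<ge> 1" "\<And>n. (\<integral>x. excess R x \<partial>\<mu> n) \<le> \<delta>"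
      using tails unfolding uniform_tails_def by (metis rangeI)
    have "(\<integral>x. excess R x \<partial>\<nu>) \<le> \<delta>"
      by (rule portmanteau(2)) (auto intro: continuous_on_excess R excess_nonneg P1_integrable_excess \<mu>)
    then show "\<exists>R\<ge>1. \<forall>\<mu>\<in>insert \<nu> (range \<mu>). (\<integral>x. excess R x \<partial>\<mu>) \<le> \<delta>" using R by auto
  qed
  then have "P1_tendsto \<mu> \<nu>"
  proof (rule P1_tendstoI[OF \<mu> \<nu>_P1])
    fix \<phi> :: "real ^ 'd \<Rightarrow> real" assume \<phi>: "\<phi> \<in> test_functions"
    obtain l where l: "(\<lambda>n. \<integral>x. \<phi> x \<partial>\<mu> n) \<longlonglongrightarrow> l"
      using conv[OF \<phi>] by (auto simp: convergent_def)
    have "bounded (range \<phi>)"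
      using test_function_bounded[OF \<phi>] by (auto simp: bounded_iff)
    from LIMSEQ_unique[OF LIMSEQ_subseq_LIMSEQ[OF l r, unfolded comp_def]
        weak[OF test_function_continuous[OF \<phi>] this]]
    show "(\<lambda>n. \<integral>x. \<phi> x \<partial>\<mu> n) \<longlonglongrightarrow> (\<integral>x. \<phi> x \<partial>\<nu>)" using l by simp
  qed
  then show thesis using that \<nu>_P1 by blast
qed

section \<open>Compactness of curves of measures\<close>

lemma bounded_sublinear: "bounded (range f) \<Longrightarrow> sublinear_growth f"
proof -
  assume "bounded (range f)"
  then obtain B where B: "\<And>x. norm (f x) \<le> B" by (auto simp: bounded_iff)
  have "norm (f x) \<le> B * (1 + norm x)" for x
    using B[of x] order_trans[OF norm_ge_zero B[of x]] by (simp add: algebra_simps add_increasing2)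
  then show ?thesis unfolding sublinear_growth_def by blast
qed

lemma P1_tendsto_bounded:
  "P1_tendsto \<mu> \<nu> \<Longrightarrow> continuous_on UNIV f \<Longrightarrow> (\<And>x. \<bar>f x\<bar> \<le> B) \<Longrightarrow>
    (\<lambda>n. \<integral>x. f x \<partial>\<mu> n) \<longlonglongrightarrow> (\<integral>x. f x \<partial>\<nu>)"
  for f :: "'a::euclidean_space \<Rightarrow> real"
  unfolding P1_tendsto_def using bounded_sublinear[of f] by (auto simp: bounded_iff)

lemma P1_tendsto_norm:
  "P1_tendsto \<mu> \<nu> \<Longrightarrow> (\<lambda>n. \<integral>x. norm x \<partial>\<mu> n) \<longlonglongrightarrow> (\<integral>x. norm x \<partial>\<nu>)"
  unfolding P1_tendsto_def
  by (auto simp: sublinear_growth_def intro!: continuous_intros exI[of _ 1])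

lemma closed_indicator_approx:
  fixes A :: "'a::metric_space set"
  assumes "closed A" "A \<noteq> {}"
  shows "(\<lambda>k. max 0 (1 - real k * infdist x A)) \<longlonglongrightarrow> indicator A x"
proof (cases "x \<in> A")
  case True
  then show ?thesis by simp
next
  case False
  then have pos: "infdist x A > 0"
    using assms in_closed_iff_infdist_zero[of A x] infdist_nonneg[of x A] by (auto simp: less_le)
  obtain k0 :: nat where k0: "1 / infdist x A < real k0" using reals_Archimedean2 by blast
  have "max 0 (1 - real k * infdist x A) = indicator A x" if "k \<ge> k0" for k
  proof -
    have "1 / infdist x A < real k" using k0 that by linarith
    then show ?thesis using pos False by (simp add: field_simps)
  qed
  then show ?thesis
    by (intro tendsto_eventually) (auto simp: eventually_sequentially)
qed

text \<open>The closed sets form a generator of the Borel sets, and the indicator of a closed set is a pointwise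
limit of bounded continuous functions.\<close>

lemma measurable_prob_algebra_borelI:
  fixes \<mu> :: "'b \<Rightarrow> 'a::euclidean_space measure"
  assumes \<mu>: "\<And>t. t \<in> space N \<Longrightarrow> \<mu> t \<in> P1"
    and meas: "\<And>f :: 'a \<Rightarrow> real. continuous_on UNIV f \<Longrightarrow> (\<And>x. \<bar>f x\<bar> \<le> 1) \<Longrightarrow>
      (\<lambda>t. \<integral>x. f x \<partial>\<mu> t) \<in> borel_measurable N"
  shows "\<mu> \<in> N \<rightarrow>\<^sub>M prob_algebra borel"
proof (rule measurable_prob_algebraI)
  show "prob_space (\<mu> t)" if "t \<in> space N" for t using P1_simps(1)[OF \<mu>[OF that]] .
  show "\<mu> \<in> N \<rightarrow>\<^sub>M subprob_algebra borel"
  proof (rule measurable_subprob_algebra_generated[where \<Omega> = UNIV and G = "Collect closed"])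
    show "sets borel = sigma_sets UNIV (Collect closed)" by (simp add: borel_eq_closed)
    show "Int_stable (Collect closed)" by (auto simp: Int_stable_def)
    fix t assume t: "t \<in> space N"
    then interpret prob_space "\<mu> t" using P1_simps(1)[OF \<mu>] by simp
    show "subprob_space (\<mu> t)" by unfold_locales
    show "sets (\<mu> t) = sets borel" by (rule P1_simps(2)[OF \<mu>[OF t]])
  next
    show "(\<lambda>t. emeasure (\<mu> t) UNIV) \<in> borel_measurable N"
    proof (rule measurable_cong[THEN iffD2])
      fix t assume t: "t \<in> space N"
      then interpret prob_space "\<mu> t" using P1_simps(1)[OF \<mu>] by simp
      show "emeasure (\<mu> t) UNIV = 1" using emeasure_space_1 P1_simps(3)[OF \<mu>[OF t]] by simp
    qed simp
  next
    fix A :: "'a set" assume "A \<in> Collect closed"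
    then have A: "closed A" by simp
    show "(\<lambda>t. emeasure (\<mu> t) A) \<in> borel_measurable N"
    proof (cases "A = {}")
      case False
      let ?f = "\<lambda>k x. max 0 (1 - real k * infdist x A)"
      have f: "continuous_on UNIV (?f k)" "\<bar>?f k x\<bar> \<le> 1" for k x
        by (auto intro!: continuous_intros simp: infdist_nonneg)
      have lim: "(\<lambda>k. \<integral>x. ?f k x \<partial>\<mu> t) \<longlonglongrightarrow> measure (\<mu> t) A" if t: "t \<in> space N" for t
      proof -
        interpret prob_space "\<mu> t" using P1_simps(1)[OF \<mu>[OF t]] .
        have "A \<in> events" using A unfolding P1_simps(2)[OF \<mu>[OF t]] by simp
        moreover have "(\<lambda>k. \<integral>x. ?f k x \<partial>\<mu> t) \<longlonglongrightarrow> (\<integral>x. indicator A x \<partial>\<mu> t)"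
        proof (rule integral_dominated_convergence[where w = "\<lambda>_. 1"])
          show "?f k \<in> borel_measurable (\<mu> t)" for k
            by (intro P1_measurable[OF \<mu>[OF t]] borel_measurable_continuous_onI f)
          show "(indicator A :: 'a \<Rightarrow> real) \<in> borel_measurable (\<mu> t)" using \<open>A \<in> events\<close> by simp
          show "AE x in \<mu> t. (\<lambda>k. ?f k x) \<longlonglongrightarrow> indicator A x"
            using closed_indicator_approx[OF A False] by (intro AE_I2)
          show "AE x in \<mu> t. norm (?f k x) \<le> 1" for k using f by (intro AE_I2) simp
        qed simp
        ultimately show ?thesis by simp
      qed
      have "(\<lambda>t. measure (\<mu> t) A) \<in> borel_measurable N"
        by (rule borel_measurable_LIMSEQ_real[OF lim]) (use meas f in auto)
      then have "(\<lambda>t. ennreal (measure (\<mu> t) A)) \<in> borel_measurable N" by simp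
      then show ?thesis
      proof (rule measurable_cong[THEN iffD1, rotated])
        fix t assume t: "t \<in> space N"
        then interpret prob_space "\<mu> t" using P1_simps(1)[OF \<mu>] by simp
        show "ennreal (measure (\<mu> t) A) = emeasure (\<mu> t) A" by (simp add: emeasure_eq_measure)
      qed
    qed simp
  qed auto
qed

text \<open>The theorem of Arzela and Ascoli for curves in the Wasserstein space.  A diagonal sequence makes the
integrals of all test functions converge at all rational times; equicontinuity in time extends this to
every time, and the tail bounds turn it into convergence of measures.\<close>

theorem P1_curves_compact:
  fixes m :: "nat \<Rightarrow> real \<Rightarrow> (real ^ 'd::finite) measure"
  assumes T: "T > 0"
    and m: "\<And>n. m n \<in> L2_P1 T" and init: "\<And>n. m n 0 = \<mu>0"
    and tails: "uniform_tails (\<Union>n. m n ` {0..T})"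
    and equi: "\<And>\<phi>. \<phi> \<in> test_functions \<Longrightarrow> \<exists>L. \<forall>n. \<forall>s\<in>{0..T}. \<forall>t\<in>{0..T}.
      \<bar>(\<integral>x. \<phi> x \<partial>m n t) - (\<integral>x. \<phi> x \<partial>m n s)\<bar> \<le> L * \<bar>t - s\<bar>"
  obtains r \<mu> where "strict_mono (r :: nat \<Rightarrow> nat)" "\<mu> \<in> L2_P1 T" "\<mu> 0 = \<mu>0"
    "\<And>t. t \<in> {0..T} \<Longrightarrow> P1_tendsto (\<lambda>n. m (r n) t) (\<mu> t)"
proof -
  have P1: "m n t \<in> P1" if "t \<in> {0..T}" for n t
    using m[of n] that by (auto simp: L2_P1_def)
  have sub: "(\<Union>n. m n ` {0..T}) \<subseteq> P1" using P1 by blast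
  \<comment> \<open>all rationals; \<open>Q k\<close> imposes no condition if \<open>q k\<close> lies outside \<open>[0, T]\<close>\<close>
  define q where "q k = real_of_rat (nat_to_rat_surj k)" for k
  define Q where "Q k s \<longleftrightarrow> (q k \<in> {0..T} \<longrightarrow>
    (\<forall>\<phi>\<in>test_functions. convergent (\<lambda>n. \<integral>x. \<phi> x \<partial>m (s n) (q k))))" for k and s :: "nat \<Rightarrow> nat"
  interpret subseqs Q
  proof
    fix k and s :: "nat \<Rightarrow> nat"
    show "\<exists>r'. strict_mono r' \<and> Q k (s \<circ> r')"
    proof (cases "q k \<in> {0..T}")
      case True
      have "uniform_tails (range (\<lambda>n. m (s n) (q k)))"
        using True by (intro uniform_tails_subset[OF tails]) blast
      then have tight: "\<exists>R. \<forall>n. measure (m (s n) (q k)) {x. R < norm x} \<le> \<delta>" if "\<delta> > 0" for \<delta>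
        using uniform_tails_tight[OF _ _ that, of "range (\<lambda>n. m (s n) (q k))"] P1[OF True] by auto
      obtain r \<nu> where r: "strict_mono r"
        and conv: "\<And>f :: real ^ 'd \<Rightarrow> real. continuous_on UNIV f \<Longrightarrow> bounded (range f) \<Longrightarrow>
          (\<lambda>n. \<integral>x. f x \<partial>m (s (r n)) (q k)) \<longlonglongrightarrow> (\<integral>x. f x \<partial>\<nu>)"
        using tight_imp_weakly_convergent_subsequence[of "\<lambda>n. m (s n) (q k)",
            OF P1_simps(1)[OF P1[OF True]] P1_simps(2)[OF P1[OF True]] tight] by metis
      have "Q k (s \<circ> r)"
        unfolding Q_def
      proof (intro impI ballI)
        fix \<phi> :: "real ^ 'd \<Rightarrow> real" assume \<phi>: "\<phi> \<in> test_functions"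
        have "bounded (range \<phi>)"
          using test_function_bounded[OF \<phi>] by (auto simp: bounded_iff)
        from conv[OF test_function_continuous[OF \<phi>] this]
        show "convergent (\<lambda>n. \<integral>x. \<phi> x \<partial>m ((s \<circ> r) n) (q k))" by (auto simp: convergent_def)
      qed
      then show ?thesis using r by blast
    qed (auto simp: Q_def intro: strict_mono_id)
  qed
  define r where "r = diagseq"
  have r: "strict_mono r" unfolding r_def by (rule subseq_diagseq)
  have rat: "convergent (\<lambda>n. \<integral>x. \<phi> x \<partial>m (r n) (q k))"
    if "q k \<in> {0..T}" "\<phi> \<in> test_functions" for k \<phi>
  proof -
    have "Q k (diagseq \<circ> (+) (Suc k))"
    proof (rule diagseq_holds)
      fix r s :: "nat \<Rightarrow> nat" and n assume "strict_mono r" "Q n s"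
      then show "Q n (s \<circ> r)"
        unfolding Q_def by (auto simp: convergent_def comp_def dest!: bspec intro: LIMSEQ_subseq_LIMSEQ[unfolded comp_def])
    qed
    then have "convergent (\<lambda>n. \<integral>x. \<phi> x \<partial>m (r (n + Suc k)) (q k))"
      using that by (simp add: Q_def r_def comp_def add.commute)
    then show ?thesis by (rule convergent_ignore_initial_segment[THEN iffD1])
  qed
  have conv: "convergent (\<lambda>n. \<integral>x. \<phi> x \<partial>m (r n) t)" if t: "t \<in> {0..T}" and \<phi>: "\<phi> \<in> test_functions" for t \<phi>
  proof -
    obtain L0 where L0: "\<And>n s t. s \<in> {0..T} \<Longrightarrow> t \<in> {0..T} \<Longrightarrow>
      \<bar>(\<integral>x. \<phi> x \<partial>m n t) - (\<integral>x. \<phi> x \<partial>m n s)\<bar> \<le> L0 * \<bar>t - s\<bar>"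
      using equi[OF \<phi>] by blast
    define L where "L = max L0 1"
    have L: "\<bar>(\<integral>x. \<phi> x \<partial>m n t) - (\<integral>x. \<phi> x \<partial>m n s)\<bar> \<le> L * \<bar>t - s\<bar>"
      if "s \<in> {0..T}" "t \<in> {0..T}" for n s t
      using L0[OF that, of n] mult_right_mono[of L0 L "\<bar>t - s\<bar>"] by (auto simp: L_def)
    have "L \<ge> 1" by (simp add: L_def)
    have "Cauchy (\<lambda>n. \<integral>x. \<phi> x \<partial>m (r n) t)"
    proof (rule CauchyI)
      fix \<delta> :: real assume \<delta>: "\<delta> > 0"
      define h where "h = \<delta> / (4 * L)"
      have h: "h > 0" using \<delta> \<open>L \<ge> 1\<close> by (simp add: h_def)
      have "max 0 (t - h) < min T (t + h)" using t T h by auto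
      then obtain k where k: "max 0 (t - h) < q k" "q k < min T (t + h)"
        using Rats_dense_in_real[of "max 0 (t - h)" "min T (t + h)"] surj_nat_to_rat_surj
        unfolding q_def Rats_def surj_def by auto metis
      then have qk: "q k \<in> {0..T}" "\<bar>t - q k\<bar> \<le> h" by auto
      obtain N where N: "\<And>i j. i \<ge> N \<Longrightarrow> j \<ge> N \<Longrightarrow>
          norm ((\<integral>x. \<phi> x \<partial>m (r i) (q k)) - (\<integral>x. \<phi> x \<partial>m (r j) (q k))) < \<delta> / 4"
        using CauchyD[OF convergent_Cauchy[OF rat[OF qk(1) \<phi>]], of "\<delta> / 4"] \<delta> by auto
      have "\<bar>(\<integral>x. \<phi> x \<partial>m n t) - (\<integral>x. \<phi> x \<partial>m n (q k))\<bar> \<le> \<delta> / 4" for n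
        using L[OF qk(1) t, of n] mult_left_mono[OF qk(2), of L] \<open>L \<ge> 1\<close> by (simp add: h_def)
      note near = this
      have "norm ((\<integral>x. \<phi> x \<partial>m (r i) t) - (\<integral>x. \<phi> x \<partial>m (r j) t)) < \<delta>" if "i \<ge> N" "j \<ge> N" for i j
        using near[of "r i"] near[of "r j"] N[OF that] \<delta> unfolding real_norm_def abs_less_iff abs_le_iff by simp
      then show "\<exists>N. \<forall>i\<ge>N. \<forall>j\<ge>N. norm ((\<integral>x. \<phi> x \<partial>m (r i) t) - (\<integral>x. \<phi> x \<partial>m (r j) t)) < \<delta>" by blast
    qed
    then show ?thesis by (rule Cauchy_convergent)
  qed
  \<comment> \<open>at time \<open>0\<close> the sequence is constant, and \<open>\<mu>0\<close> itself is taken as the limit\<close>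
  have "\<exists>\<nu>. \<nu> \<in> P1 \<and> P1_tendsto (\<lambda>n. m (r n) t) \<nu> \<and> (t = 0 \<longrightarrow> \<nu> = \<mu>0)" if t: "t \<in> {0..T}" for t
  proof (cases "t = 0")
    case True
    then show ?thesis using P1[OF t, of 0] by (auto simp: init P1_tendsto_def)
  next
    case False
    have "uniform_tails (range (\<lambda>n. m (r n) t))"
      using t by (intro uniform_tails_subset[OF tails]) blast
    from P1_limit_exists[OF P1[OF t] this conv[OF t]] False show ?thesis by blast
  qed
  then obtain \<mu> where \<mu>: "\<And>t. t \<in> {0..T} \<Longrightarrow> \<mu> t \<in> P1"
    "\<And>t. t \<in> {0..T} \<Longrightarrow> P1_tendsto (\<lambda>n. m (r n) t) (\<mu> t)" "\<And>t. t \<in> {0..T} \<Longrightarrow> t = 0 \<longrightarrow> \<mu> t = \<mu>0"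
    by metis
  have m_meas: "(\<lambda>t. \<integral>x. f x \<partial>m n t) \<in> borel_measurable (lebesgue_on {0..T})"
    if "f \<in> borel_measurable borel" for n and f :: "real ^ 'd \<Rightarrow> real"
    using m[of n] measurable_compose[OF measurable_prob_algebraD integral_measurable_subprob_algebra[OF that]]
    by (auto simp: L2_P1_def)
  have "\<mu> \<in> L2_P1 T"
    unfolding L2_P1_def
  proof (intro CollectI conjI ballI \<mu>(1))
    show "\<mu> \<in> lebesgue_on {0..T} \<rightarrow>\<^sub>M prob_algebra borel"
    proof (rule measurable_prob_algebra_borelI)
      fix f :: "real ^ 'd \<Rightarrow> real" assume f: "continuous_on UNIV f" "\<And>x. \<bar>f x\<bar> \<le> 1"
      show "(\<lambda>t. \<integral>x. f x \<partial>\<mu> t) \<in> borel_measurable (lebesgue_on {0..T})"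
      proof (rule borel_measurable_LIMSEQ_real)
        show "(\<lambda>n. \<integral>x. f x \<partial>m (r n) t) \<longlonglongrightarrow> (\<integral>x. f x \<partial>\<mu> t)" if "t \<in> space (lebesgue_on {0..T})" for t
          using P1_tendsto_bounded[OF \<mu>(2) f] that by simp
      qed (rule m_meas[OF borel_measurable_continuous_onI[OF f(1)]])
    qed (use \<mu>(1) in simp)
    obtain M where M: "M \<ge> 0" "\<And>\<kappa>. \<kappa> \<in> (\<Union>n. m n ` {0..T}) \<Longrightarrow> (\<integral>x. norm x \<partial>\<kappa>) \<le> M"
      using uniform_tails_moment_bound[OF tails sub] by blast
    have norm_le: "(\<integral>x. norm x \<partial>\<mu> t) \<le> M" if "t \<in> {0..T}" for t
    proof (rule LIMSEQ_le_const2[OF P1_tendsto_norm[OF \<mu>(2)[OF that]]])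
      have "(\<integral>x. norm x \<partial>m (r n) t) \<le> M" for n
        using M(2)[of "m (r n) t"] that by blast
      then show "\<exists>N. \<forall>n\<ge>N. (\<integral>x. norm x \<partial>m (r n) t) \<le> M" by blast
    qed
    interpret finite_measure "lebesgue_on {0..T}"
      by (rule finite_measure_lebesgue_on) simp
    show "integrable (lebesgue_on {0..T}) (\<lambda>t. (\<integral>x. norm x \<partial>\<mu> t)\<^sup>2)"
    proof (rule integrable_const_bound)
      show "AE t in lebesgue_on {0..T}. norm ((\<integral>x. norm x \<partial>\<mu> t)\<^sup>2) \<le> M\<^sup>2"
        using norm_le by (intro AE_I2) (auto intro!: power_mono)
      have "(\<lambda>t. \<integral>x. norm x \<partial>\<mu> t) \<in> borel_measurable (lebesgue_on {0..T})"
      proof (rule borel_measurable_LIMSEQ_real)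
        show "(\<lambda>n. \<integral>x. norm x \<partial>m (r n) t) \<longlonglongrightarrow> (\<integral>x. norm x \<partial>\<mu> t)" if "t \<in> space (lebesgue_on {0..T})" for t
          using P1_tendsto_norm[OF \<mu>(2)] that by simp
      qed (rule m_meas, simp)
      then show "(\<lambda>t. (\<integral>x. norm x \<partial>\<mu> t)\<^sup>2) \<in> borel_measurable (lebesgue_on {0..T})" by simp
    qed
  qed
  moreover have "\<mu> 0 = \<mu>0" using \<mu>(3)[of 0] T by simp
  ultimately show thesis using that[OF r] \<mu>(2) by blast
qed

section \<open>The collision integral\<close>

text \<open>On \<open>{0, 1}\<times>{0, 1}\<close> every function of \<open>(\<theta>, \<theta>')\<close> is a combination of \<open>1\<close>, \<open>\<theta>\<close>, \<open>\<theta>'\<close> and \<open>\<theta> * \<theta>'\<close>, whose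
expectations are \<open>1\<close>, \<open>p\<close>, \<open>p\<close> and, by independence, \<open>p * p\<close>.\<close>

lemma bernoulli_expectation:
  fixes g :: "real \<Rightarrow> real \<Rightarrow> 'b::{banach, second_countable_topology}"
  assumes P: "prob_space P" and \<Theta>: "bernoulli_rv P p \<Theta>" "bernoulli_rv P p \<Theta>'"
    and indep: "prob_space.indep_var P borel \<Theta> borel \<Theta>'"
  shows "(\<integral>\<omega>. g (\<Theta> \<omega>) (\<Theta>' \<omega>) \<partial>P) =
    (1 - p)\<^sup>2 *\<^sub>R g 0 0 + (p * (1 - p)) *\<^sub>R g 0 1 + (p * (1 - p)) *\<^sub>R g 1 0 + p\<^sup>2 *\<^sub>R g 1 1"
proof -
  interpret prob_space P by (rule P)
  have one: "integrable P X" "(\<integral>\<omega>. X \<omega> \<partial>P) = p" if "bernoulli_rv P p X" for X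
  proof -
    have X: "X \<in> borel_measurable P" "\<And>\<omega>. \<omega> \<in> space P \<Longrightarrow> X \<omega> \<in> {0, 1}"
      "prob {\<omega> \<in> space P. X \<omega> = 1} = p"
      using that by (auto simp: bernoulli_rv_def)
    show "integrable P X"
      by (rule integrable_const_bound[of _ 1]) (use X(1,2) in \<open>fastforce intro!: AE_I2\<close>)+
    have "(\<integral>\<omega>. X \<omega> \<partial>P) = (\<integral>\<omega>. indicator {\<omega> \<in> space P. X \<omega> = 1} \<omega> \<partial>P)"
      using X(2) by (intro Bochner_Integration.integral_cong) (auto simp: indicator_def)
    then show "(\<integral>\<omega>. X \<omega> \<partial>P) = p"
      using X(1,3) by simp
  qed
  note [simp] = one[OF \<Theta>(1)] one[OF \<Theta>(2)]
  have prod [simp]: "integrable P (\<lambda>\<omega>. \<Theta> \<omega> * \<Theta>' \<omega>)" "(\<integral>\<omega>. \<Theta> \<omega> * \<Theta>' \<omega> \<partial>P) = p * p"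
    using indep_var_integrable[OF indep] indep_var_lebesgue_integral[OF indep] by simp_all
  have "(\<integral>\<omega>. g (\<Theta> \<omega>) (\<Theta>' \<omega>) \<partial>P) = (\<integral>\<omega>.
      (1 - \<Theta> \<omega> - \<Theta>' \<omega> + \<Theta> \<omega> * \<Theta>' \<omega>) *\<^sub>R g 0 0 + (\<Theta>' \<omega> - \<Theta> \<omega> * \<Theta>' \<omega>) *\<^sub>R g 0 1
      + (\<Theta> \<omega> - \<Theta> \<omega> * \<Theta>' \<omega>) *\<^sub>R g 1 0 + (\<Theta> \<omega> * \<Theta>' \<omega>) *\<^sub>R g 1 1 \<partial>P)"
  proof (rule Bochner_Integration.integral_cong[OF refl])
    fix \<omega> assume "\<omega> \<in> space P"
    then have "\<Theta> \<omega> = 0 \<or> \<Theta> \<omega> = 1" "\<Theta>' \<omega> = 0 \<or> \<Theta>' \<omega> = 1"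
      using \<Theta> by (auto simp: bernoulli_rv_def)
    then show "g (\<Theta> \<omega>) (\<Theta>' \<omega>) =
      (1 - \<Theta> \<omega> - \<Theta>' \<omega> + \<Theta> \<omega> * \<Theta>' \<omega>) *\<^sub>R g 0 0 + (\<Theta>' \<omega> - \<Theta> \<omega> * \<Theta>' \<omega>) *\<^sub>R g 0 1
      + (\<Theta> \<omega> - \<Theta> \<omega> * \<Theta>' \<omega>) *\<^sub>R g 1 0 + (\<Theta> \<omega> * \<Theta>' \<omega>) *\<^sub>R g 1 1"
      by (elim disjE) simp_all
  qed
  also have "\<dots> = (1 - p - p + p * p) *\<^sub>R g 0 0 + (p - p * p) *\<^sub>R g 0 1
      + (p - p * p) *\<^sub>R g 1 0 + (p * p) *\<^sub>R g 1 1"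
    by (simp add: prob_space)
  finally show ?thesis by (simp add: power2_eq_square algebra_simps)
qed

lemma interaction_kernel_bounded:
  assumes H: "admissible_interaction H" and G: "\<And>l. admissible_interaction (G l)" and U: "bounded U"
  shows "\<exists>C\<ge>0. \<forall>\<theta>\<in>{0, 1}. \<forall>\<theta>'\<in>{0, 1}. \<forall>v\<in>U. \<forall>v'\<in>U. \<forall>x y.
    norm (interaction_kernel H G \<theta> \<theta>' v v' x y) \<le> C"
proof -
  obtain BH where BH: "\<And>z. norm (H z) \<le> BH"
    using H by (auto simp: admissible_interaction_def bounded_iff)
  have "\<exists>B. \<forall>z. norm (G l z) \<le> B" for l
    using G[of l] by (auto simp: admissible_interaction_def bounded_iff)
  then obtain BG where BG: "\<And>l z. norm (G l z) \<le> BG l" by metis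
  obtain BU0 where BU0: "\<And>v. v \<in> U \<Longrightarrow> norm v \<le> BU0"
    using U by (auto simp: bounded_iff)
  define BU where "BU = max BU0 0"
  have BU: "\<And>v. v \<in> U \<Longrightarrow> norm v \<le> BU" "BU \<ge> 0" using BU0 by (force simp: BU_def)+
  have BH0: "BH \<ge> 0" using order_trans[OF norm_ge_zero BH] by blast
  have BG0: "BG l \<ge> 0" for l using order_trans[OF norm_ge_zero BG] by blast
  define S where "S = (\<Sum>l\<in>UNIV. BU * BG l)"
  have S0: "S \<ge> 0" unfolding S_def using BG0 BU(2) by (intro sum_nonneg) auto
  show ?thesis
  proof (intro exI[of _ "BH + (S + BU)"] conjI ballI allI)
    show "0 \<le> BH + (S + BU)" using BH0 S0 BU(2) by simp
    fix \<theta> \<theta>' :: real and v v' x y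
    assume \<theta>: "\<theta> \<in> {0, 1}" "\<theta>' \<in> {0, 1}" and v: "v \<in> U" "v' \<in> U"
    have "norm (\<Sum>l\<in>UNIV. (v' $ l) *\<^sub>R G l (x - y)) \<le> S"
      unfolding S_def
    proof (rule sum_norm_le)
      fix l
      have "\<bar>v' $ l\<bar> \<le> BU"
        using component_le_norm_cart[of v' l] BU(1)[OF v(2)] by simp
      then show "norm ((v' $ l) *\<^sub>R G l (x - y)) \<le> BU * BG l"
        using BG[of l "x - y"] BU(2) by (simp add: mult_mono)
    qed
    moreover have "norm (H (x - y)) \<le> BH" "norm v \<le> BU" using BH BU(1) v by auto
    ultimately show "norm (interaction_kernel H G \<theta> \<theta>' v v' x y) \<le> BH + (S + BU)"
      using \<theta> BH0 S0 BU(2) by (auto simp: interaction_kernel_def)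
  qed
qed

lemma abs_integral_le:
  fixes f g :: "'a \<Rightarrow> real"
  assumes "integrable M g" "\<And>x. x \<in> space M \<Longrightarrow> \<bar>f x\<bar> \<le> g x"
  shows "\<bar>\<integral>x. f x \<partial>M\<bar> \<le> (\<integral>x. g x \<partial>M)"
proof (cases "integrable M f")
  case True
  have "\<bar>\<integral>x. f x \<partial>M\<bar> \<le> (\<integral>x. \<bar>f x\<bar> \<partial>M)" by (rule integral_abs_bound)
  also have "\<dots> \<le> (\<integral>x. g x \<partial>M)"
    using True assms by (intro integral_mono) auto
  finally show ?thesis .
next
  case False
  \<comment> \<open>then the integral of \<open>f\<close> is \<open>0\<close> by convention\<close>
  have "0 \<le> g x" if "x \<in> space M" for x using assms(2)[OF that] by linarith
  then have "0 \<le> (\<integral>x. g x \<partial>M)" by (intro integral_nonneg_AE AE_I2)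
  then show ?thesis using False by (simp add: not_integrable_integral_eq)
qed

lemma (in prob_space) abs_integral_le_const:
  fixes f :: "'a \<Rightarrow> real"
  assumes "\<And>x. x \<in> space M \<Longrightarrow> \<bar>f x\<bar> \<le> c"
  shows "\<bar>\<integral>x. f x \<partial>M\<bar> \<le> c"
  using abs_integral_le[of M "\<lambda>_. c" f] assms by (simp add: prob_space)

lemma has_time_derivative_interval:
  assumes "has_time_derivative T F f" "0 \<le> s" "s \<le> t" "t \<le> T"
  shows "(f has_integral (F t - F s)) {s..t}"
proof -
  have s: "(f has_integral (F s - F 0)) {0..s}" and t: "(f has_integral (F t - F 0)) {0..t}"
    using assms by (auto simp: has_time_derivative_def)
  have "f integrable_on {s..t}"
    by (rule integrable_subinterval_real[OF has_integral_integrable[OF t]]) (use assms in auto)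
  moreover have "integral {0..s} f + integral {s..t} f = integral {0..t} f"
    by (rule Henstock_Kurzweil_Integration.integral_combine[OF assms(2,3) has_integral_integrable[OF t]])
  ultimately show ?thesis
    using integral_unique[OF s] integral_unique[OF t] by (simp add: has_integral_iff)
qed

text \<open>A collision moves an agent by at most \<open>\<alpha> * C\<close>.  If this changes \<open>\<phi>\<close> by at most \<open>\<alpha> * g x\<close>, the
interaction frequency \<open>1 / \<alpha>\<close> turns the change into a rate that does not depend on \<open>\<alpha>\<close>.\<close>

lemma collision_integral_bound:
  assumes P: "prob_space P" and \<Theta>: "\<And>\<omega>. \<omega> \<in> space P \<Longrightarrow> \<Theta> \<omega> \<in> {0, 1} \<and> \<Theta>' \<omega> \<in> {0, 1}"
    and C: "\<And>\<theta> \<theta>' x y. \<theta> \<in> {0, 1} \<Longrightarrow> \<theta>' \<in> {0, 1} \<Longrightarrow> norm (interaction_kernel H G \<theta> \<theta>' v v' x y) \<le> C"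
    and \<alpha>: "\<alpha> > 0" and \<kappa>: "prob_space \<kappa>" "integrable \<kappa> g"
    and \<phi>: "\<And>x h. norm h \<le> \<alpha> * C \<Longrightarrow> \<bar>\<phi> (x + h) - \<phi> x\<bar> \<le> \<alpha> * g x"
  shows "\<bar>1 / \<alpha> * (\<integral>\<omega>. (\<integral>y. (\<integral>x. (\<phi> (post_interaction H G \<alpha> (\<Theta> \<omega>) (\<Theta>' \<omega>) v v' x y) - \<phi> x) \<partial>\<kappa>) \<partial>\<kappa>) \<partial>P)\<bar>
    \<le> (\<integral>x. g x \<partial>\<kappa>)"
proof -
  have "\<bar>\<integral>\<omega>. (\<integral>y. (\<integral>x. (\<phi> (post_interaction H G \<alpha> (\<Theta> \<omega>) (\<Theta>' \<omega>) v v' x y) - \<phi> x) \<partial>\<kappa>) \<partial>\<kappa>) \<partial>P\<bar>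
      \<le> (\<integral>x. \<alpha> * g x \<partial>\<kappa>)"
  proof (rule prob_space.abs_integral_le_const[OF P], rule prob_space.abs_integral_le_const[OF \<kappa>(1)],
      rule abs_integral_le)
    show "integrable \<kappa> (\<lambda>x. \<alpha> * g x)" using \<kappa>(2) by simp
    fix \<omega> y x assume "\<omega> \<in> space P"
    then have "norm (interaction_kernel H G (\<Theta> \<omega>) (\<Theta>' \<omega>) v v' x y) \<le> C"
      using \<Theta> C by blast
    then have "norm (\<alpha> *\<^sub>R interaction_kernel H G (\<Theta> \<omega>) (\<Theta>' \<omega>) v v' x y) \<le> \<alpha> * C"
      using \<alpha> by simp
    from \<phi>[OF this, of x]
    show "\<bar>\<phi> (post_interaction H G \<alpha> (\<Theta> \<omega>) (\<Theta>' \<omega>) v v' x y) - \<phi> x\<bar> \<le> \<alpha> * g x"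
      by (simp add: post_interaction_def)
  qed
  then show ?thesis using \<alpha> by (simp add: abs_mult field_simps)
qed

lemma collision_integral_lipschitz_bound:
  assumes P: "prob_space P" and \<Theta>: "\<And>\<omega>. \<omega> \<in> space P \<Longrightarrow> \<Theta> \<omega> \<in> {0, 1} \<and> \<Theta>' \<omega> \<in> {0, 1}"
    and C: "\<And>\<theta> \<theta>' x y. \<theta> \<in> {0, 1} \<Longrightarrow> \<theta>' \<in> {0, 1} \<Longrightarrow> norm (interaction_kernel H G \<theta> \<theta>' v v' x y) \<le> C"
    and \<alpha>: "\<alpha> > 0" and \<kappa>: "prob_space \<kappa>"
    and \<phi>: "L \<ge> 0" "\<And>x y. \<bar>\<phi> x - \<phi> y\<bar> \<le> L * norm (x - y)"
  shows "\<bar>1 / \<alpha> * (\<integral>\<omega>. (\<integral>y. (\<integral>x. (\<phi> (post_interaction H G \<alpha> (\<Theta> \<omega>) (\<Theta>' \<omega>) v v' x y) - \<phi> x) \<partial>\<kappa>) \<partial>\<kappa>) \<partial>P)\<bar>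
    \<le> L * C"
proof -
  interpret prob_space \<kappa> by (rule \<kappa>)
  have "\<bar>1 / \<alpha> * (\<integral>\<omega>. (\<integral>y. (\<integral>x. (\<phi> (post_interaction H G \<alpha> (\<Theta> \<omega>) (\<Theta>' \<omega>) v v' x y) - \<phi> x) \<partial>\<kappa>) \<partial>\<kappa>) \<partial>P)\<bar>
      \<le> (\<integral>x. L * C \<partial>\<kappa>)"
  proof (rule collision_integral_bound[OF P \<Theta> C \<alpha> \<kappa>])
    fix x h :: "real ^ 'b" assume "norm h \<le> \<alpha> * C"
    then have "L * norm h \<le> L * (\<alpha> * C)" using \<phi>(1) by (rule mult_left_mono)
    then show "\<bar>\<phi> (x + h) - \<phi> x\<bar> \<le> \<alpha> * (L * C)"
      using \<phi>(2)[of "x + h" x] by (simp add: mult_ac)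
  qed auto
  then show ?thesis by (simp add: prob_space)
qed

text \<open>The source of equicontinuity in time: the constant \<open>L * C\<close> is the same for all \<open>\<alpha>\<close>.\<close>

lemma boltzmann_time_lipschitz:
  fixes \<mu> :: "real \<Rightarrow> (real ^ 'd::finite) measure"
  assumes P: "prob_space P" and \<Theta>: "\<And>\<omega>. \<omega> \<in> space P \<Longrightarrow> \<Theta> \<omega> \<in> {0, 1} \<and> \<Theta>' \<omega> \<in> {0, 1}"
    and C: "C \<ge> 0" "\<And>\<theta> \<theta>' t x y. \<theta> \<in> {0, 1} \<Longrightarrow> \<theta>' \<in> {0, 1} \<Longrightarrow> t \<in> {0..T} \<Longrightarrow>
      norm (interaction_kernel H G \<theta> \<theta>' (u t) (u' t) x y) \<le> C"
    and \<alpha>: "\<alpha> > 0" and sol: "boltzmann_weak_solution P \<Theta> \<Theta>' H G \<alpha> (1 / \<alpha>) u u' T \<mu>0 \<mu>"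
    and \<phi>: "\<phi> \<in> test_functions" "L \<ge> 0" "\<And>x y. \<bar>\<phi> x - \<phi> y\<bar> \<le> L * norm (x - y)"
    and s: "s \<in> {0..T}" and t: "t \<in> {0..T}"
  shows "\<bar>(\<integral>x. \<phi> x \<partial>\<mu> t) - (\<integral>x. \<phi> x \<partial>\<mu> s)\<bar> \<le> L * C * \<bar>t - s\<bar>"
proof -
  let ?f = "\<lambda>t. 1 / \<alpha> * (\<integral>\<omega>. (\<integral>y. (\<integral>x.
    (\<phi> (post_interaction H G \<alpha> (\<Theta> \<omega>) (\<Theta>' \<omega>) (u t) (u' t) x y) - \<phi> x) \<partial>\<mu> t) \<partial>\<mu> t) \<partial>P)"
  have P1: "\<mu> t \<in> P1" if "t \<in> {0..T}" for t
    using sol that by (auto simp: boltzmann_weak_solution_def L2_P1_def)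
  have bound: "\<bar>?f t\<bar> \<le> L * C" if t: "t \<in> {0..T}" for t
    by (rule collision_integral_lipschitz_bound[OF P \<Theta> C(2) \<alpha> P1_simps(1)[OF P1[OF t]] \<phi>(2,3)])
      (use t in auto)
  have der: "has_time_derivative T (\<lambda>t. \<integral>x. \<phi> x \<partial>\<mu> t) ?f"
    using sol \<phi>(1) by (simp add: boltzmann_weak_solution_def)
  have *: "\<bar>(\<integral>x. \<phi> x \<partial>\<mu> t) - (\<integral>x. \<phi> x \<partial>\<mu> s)\<bar> \<le> L * C * \<bar>t - s\<bar>"
    if "0 \<le> s" "s \<le> t" "t \<le> T" for s t
  proof -
    have "norm ((\<integral>x. \<phi> x \<partial>\<mu> t) - (\<integral>x. \<phi> x \<partial>\<mu> s)) \<le> L * C * measure lborel (cbox s t)"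
      using has_time_derivative_interval[OF der that] bound that \<phi>(2) C(1)
      by (intro has_integral_bound[of _ ?f]) auto
    then show ?thesis using that by (simp add: mult_ac)
  qed
  show ?thesis
  proof (cases "s \<le> t")
    case True then show ?thesis using *[of s t] s t by auto
  next
    case False then show ?thesis using *[of t s] s t by (auto simp: abs_minus_commute)
  qed
qed

section \<open>Moment bounds uniform in the scaling parameter\<close>

text \<open>A smooth function that grows like the norm at distances beyond \<open>R\<close>, but whose gradient at \<open>x\<close> is at most
\<open>norm x / R\<close>, hence small, for large \<open>R\<close>, where most of the mass is.\<close>

definition soft_norm :: "real \<Rightarrow> 'a::real_inner \<Rightarrow> real" where
  "soft_norm R x = sqrt (R\<^sup>2 + x \<bullet> x) - R"

lemma soft_norm_elementary:
  assumes "R > 0"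
  shows "soft_norm R \<in> elementary"
proof -
  have "soft_norm R x = (R\<^sup>2 + x \<bullet> x) * (1 / sqrt (R\<^sup>2 + x \<bullet> x)) + (- R)" for x :: "real ^ 'd"
    by (simp add: soft_norm_def real_div_sqrt)
  then have "soft_norm R = (\<lambda>x :: real ^ 'd. (R\<^sup>2 + x \<bullet> x) * (1 / sqrt (R\<^sup>2 + x \<bullet> x)) + (- R))"
    by blast
  also have "\<dots> \<in> elementary"
    using assms by (intro elementary.intros elementary_inner) auto
  finally show ?thesis .
qed

lemma soft_norm_eq: "R \<ge> 0 \<Longrightarrow> soft_norm R x = norm (R, x) - R"
  by (simp add: soft_norm_def norm_Pair dot_square_norm)

lemma soft_norm_bounds:
  assumes "R \<ge> 0"
  shows "0 \<le> soft_norm R x" "soft_norm R x \<le> norm x" "excess R x \<le> soft_norm R x"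
proof -
  show "0 \<le> soft_norm R x"
    using norm_fst_le[of R x] assms by (simp add: soft_norm_eq[OF assms])
  show "soft_norm R x \<le> norm x"
    using norm_Pair_le[of R x] assms by (simp add: soft_norm_eq[OF assms])
  then show "excess R x \<le> soft_norm R x"
    using norm_snd_le[of x R] \<open>0 \<le> soft_norm R x\<close> assms by (simp add: soft_norm_eq[OF assms] excess_def)
qed

lemma soft_norm_lipschitz:
  assumes "R \<ge> 0"
  shows "\<bar>soft_norm R (x + h) - soft_norm R x\<bar> \<le> norm h"
  using norm_triangle_ineq3[of "(R, x + h)" "(R, x)"] by (simp add: soft_norm_eq[OF assms] norm_Pair)

lemma P1_integrable_soft_norm:
  fixes \<mu> :: "'a::euclidean_space measure"
  assumes "\<mu> \<in> P1" "R \<ge> 0"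
  shows "integrable \<mu> (soft_norm R)"
proof (rule P1_integrable[OF assms(1), of _ 1])
  show "continuous_on UNIV (soft_norm R :: 'a \<Rightarrow> real)"
    unfolding soft_norm_def by (intro continuous_intros)
  show "norm (soft_norm R x) \<le> 1 * (1 + norm x)" for x :: 'a
    using soft_norm_bounds[OF assms(2), of x] by simp
qed

lemma abs_norm_square_diff: "\<bar>(norm (x + h))\<^sup>2 - (norm x)\<^sup>2\<bar> \<le> norm h * (2 * norm x + norm h)"
proof -
  have "\<bar>(norm (x + h))\<^sup>2 - (norm x)\<^sup>2\<bar> = \<bar>norm (x + h) - norm x\<bar> * (norm (x + h) + norm x)"
    by (simp add: square_diff_square_factored power2_eq_square abs_mult mult.commute)
  also have "\<dots> \<le> norm h * (2 * norm x + norm h)"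
    using norm_triangle_ineq3[of "x + h" x] norm_triangle_ineq[of x h]
    by (intro mult_mono) auto
  finally show ?thesis .
qed

lemma soft_norm_increment:
  assumes "R > 0" "norm h \<le> D"
  shows "\<bar>soft_norm R (x + h) - soft_norm R x\<bar> \<le> norm h * ((2 * norm x + D) / (2 * R))"
proof -
  define a where "a = sqrt (R\<^sup>2 + (x + h) \<bullet> (x + h))"
  define b where "b = sqrt (R\<^sup>2 + x \<bullet> x)"
  have ab: "a \<ge> R" "b \<ge> R"
    unfolding a_def b_def using assms(1) by (auto intro!: real_le_rsqrt)
  have "a\<^sup>2 - b\<^sup>2 = (norm (x + h))\<^sup>2 - (norm x)\<^sup>2"
    by (simp add: a_def b_def dot_square_norm)
  moreover have "\<bar>a\<^sup>2 - b\<^sup>2\<bar> = \<bar>a - b\<bar> * (a + b)"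
    using ab assms(1) by (simp add: square_diff_square_factored power2_eq_square abs_mult mult.commute)
  ultimately have "\<bar>a - b\<bar> * (a + b) \<le> norm h * (2 * norm x + norm h)"
    using abs_norm_square_diff[of x h] by simp
  also have "\<dots> \<le> norm h * (2 * norm x + D)" using assms(2) by (intro mult_left_mono) auto
  finally have "\<bar>a - b\<bar> * (a + b) \<le> norm h * (2 * norm x + D)" .
  moreover have "\<bar>a - b\<bar> * (2 * R) \<le> \<bar>a - b\<bar> * (a + b)" using ab by (intro mult_left_mono) auto
  ultimately have "\<bar>a - b\<bar> * (2 * R) \<le> norm h * (2 * norm x + D)" by linarith
  then show ?thesis using assms(1) by (simp add: soft_norm_def a_def b_def field_simps)
qed

text \<open>The cut-off at scale \<open>N\<close> depends on \<open>(norm x / N)\<^sup>2\<close> and vanishes for \<open>norm x \<ge> N\<close>, so it only changes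
where \<open>norm x\<close> is at most \<open>2 * N\<close>, and there by \<open>O (norm h / N)\<close>.\<close>

lemma bump_increment:
  fixes x h :: "'a::real_inner"
  assumes N: "N > 0" and h: "norm h \<le> N"
  shows "\<bar>exp_flat 0 (1 - (1 / N\<^sup>2) * ((x + h) \<bullet> (x + h))) - exp_flat 0 (1 - (1 / N\<^sup>2) * (x \<bullet> x))\<bar>
    \<le> 10 * norm h / N"
proof (cases "norm x \<le> 2 * N")
  case True
  have "\<bar>exp_flat 0 (1 - (1 / N\<^sup>2) * ((x + h) \<bullet> (x + h))) - exp_flat 0 (1 - (1 / N\<^sup>2) * (x \<bullet> x))\<bar>
      \<le> 2 * \<bar>(1 - (1 / N\<^sup>2) * ((x + h) \<bullet> (x + h))) - (1 - (1 / N\<^sup>2) * (x \<bullet> x))\<bar>"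
    by (rule exp_flat_0_lipschitz)
  also have "\<dots> = 2 * (\<bar>(norm (x + h))\<^sup>2 - (norm x)\<^sup>2\<bar> / N\<^sup>2)"
    by (simp add: dot_square_norm abs_minus_commute flip: diff_divide_distrib)
  also have "\<dots> \<le> 2 * ((norm h * (5 * N)) / N\<^sup>2)"
  proof (intro mult_left_mono divide_right_mono)
    have "norm h * (2 * norm x + norm h) \<le> norm h * (5 * N)"
      using True h by (intro mult_left_mono) auto
    then show "\<bar>(norm (x + h))\<^sup>2 - (norm x)\<^sup>2\<bar> \<le> norm h * (5 * N)"
      using abs_norm_square_diff[of x h] by linarith
  qed auto
  also have "\<dots> = 10 * norm h / N" using N by (simp add: power2_eq_square)
  finally show ?thesis .
next
  case False
  have zero: "exp_flat 0 (1 - (1 / N\<^sup>2) * (z \<bullet> z)) = 0" if "N \<le> norm z" for z :: 'a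
  proof -
    have "N\<^sup>2 \<le> (norm z)\<^sup>2" using that N by (intro power_mono) auto
    then have "1 \<le> (norm z)\<^sup>2 / N\<^sup>2" using N by simp
    then show ?thesis by (simp add: exp_flat_def dot_square_norm)
  qed
  have "norm x \<le> norm (x + h) + norm h" using norm_triangle_ineq4[of "x + h" h] by simp
  then have "N \<le> norm (x + h)" "N \<le> norm x" using False h N by auto
  then show ?thesis using N by (simp only: zero) simp
qed

lemma bump_tendsto_1:
  "(\<lambda>n. exp 1 * exp_flat 0 (1 - (1 / (real (Suc n))\<^sup>2) * (x \<bullet> x))) \<longlonglongrightarrow> 1"
proof -
  have "(\<lambda>n. 1 / (real (Suc n))) \<longlonglongrightarrow> 0" by (rule LIMSEQ_Suc[OF lim_1_over_n])
  from tendsto_mult[OF tendsto_power[OF this, of 2] tendsto_const[of "x \<bullet> x"]]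
  have "(\<lambda>n. (1 / (real (Suc n))\<^sup>2) * (x \<bullet> x)) \<longlonglongrightarrow> 0"
    by (simp add: power_one_over)
  from tendsto_diff[OF tendsto_const[of 1] this]
  have lim: "(\<lambda>n. 1 - (1 / (real (Suc n))\<^sup>2) * (x \<bullet> x)) \<longlonglongrightarrow> 1" by simp
  have "isCont (exp_flat 0) 1" using exp_flat_has_derivative DERIV_isCont by blast
  from isCont_tendsto_compose[OF this lim]
  have "(\<lambda>n. exp_flat 0 (1 - (1 / (real (Suc n))\<^sup>2) * (x \<bullet> x))) \<longlonglongrightarrow> exp (- 1)"
    by (simp add: exp_flat_def)
  from tendsto_mult[OF tendsto_const[of "exp 1"] this] show ?thesis
    by (simp add: exp_minus)
qed

text \<open>This extends the weak formulation, as an inequality, to functions \<open>\<phi>\<close> of linear growth.  It is applied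
to \<open>\<phi>\<close> times a bump of scale \<open>N\<close>.  The increments of the bump contribute at most a multiple of
\<open>norm x / N\<close>, and the first moment of a curve in \<^term>\<open>L2_P1 T\<close> is integrable in time; so this
contribution disappears for \<open>N \<rightarrow> \<infinity>\<close> while \<open>\<alpha>\<close> stays fixed.\<close>

lemma boltzmann_moment_estimate:
  fixes \<mu> :: "real \<Rightarrow> (real ^ 'd::finite) measure"
  assumes P: "prob_space P" and \<Theta>: "\<And>\<omega>. \<omega> \<in> space P \<Longrightarrow> \<Theta> \<omega> \<in> {0, 1} \<and> \<Theta>' \<omega> \<in> {0, 1}"
    and C: "C \<ge> 0" "\<And>\<theta> \<theta>' t x y. \<theta> \<in> {0, 1} \<Longrightarrow> \<theta>' \<in> {0, 1} \<Longrightarrow> t \<in> {0..T} \<Longrightarrow>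
      norm (interaction_kernel H G \<theta> \<theta>' (u t) (u' t) x y) \<le> C"
    and \<alpha>: "\<alpha> > 0" and sol: "boltzmann_weak_solution P \<Theta> \<Theta>' H G \<alpha> (1 / \<alpha>) u u' T \<mu>0 \<mu>"
    and \<phi>: "\<phi> \<in> elementary" "\<And>x. 0 \<le> \<phi> x" "\<And>x. \<phi> x \<le> norm x"
    and g0: "\<And>x. 0 \<le> g x"
    and g: "\<And>t. t \<in> {0..T} \<Longrightarrow> integrable (\<mu> t) g" "\<And>t. t \<in> {0..T} \<Longrightarrow> (\<integral>x. g x \<partial>\<mu> t) \<le> b"
    and incr: "\<And>x h. norm h \<le> \<alpha> * C \<Longrightarrow> \<bar>\<phi> (x + h) - \<phi> x\<bar> \<le> norm h * g x"
    and t: "t \<in> {0..T}"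
  shows "(\<integral>x. \<phi> x \<partial>\<mu> t) \<le> (\<integral>x. \<phi> x \<partial>\<mu>0) + C * b * t"
proof -
  have P1: "\<mu> t \<in> P1" if "t \<in> {0..T}" for t
    using sol that by (auto simp: boltzmann_weak_solution_def L2_P1_def)
  have \<mu>0: "\<mu> 0 = \<mu>0" using sol by (simp add: boltzmann_weak_solution_def)
  have T0: "0 \<in> {0..T}" using t by simp
  define m where "m s = (\<integral>x. norm x \<partial>\<mu> s)" for s
  have m2: "integrable (lebesgue_on {0..T}) (\<lambda>s. (m s)\<^sup>2)"
    using sol by (simp add: boltzmann_weak_solution_def L2_P1_def m_def)
  have m_nonneg: "0 \<le> m s" for s unfolding m_def by (intro integral_nonneg_AE AE_I2) simp
  have "integrable (lebesgue_on {0..T}) m"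
  proof (rule Bochner_Integration.integrable_bound)
    show "integrable (lebesgue_on {0..T}) (\<lambda>s. 1 + (m s)\<^sup>2)" using m2 by auto
    have "(\<lambda>s. sqrt ((m s)\<^sup>2)) \<in> borel_measurable (lebesgue_on {0..T})"
      by (rule measurable_compose[OF borel_measurable_integrable[OF m2] borel_measurable_sqrt])
    then show "m \<in> borel_measurable (lebesgue_on {0..T})" using m_nonneg by simp
    have "m s \<le> 1 + (m s)\<^sup>2" for s
      using sum_squares_bound[of "m s" 1] m_nonneg[of s] by simp
    then show "AE s in lebesgue_on {0..T}. norm (m s) \<le> norm (1 + (m s)\<^sup>2)"
      using m_nonneg by (intro AE_I2) simp
  qed
  then have "m integrable_on {0..T}" by (rule integrable_on_lebesgue_on) simp
  then have m_int: "m integrable_on {0..t}"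
    by (rule integrable_subinterval_real) (use t in auto)
  define \<zeta> where "\<zeta> n x = exp 1 * exp_flat 0 (1 - (1 / (real (Suc n))\<^sup>2) * (x \<bullet> x))" for n and x :: "real ^ 'd"
  have \<zeta>01: "0 \<le> \<zeta> n x" "\<zeta> n x \<le> 1" for n x
    unfolding \<zeta>_def
    by (auto simp: exp_flat_def mult_exp_exp intro!: divide_nonneg_nonneg)
  define \<psi> where "\<psi> n x = \<zeta> n x * \<phi> x" for n x
  have \<psi>_test: "\<psi> n \<in> test_functions" for n
    using test_function_bump_times[of "\<lambda>x. exp 1 * \<phi> x" "1 / (real (Suc n))\<^sup>2" 0] \<phi>(1)
    by (simp add: \<psi>_def[abs_def] \<zeta>_def mult_ac elementary.intros)
  have \<psi>01: "0 \<le> \<psi> n x" "\<psi> n x \<le> \<phi> x" for n x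
    using \<zeta>01[of n x] \<phi>(2)[of x] by (auto simp: \<psi>_def mult_le_cancel_right1 mult_left_le_one_le)
  have \<phi>_cont: "continuous_on UNIV \<phi>"
    using elementary_differentiable[OF \<phi>(1)] differentiable_imp_continuous_on by blast
  have \<phi>_int: "integrable (\<mu> s) \<phi>" if "s \<in> {0..T}" for s
    by (rule P1_integrable[OF P1[OF that] \<phi>_cont, of 1]) (use \<phi> in \<open>auto intro: add_increasing\<close>)
  have \<psi>_int: "integrable (\<mu> s) (\<psi> n)" if "s \<in> {0..T}" for s n
    by (rule P1_integrable[OF P1[OF that] test_function_continuous[OF \<psi>_test], of _ 1])
      (use \<phi>(3) \<psi>01[of n] order_trans in \<open>fastforce intro: add_increasing\<close>)
  \<comment> \<open>\<open>bump_increment\<close> asks that no jump exceed the scale \<open>Suc n\<close> of the bump\<close>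
  have approx: "(\<integral>x. \<psi> n x \<partial>\<mu> t) \<le> (\<integral>x. \<phi> x \<partial>\<mu>0) + (C * b * t + 30 * C / real (Suc n) * integral {0..t} m)"
    if n: "\<alpha> * C \<le> real (Suc n)" for n
  proof -
    define N where "N = real (Suc n)"
    have N: "N > 0" by (simp add: N_def)
    let ?f = "\<lambda>t. 1 / \<alpha> * (\<integral>\<omega>. (\<integral>y. (\<integral>x.
      (\<psi> n (post_interaction H G \<alpha> (\<Theta> \<omega>) (\<Theta>' \<omega>) (u t) (u' t) x y) - \<psi> n x) \<partial>\<mu> t) \<partial>\<mu> t) \<partial>P)"
    have incr\<psi>: "\<bar>\<psi> n (x + h) - \<psi> n x\<bar> \<le> \<alpha> * (C * (g x + 30 * norm x / N))"
      if h: "norm h \<le> \<alpha> * C" for x h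
    proof -
      have "\<bar>\<zeta> n (x + h) - \<zeta> n x\<bar> \<le> exp 1 * (10 * norm h / N)"
        unfolding \<zeta>_def right_diff_distrib[symmetric] abs_mult abs_exp_cancel N_def
        by (intro mult_left_mono bump_increment) (use h n in auto)
      also have "\<dots> \<le> 3 * (10 * norm h / N)"
        using exp_le N by (intro mult_right_mono) auto
      finally have \<zeta>: "\<bar>\<zeta> n (x + h) - \<zeta> n x\<bar> \<le> 30 * norm h / N" by simp
      have "\<psi> n (x + h) - \<psi> n x = \<zeta> n (x + h) * (\<phi> (x + h) - \<phi> x) + (\<zeta> n (x + h) - \<zeta> n x) * \<phi> x"
        by (simp add: \<psi>_def algebra_simps)
      then have "\<bar>\<psi> n (x + h) - \<psi> n x\<bar> \<le> \<zeta> n (x + h) * \<bar>\<phi> (x + h) - \<phi> x\<bar> + \<bar>\<zeta> n (x + h) - \<zeta> n x\<bar> * \<phi> x"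
        using \<zeta>01[of n "x + h"] \<phi>(2)[of x] by (metis abs_mult abs_of_nonneg abs_triangle_ineq)
      also have "\<dots> \<le> 1 * (norm h * g x) + (30 * norm h / N) * norm x"
        using \<zeta>01 \<phi>(2,3) incr[OF h] \<zeta> N by (intro add_mono mult_mono) auto
      also have "\<dots> = norm h * (g x + 30 * norm x / N)" by (simp add: algebra_simps)
      also have "\<dots> \<le> (\<alpha> * C) * (g x + 30 * norm x / N)"
        using h N g0[of x] by (intro mult_right_mono) auto
      finally show ?thesis by (simp add: mult_ac)
    qed
    have bound: "?f s \<le> C * b + 30 * C / N * m s" if s: "s \<in> {0..T}" for s
    proof -
      have gi: "integrable (\<mu> s) (\<lambda>x. C * (g x + 30 * norm x / N))"
        using g(1)[OF s] P1_simps(4)[OF P1[OF s]] by simp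
      have "\<bar>?f s\<bar> \<le> (\<integral>x. C * (g x + 30 * norm x / N) \<partial>\<mu> s)"
        by (rule collision_integral_bound[OF P \<Theta> C(2) \<alpha> P1_simps(1)[OF P1[OF s]] gi])
          (use s incr\<psi> in auto)
      also have "\<dots> = C * (\<integral>x. g x \<partial>\<mu> s) + 30 * C / N * m s"
        using g(1)[OF s] P1_simps(4)[OF P1[OF s]] by (simp add: m_def algebra_simps)
      also have "\<dots> \<le> C * b + 30 * C / N * m s" using g(2)[OF s] C(1) by (simp add: mult_left_mono)
      finally show ?thesis by (rule abs_le_D1)
    qed
    have "has_time_derivative T (\<lambda>t. \<integral>x. \<psi> n x \<partial>\<mu> t) ?f"
      using sol \<psi>_test by (simp add: boltzmann_weak_solution_def)
    then have I: "(?f has_integral ((\<integral>x. \<psi> n x \<partial>\<mu> t) - (\<integral>x. \<psi> n x \<partial>\<mu>0))) {0..t}"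
      using t by (simp add: has_time_derivative_def \<mu>0)
    have J: "((\<lambda>s. C * b + 30 * C / N * m s) has_integral (C * b * t + 30 * C / N * integral {0..t} m)) {0..t}"
      using has_integral_add[OF has_integral_const_real[of "C * b" 0 t]
          has_integral_mult_right[OF integrable_integral[OF m_int], of "30 * C / N"]] t
      by (simp add: mult_ac)
    have "(\<integral>x. \<psi> n x \<partial>\<mu> t) - (\<integral>x. \<psi> n x \<partial>\<mu>0) \<le> C * b * t + 30 * C / N * integral {0..t} m"
      by (rule has_integral_le[OF I J]) (use bound t in auto)
    moreover have "(\<integral>x. \<psi> n x \<partial>\<mu>0) \<le> (\<integral>x. \<phi> x \<partial>\<mu>0)"
      using integral_mono[OF \<psi>_int[OF T0] \<phi>_int[OF T0] \<psi>01(2)] by (simp add: \<mu>0)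
    ultimately show ?thesis by (simp add: N_def)
  qed
  have lhs: "(\<lambda>n. \<integral>x. \<psi> n x \<partial>\<mu> t) \<longlonglongrightarrow> (\<integral>x. \<phi> x \<partial>\<mu> t)"
  proof (rule integral_dominated_convergence[where w = \<phi>])
    show "AE x in \<mu> t. (\<lambda>n. \<psi> n x) \<longlonglongrightarrow> \<phi> x"
    proof (rule AE_I2)
      fix x
      show "(\<lambda>n. \<psi> n x) \<longlonglongrightarrow> \<phi> x"
        using tendsto_mult[OF bump_tendsto_1[of x] tendsto_const[of "\<phi> x"]]
        by (simp add: \<psi>_def \<zeta>_def)
    qed
    show "AE x in \<mu> t. norm (\<psi> n x) \<le> \<phi> x" for n using \<psi>01 by (intro AE_I2) simp
    show "\<phi> \<in> borel_measurable (\<mu> t)" "integrable (\<mu> t) \<phi>" using \<phi>_int[OF t] by auto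
    show "\<psi> n \<in> borel_measurable (\<mu> t)" for n using \<psi>_int[OF t] by auto
  qed
  have "(\<lambda>n. 30 * C * integral {0..t} m * (1 / real (Suc n))) \<longlonglongrightarrow> 30 * C * integral {0..t} m * 0"
    by (intro tendsto_mult tendsto_const LIMSEQ_Suc[OF lim_1_over_n])
  then have "(\<lambda>n. (\<integral>x. \<phi> x \<partial>\<mu>0) + (C * b * t + 30 * C / real (Suc n) * integral {0..t} m))
      \<longlonglongrightarrow> (\<integral>x. \<phi> x \<partial>\<mu>0) + (C * b * t + 0)"
    by (intro tendsto_intros) (simp add: mult_ac)
  moreover have "\<exists>K. \<forall>n\<ge>K. (\<integral>x. \<psi> n x \<partial>\<mu> t) \<le>
      (\<integral>x. \<phi> x \<partial>\<mu>0) + (C * b * t + 30 * C / real (Suc n) * integral {0..t} m)"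
  proof -
    obtain K :: nat where "\<alpha> * C \<le> real K" using real_arch_simple by blast
    then show ?thesis using approx by (intro exI[of _ K]) force
  qed
  ultimately show ?thesis using LIMSEQ_le[OF lhs] by simp
qed

lemma soft_norm_vanishes:
  assumes "\<mu> \<in> P1"
  shows "(\<lambda>n. \<integral>x. soft_norm (real (Suc n)) x \<partial>\<mu>) \<longlonglongrightarrow> 0"
proof -
  have cont: "continuous_on UNIV (soft_norm R :: 'a::euclidean_space \<Rightarrow> real)" for R
    unfolding soft_norm_def by (intro continuous_intros)
  have "(\<lambda>n. \<integral>x. soft_norm (real (Suc n)) x \<partial>\<mu>) \<longlonglongrightarrow> (\<integral>x. 0 \<partial>\<mu>)"
  proof (rule integral_dominated_convergence[where w = norm])
    show "AE x in \<mu>. (\<lambda>n. soft_norm (real (Suc n)) x) \<longlonglongrightarrow> 0"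
    proof (rule AE_I2, rule tendsto_sandwich)
      fix x :: 'a
      show "\<forall>\<^sub>F n in sequentially. 0 \<le> soft_norm (real (Suc n)) x"
        by (intro always_eventually allI soft_norm_bounds) simp
      show "\<forall>\<^sub>F n in sequentially. soft_norm (real (Suc n)) x \<le> (norm x)\<^sup>2 / 2 * (1 / real (Suc n))"
      proof (intro always_eventually allI)
        fix n
        have "soft_norm (real (Suc n)) (0::'a) = 0" by (simp add: soft_norm_def)
        then have "soft_norm (real (Suc n)) x \<le> norm x * (norm x / (2 * real (Suc n)))"
          using soft_norm_increment[of "real (Suc n)" x "norm x" 0] by (simp del: of_nat_Suc)
        then show "soft_norm (real (Suc n)) x \<le> (norm x)\<^sup>2 / 2 * (1 / real (Suc n))"
          by (simp add: power2_eq_square)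
      qed
      show "(\<lambda>n. (norm x)\<^sup>2 / 2 * (1 / real (Suc n))) \<longlonglongrightarrow> 0"
        using tendsto_mult[OF tendsto_const[of "(norm x)\<^sup>2 / 2"] LIMSEQ_Suc[OF lim_1_over_n]] by simp
    qed simp
    show "AE x in \<mu>. norm (soft_norm (real (Suc n)) x) \<le> norm x" for n
      using soft_norm_bounds(1,2)[of "real (Suc n)" "_ :: 'a"] by (intro AE_I2) (simp del: of_nat_Suc)
    show "integrable \<mu> norm" by (rule P1_simps(4)[OF assms])
    show "(\<lambda>x. 0) \<in> borel_measurable \<mu>" by simp
    show "soft_norm (real (Suc n)) \<in> borel_measurable \<mu>" for n
      by (intro P1_measurable[OF assms] borel_measurable_continuous_onI cont)
  qed
  then show ?thesis by simp
qed

text \<open>The moment estimate is used twice.  For \<open>R = 1\<close> the increments of \<open>soft_norm\<close> are at most \<open>norm h\<close>, which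
bounds the first moments.  For large \<open>R\<close> they are at most \<open>norm h * (2 * norm x + D) / (2 * R)\<close>, so, by the
bound on the first moments, the integral of \<open>soft_norm R\<close> grows by \<open>O (1 / R)\<close> on \<open>[0, T]\<close>, uniformly in
\<open>\<epsilon> \<le> E\<close>; initially it tends to \<open>0\<close> for \<open>R \<rightarrow> \<infinity>\<close>.\<close>

lemma boltzmann_uniform_tails:
  fixes \<mu>\<epsilon> :: "real \<Rightarrow> real \<Rightarrow> (real ^ 'd::finite) measure"
  assumes P: "prob_space P" and \<Theta>: "\<And>\<omega>. \<omega> \<in> space P \<Longrightarrow> \<Theta> \<omega> \<in> {0, 1} \<and> \<Theta>' \<omega> \<in> {0, 1}"
    and C: "C \<ge> 0" "\<And>\<theta> \<theta>' \<epsilon> t x y. \<theta> \<in> {0, 1} \<Longrightarrow> \<theta>' \<in> {0, 1} \<Longrightarrow> \<epsilon> > 0 \<Longrightarrow> t \<in> {0..T} \<Longrightarrow>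
      norm (interaction_kernel H G \<theta> \<theta>' (u \<epsilon> t) (u' \<epsilon> t) x y) \<le> C"
    and sol: "\<And>\<epsilon>. \<epsilon> > 0 \<Longrightarrow> boltzmann_weak_solution P \<Theta> \<Theta>' H G \<epsilon> (1 / \<epsilon>) (u \<epsilon>) (u' \<epsilon>) T \<mu>0 (\<mu>\<epsilon> \<epsilon>)"
    and \<mu>0: "\<mu>0 \<in> P1"
  shows "uniform_tails (\<Union>\<epsilon>\<in>{0<..E}. \<mu>\<epsilon> \<epsilon> ` {0..T})"
proof -
  have P1: "\<mu>\<epsilon> \<epsilon> t \<in> P1" if "\<epsilon> > 0" "t \<in> {0..T}" for \<epsilon> t
    using sol[OF that(1)] that(2) by (auto simp: boltzmann_weak_solution_def L2_P1_def)
  define M where "M = 1 + ((\<integral>x. soft_norm 1 x \<partial>\<mu>0) + C * T)"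
  have moment: "(\<integral>x. norm x \<partial>\<mu>\<epsilon> \<epsilon> t) \<le> M" if \<epsilon>: "\<epsilon> > 0" and t: "t \<in> {0..T}" for \<epsilon> t
  proof -
    interpret prob_space "\<mu>\<epsilon> \<epsilon> t" using P1_simps(1)[OF P1[OF \<epsilon> t]] .
    have int: "integrable (\<mu>\<epsilon> \<epsilon> t) (soft_norm 1)"
      by (rule P1_integrable_soft_norm[OF P1[OF \<epsilon> t]]) simp
    have "(\<integral>x. soft_norm 1 x \<partial>\<mu>\<epsilon> \<epsilon> t) \<le> (\<integral>x. soft_norm 1 x \<partial>\<mu>0) + C * 1 * t"
    proof (rule boltzmann_moment_estimate[OF P \<Theta> C(1) C(2) \<epsilon> sol[OF \<epsilon>] soft_norm_elementary, where g = "\<lambda>_. 1"])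
      show "integrable (\<mu>\<epsilon> \<epsilon> s) (\<lambda>_. 1 :: real)" "(\<integral>x. 1 \<partial>\<mu>\<epsilon> \<epsilon> s) \<le> (1 :: real)" if "s \<in> {0..T}" for s
        using prob_space.prob_space[OF P1_simps(1)[OF P1[OF \<epsilon> that]]]
          prob_space.finite_measure[OF P1_simps(1)[OF P1[OF \<epsilon> that]]]
        by (simp_all add: finite_measure.integrable_const)
    qed (use \<epsilon> t soft_norm_bounds[of 1] soft_norm_lipschitz[of 1] in auto)
    also have "\<dots> \<le> (\<integral>x. soft_norm 1 x \<partial>\<mu>0) + C * T" using t C(1) by (simp add: mult_left_mono)
    finally have *: "(\<integral>x. soft_norm 1 x \<partial>\<mu>\<epsilon> \<epsilon> t) \<le> (\<integral>x. soft_norm 1 x \<partial>\<mu>0) + C * T" .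
    have "norm x \<le> 1 + soft_norm 1 x" for x :: "real ^ 'd"
      using soft_norm_bounds(3)[of 1 x] by (simp add: excess_def)
    then have "(\<integral>x. norm x \<partial>\<mu>\<epsilon> \<epsilon> t) \<le> (\<integral>x. 1 + soft_norm 1 x \<partial>\<mu>\<epsilon> \<epsilon> t)"
      using int P1_simps(4)[OF P1[OF \<epsilon> t]] by (intro integral_mono) auto
    also have "\<dots> = 1 + (\<integral>x. soft_norm 1 x \<partial>\<mu>\<epsilon> \<epsilon> t)" using int by (simp add: prob_space)
    finally show ?thesis using * by (simp add: M_def)
  qed
  define D where "D = max 0 E * C"
  define B where "B n = (\<integral>x. soft_norm (real (Suc n)) x \<partial>\<mu>0) + C * ((2 * M + D) / 2 * (1 / real (Suc n))) * T" for n
  have tail: "(\<integral>x. excess (real (Suc n)) x \<partial>\<mu>\<epsilon> \<epsilon> t) \<le> B n" if \<epsilon>: "\<epsilon> \<in> {0<..E}" and t: "t \<in> {0..T}" for \<epsilon> t n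
  proof -
    have \<epsilon>0: "\<epsilon> > 0" using \<epsilon> by simp
    let ?R = "real (Suc n)"
    let ?b = "(2 * M + D) / 2 * (1 / ?R)"
    have M0: "0 \<le> M" using moment[OF \<epsilon>0 t] order_trans[OF integral_nonneg_AE[OF AE_I2]] by (metis norm_ge_zero)
    have D0: "0 \<le> D" using C(1) by (simp add: D_def)
    have int: "integrable (\<mu>\<epsilon> \<epsilon> t) (soft_norm ?R)"
      by (rule P1_integrable_soft_norm[OF P1[OF \<epsilon>0 t]]) simp
    have "(\<integral>x. excess ?R x \<partial>\<mu>\<epsilon> \<epsilon> t) \<le> (\<integral>x. soft_norm ?R x \<partial>\<mu>\<epsilon> \<epsilon> t)"
      by (rule integral_mono[OF P1_integrable_excess[OF P1[OF \<epsilon>0 t]] int]) (simp add: soft_norm_bounds)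
    also have "\<dots> \<le> (\<integral>x. soft_norm ?R x \<partial>\<mu>0) + C * ?b * t"
    proof (rule boltzmann_moment_estimate[OF P \<Theta> C(1) C(2) \<epsilon>0 sol[OF \<epsilon>0] soft_norm_elementary,
          where g = "\<lambda>x. (2 * norm x + D) / (2 * ?R)"])
      fix s assume s: "s \<in> {0..T}"
      show "integrable (\<mu>\<epsilon> \<epsilon> s) (\<lambda>x. (2 * norm x + D) / (2 * ?R))"
        using prob_space.finite_measure[OF P1_simps(1)[OF P1[OF \<epsilon>0 s]]]
        by (intro integrable_divide Bochner_Integration.integrable_add finite_measure.integrable_const)
          (use P1_simps(4)[OF P1[OF \<epsilon>0 s]] in auto)
      have "(\<integral>x. (2 * norm x + D) / (2 * ?R) \<partial>\<mu>\<epsilon> \<epsilon> s) = (2 * (\<integral>x. norm x \<partial>\<mu>\<epsilon> \<epsilon> s) + D) / (2 * ?R)"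
        using P1_simps(4)[OF P1[OF \<epsilon>0 s]] prob_space.prob_space[OF P1_simps(1)[OF P1[OF \<epsilon>0 s]]]
          prob_space.finite_measure[OF P1_simps(1)[OF P1[OF \<epsilon>0 s]]]
        by (simp add: finite_measure.integrable_const)
      also have "\<dots> \<le> (2 * M + D) / (2 * ?R)"
        using moment[OF \<epsilon>0 s] by (intro divide_right_mono) auto
      finally show "(\<integral>x. (2 * norm x + D) / (2 * ?R) \<partial>\<mu>\<epsilon> \<epsilon> s) \<le> ?b" by simp
    next
      fix x h :: "real ^ 'd" assume "norm h \<le> \<epsilon> * C"
      then have "norm h \<le> D"
        using \<epsilon> C(1) mult_right_mono[of \<epsilon> "max 0 E" C] by (simp add: D_def)
      then show "\<bar>soft_norm ?R (x + h) - soft_norm ?R x\<bar> \<le> norm h * ((2 * norm x + D) / (2 * ?R))"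
        by (intro soft_norm_increment) auto
    qed (use \<epsilon>0 t soft_norm_bounds[of ?R] D0 in auto)
    also have "\<dots> \<le> B n"
      unfolding B_def using t C(1) M0 D0 by (intro add_left_mono mult_left_mono) auto
    finally show ?thesis .
  qed
  have "(\<lambda>n. C * ((2 * M + D) / 2 * (1 / real (Suc n))) * T) \<longlonglongrightarrow> C * ((2 * M + D) / 2 * 0) * T"
    by (intro tendsto_mult tendsto_const LIMSEQ_Suc[OF lim_1_over_n])
  from tendsto_add[OF soft_norm_vanishes[OF \<mu>0] this]
  have B_lim: "B \<longlonglongrightarrow> 0" by (simp add: B_def[abs_def])
  show ?thesis
    unfolding uniform_tails_def
  proof (intro allI impI)
    fix \<delta> :: real assume "\<delta> > 0"
    then obtain n where "B n < \<delta>"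
      using B_lim by (metis order_tendstoD(2) eventually_sequentially order_refl)
    then show "\<exists>R\<ge>1. \<forall>\<mu>\<in>(\<Union>\<epsilon>\<in>{0<..E}. \<mu>\<epsilon> \<epsilon> ` {0..T}). (\<integral>x. excess R x \<partial>\<mu>) \<le> \<delta>"
      using tail[of _ _ n] by (intro exI[of _ "real (Suc n)"]) force
  qed
qed

section \<open>Convergence of product measures\<close>

lemma P1_pair:
  fixes F :: "'a::euclidean_space \<times> 'a \<Rightarrow> 'b::{banach, second_countable_topology}"
  assumes \<kappa>: "\<kappa> \<in> P1" and F: "continuous_on UNIV F" "\<And>z. norm (F z) \<le> B"
  shows "integrable (\<kappa> \<Otimes>\<^sub>M \<kappa>) F"
    and "(\<integral>y. (\<integral>x. F (x, y) \<partial>\<kappa>) \<partial>\<kappa>) = (\<integral>z. F z \<partial>(\<kappa> \<Otimes>\<^sub>M \<kappa>))"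
    and "(\<integral>x. (\<integral>y. F (x, y) \<partial>\<kappa>) \<partial>\<kappa>) = (\<integral>z. F z \<partial>(\<kappa> \<Otimes>\<^sub>M \<kappa>))"
proof -
  interpret prob_space \<kappa> using P1_simps(1)[OF \<kappa>] .
  interpret pair_prob_space \<kappa> \<kappa> ..
  have "sets (\<kappa> \<Otimes>\<^sub>M \<kappa>) = sets (borel :: ('a \<times> 'a) measure)"
    using sets_pair_measure_cong[OF P1_simps(2)[OF \<kappa>] P1_simps(2)[OF \<kappa>]] by (simp only: borel_prod)
  then have meas: "F \<in> borel_measurable (\<kappa> \<Otimes>\<^sub>M \<kappa>)"
    using borel_measurable_continuous_onI[OF F(1)] by (simp cong: measurable_cong_sets)
  show int: "integrable (\<kappa> \<Otimes>\<^sub>M \<kappa>) F"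
    by (rule P.integrable_const_bound[of _ B]) (use F(2) meas in auto)
  show "(\<integral>y. (\<integral>x. F (x, y) \<partial>\<kappa>) \<partial>\<kappa>) = (\<integral>z. F z \<partial>(\<kappa> \<Otimes>\<^sub>M \<kappa>))"
    using integral_snd[of "\<lambda>x y. F (x, y)"] int by simp
  show "(\<integral>x. (\<integral>y. F (x, y) \<partial>\<kappa>) \<partial>\<kappa>) = (\<integral>z. F z \<partial>(\<kappa> \<Otimes>\<^sub>M \<kappa>))"
    by (rule integral_fst'[OF int])
qed

lemma P1_pair_prob: "\<kappa> \<in> P1 \<Longrightarrow> prob_space (\<kappa> \<Otimes>\<^sub>M \<kappa>)"
  using P1_simps(1) by (intro prob_space_pair)

text \<open>Integrals of these functions against a product measure reduce to integrals against its factors.\<close>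

inductive_set tensor_functions :: "('a::topological_space \<times> 'b::topological_space \<Rightarrow> real) set" where
  prod: "continuous_on UNIV a \<Longrightarrow> continuous_on UNIV b \<Longrightarrow> (\<lambda>z. a (fst z) * b (snd z)) \<in> tensor_functions"
| add: "f \<in> tensor_functions \<Longrightarrow> g \<in> tensor_functions \<Longrightarrow> (\<lambda>z. f z + g z) \<in> tensor_functions"

lemma tensor_functions_mult:
  assumes "f \<in> tensor_functions" "g \<in> tensor_functions"
  shows "(\<lambda>z. f z * g z) \<in> tensor_functions"
  using assms(1)
proof induction
  case (prod a b)
  show ?case
    using assms(2)
  proof induction
    case (prod a' b')
    have "(\<lambda>z. (a (fst z) * a' (fst z)) * (b (snd z) * b' (snd z))) \<in> tensor_functions"
      by (intro tensor_functions.prod continuous_on_mult prod \<open>continuous_on UNIV a\<close> \<open>continuous_on UNIV b\<close>)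
    then show ?case by (simp add: mult_ac)
  next
    case (add f g)
    then show ?case using tensor_functions.add[OF add.IH] by (simp add: distrib_left)
  qed
next
  case (add f1 f2)
  then show ?case using tensor_functions.add[OF add.IH] by (simp add: distrib_right)
qed

lemma polynomial_tensor:
  fixes q :: "'a::euclidean_space \<times> 'b::euclidean_space \<Rightarrow> real"
  assumes "real_polynomial_function q"
  shows "q \<in> tensor_functions"
  using assms
proof induction
  case (linear f)
  then interpret bounded_linear f .
  have 1: "continuous_on UNIV (\<lambda>x. f (x, 0))" and 2: "continuous_on UNIV (\<lambda>y. f (0, y))"
    by (intro continuous_on continuous_intros)+
  have "(\<lambda>z. f (fst z, 0) * 1 + 1 * f (0, snd z)) \<in> tensor_functions"
    using tensor_functions.add[OF tensor_functions.prod[OF 1 continuous_on_const[of _ 1]]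
        tensor_functions.prod[OF continuous_on_const[of _ 1] 2]] .
  moreover have "f (fst z, 0) * 1 + 1 * f (0, snd z) = f z" for z
    using add[of "(fst z, 0)" "(0, snd z)"] by simp
  ultimately show ?case by simp
next
  case (const c)
  show ?case
    using tensor_functions.prod[OF continuous_on_const[of _ c] continuous_on_const[of _ 1]] by simp
qed (auto intro: tensor_functions.add tensor_functions_mult)

lemma P1_tendsto_compact_support_pair:
  fixes F :: "'a::euclidean_space \<times> 'a \<Rightarrow> real" and \<zeta> :: "'a \<Rightarrow> real"
  assumes \<kappa>: "\<And>n. \<kappa> n \<in> P1" "\<nu> \<in> P1" and conv: "P1_tendsto \<kappa> \<nu>"
    and F: "F \<in> tensor_functions"
    and \<zeta>: "continuous_on UNIV \<zeta>" "\<And>x. R \<le> norm x \<Longrightarrow> \<zeta> x = 0"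
  shows "(\<lambda>n. \<integral>z. \<zeta> (fst z) * \<zeta> (snd z) * F z \<partial>(\<kappa> n \<Otimes>\<^sub>M \<kappa> n)) \<longlonglongrightarrow>
      (\<integral>z. \<zeta> (fst z) * \<zeta> (snd z) * F z \<partial>(\<nu> \<Otimes>\<^sub>M \<nu>))
    \<and> (\<forall>\<mu>\<in>P1. integrable (\<mu> \<Otimes>\<^sub>M \<mu>) (\<lambda>z. \<zeta> (fst z) * \<zeta> (snd z) * F z))"
  using F
proof induction
  case (prod a b)
  have bdd: "continuous_on UNIV (\<lambda>x. \<zeta> x * c x) \<and> (\<exists>B. \<forall>x. \<bar>\<zeta> x * c x\<bar> \<le> B)"
    if c: "continuous_on UNIV c" for c :: "'a \<Rightarrow> real"
  proof
    show cont: "continuous_on UNIV (\<lambda>x. \<zeta> x * c x)" by (intro continuous_intros \<zeta> c)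
    have "bounded ((\<lambda>x. \<zeta> x * c x) ` cball 0 R)"
      by (intro compact_imp_bounded compact_continuous_image continuous_on_subset[OF cont]) auto
    then obtain B where "\<forall>y\<in>(\<lambda>x. \<zeta> x * c x) ` cball 0 R. norm y \<le> B"
      unfolding bounded_iff by blast
    then have B: "norm x \<le> R \<Longrightarrow> \<bar>\<zeta> x * c x\<bar> \<le> B" for x by simp
    have "\<bar>\<zeta> x * c x\<bar> \<le> max B 0" for x
      using B[of x] \<zeta>(2)[of x] by (cases "norm x \<le> R") auto
    then show "\<exists>B. \<forall>x. \<bar>\<zeta> x * c x\<bar> \<le> B" by blast
  qed
  obtain A where A: "continuous_on UNIV (\<lambda>x. \<zeta> x * a x)" "\<And>x. \<bar>\<zeta> x * a x\<bar> \<le> A"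
    using bdd[OF prod(1)] by blast
  obtain B where B: "continuous_on UNIV (\<lambda>x. \<zeta> x * b x)" "\<And>x. \<bar>\<zeta> x * b x\<bar> \<le> B"
    using bdd[OF prod(2)] by blast
  let ?F = "\<lambda>z. (\<zeta> (fst z) * a (fst z)) * (\<zeta> (snd z) * b (snd z))"
  have F: "continuous_on UNIV ?F" "norm (?F z) \<le> A * B" for z
  proof -
    show "continuous_on UNIV ?F"
      by (intro continuous_on_mult continuous_on_compose2[OF A(1)] continuous_on_compose2[OF B(1)]
          continuous_on_fst continuous_on_snd continuous_on_id) auto
    show "norm (?F z) \<le> A * B"
      unfolding real_norm_def abs_mult[of "\<zeta> (fst z) * a (fst z)"]
      using order_trans[OF abs_ge_zero A(2)] by (intro mult_mono A B) auto
  qed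
  have eq: "(\<lambda>z. \<zeta> (fst z) * \<zeta> (snd z) * (a (fst z) * b (snd z))) = ?F"
    by (auto simp: mult_ac)
  have split: "(\<integral>z. ?F z \<partial>(\<mu> \<Otimes>\<^sub>M \<mu>)) = (\<integral>x. \<zeta> x * a x \<partial>\<mu>) * (\<integral>x. \<zeta> x * b x \<partial>\<mu>)" if "\<mu> \<in> P1" for \<mu>
    using P1_pair(2)[OF that F] by simp
  show ?case
    unfolding eq split[OF \<kappa>(1)] split[OF \<kappa>(2)]
    using P1_tendsto_bounded[OF conv A] P1_tendsto_bounded[OF conv B] P1_pair(1)[OF _ F]
    by (auto intro!: tendsto_mult)
next
  case (add f g)
  show ?case
    using add.IH \<kappa> by (auto simp: distrib_left intro!: tendsto_add)
qed

text \<open>The equation is quadratic in the measure, so products of the measures have to converge as well.  On the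
product of two balls \<open>F\<close> is uniformly close to a polynomial, a sum of products of functions of one
variable.  The mass outside a large ball is small for \<open>\<nu>\<close>, and therefore eventually for \<open>\<kappa> n\<close>.\<close>

theorem P1_tendsto_pair:
  fixes F :: "'a::euclidean_space \<times> 'a \<Rightarrow> real"
  assumes \<kappa>: "\<And>n. \<kappa> n \<in> P1" "\<nu> \<in> P1" and conv: "P1_tendsto \<kappa> \<nu>"
    and F: "continuous_on UNIV F" "\<And>z. \<bar>F z\<bar> \<le> B"
  shows "(\<lambda>n. \<integral>z. F z \<partial>(\<kappa> n \<Otimes>\<^sub>M \<kappa> n)) \<longlonglongrightarrow> (\<integral>z. F z \<partial>(\<nu> \<Otimes>\<^sub>M \<nu>))"
proof (rule LIMSEQ_I)
  fix \<delta> :: real assume \<delta>: "\<delta> > 0"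
  have B0: "0 \<le> B" using F(2)[of 0] by linarith
  \<comment> \<open>the error of replacing \<open>F\<close> by \<open>?Q\<close> below is at most \<open>2 * B * \<gamma> + \<gamma>\<close>\<close>
  define \<gamma> where "\<gamma> = \<delta> / (8 * (B + 1))"
  have \<gamma>: "\<gamma> > 0" using \<delta> B0 by (simp add: \<gamma>_def)
  define \<zeta> where "\<zeta> k x = max 0 (min 1 (real k + 1 - norm x))" for k :: nat and x :: 'a
  have \<zeta>: "0 \<le> \<zeta> k x" "\<zeta> k x \<le> 1" "continuous_on UNIV (\<zeta> k)" for k x
    unfolding \<zeta>_def by (auto intro!: continuous_intros)
  have \<zeta>0: "\<zeta> k x = 0" if "real k + 1 \<le> norm x" for k and x :: 'a using that by (simp add: \<zeta>_def)
  have "(\<lambda>k. \<integral>x. 1 - \<zeta> k x \<partial>\<nu>) \<longlonglongrightarrow> (\<integral>x. 0 \<partial>\<nu>)"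
  proof -
    interpret prob_space \<nu> using P1_simps(1)[OF \<kappa>(2)] .
    show ?thesis
    proof (rule integral_dominated_convergence[where w = "\<lambda>_. 1"])
      show "AE x in \<nu>. (\<lambda>k. 1 - \<zeta> k x) \<longlonglongrightarrow> 0"
      proof (rule AE_I2)
        fix x :: 'a
        obtain k0 :: nat where k0: "norm x \<le> real k0" using real_arch_simple by blast
        have "1 - \<zeta> k x = 0" if "k \<ge> k0" for k
        proof -
          have "norm x \<le> real k" using k0 that by linarith
          then show ?thesis by (simp add: \<zeta>_def)
        qed
        then show "(\<lambda>k. 1 - \<zeta> k x) \<longlonglongrightarrow> 0"
          by (intro tendsto_eventually) (auto simp: eventually_sequentially)
      qed
      show "(\<lambda>x. 1 - \<zeta> k x) \<in> borel_measurable \<nu>" for k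
        by (intro P1_measurable[OF \<kappa>(2)] borel_measurable_continuous_onI continuous_intros \<zeta>)
    qed (use \<zeta> in auto)
  qed
  then have "(\<lambda>k. \<integral>x. 1 - \<zeta> k x \<partial>\<nu>) \<longlonglongrightarrow> 0" by simp
  then obtain k where k: "(\<integral>x. 1 - \<zeta> k x \<partial>\<nu>) < \<gamma>"
    using \<gamma> by (metis order_tendstoD(2) eventually_sequentially order_refl)
  have "(\<lambda>n. \<integral>x. 1 - \<zeta> k x \<partial>\<kappa> n) \<longlonglongrightarrow> (\<integral>x. 1 - \<zeta> k x \<partial>\<nu>)"
    by (rule P1_tendsto_bounded[OF conv, of _ 1]) (use \<zeta>[of k] in \<open>auto intro!: continuous_intros\<close>)
  from order_tendstoD(2)[OF this k] obtain N1 where N1: "\<And>n. n \<ge> N1 \<Longrightarrow> (\<integral>x. 1 - \<zeta> k x \<partial>\<kappa> n) < \<gamma>"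
    by (auto simp: eventually_sequentially)
  let ?K = "cball (0::'a) (real k + 1) \<times> cball (0::'a) (real k + 1)"
  have "compact ?K" by (intro compact_Times compact_cball)
  then obtain q where q: "real_polynomial_function q" "\<And>z. z \<in> ?K \<Longrightarrow> \<bar>F z - q z\<bar> < \<gamma>"
    using Stone_Weierstrass_real_polynomial_function[OF _ continuous_on_subset[OF F(1) subset_UNIV] \<gamma>]
    by metis
  let ?Q = "\<lambda>z. \<zeta> k (fst z) * \<zeta> k (snd z) * q z"
  have Q: "(\<lambda>n. \<integral>z. ?Q z \<partial>(\<kappa> n \<Otimes>\<^sub>M \<kappa> n)) \<longlonglongrightarrow> (\<integral>z. ?Q z \<partial>(\<nu> \<Otimes>\<^sub>M \<nu>))
      \<and> (\<forall>\<mu>\<in>P1. integrable (\<mu> \<Otimes>\<^sub>M \<mu>) ?Q)"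
    by (rule P1_tendsto_compact_support_pair[OF \<kappa> conv polynomial_tensor[OF q(1)] \<zeta>(3) \<zeta>0])
  have close: "\<bar>(\<integral>z. F z \<partial>(\<mu> \<Otimes>\<^sub>M \<mu>)) - (\<integral>z. ?Q z \<partial>(\<mu> \<Otimes>\<^sub>M \<mu>))\<bar> \<le> \<delta> / 4"
    if \<mu>: "\<mu> \<in> P1" and small: "(\<integral>x. 1 - \<zeta> k x \<partial>\<mu>) < \<gamma>" for \<mu>
  proof -
    interpret prob_space \<mu> using P1_simps(1)[OF \<mu>] .
    interpret pp: prob_space "\<mu> \<Otimes>\<^sub>M \<mu>" by (rule P1_pair_prob[OF \<mu>])
    have F_int: "integrable (\<mu> \<Otimes>\<^sub>M \<mu>) F" using P1_pair(1)[OF \<mu> F(1), of B] F(2) by simp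
    have Q_int: "integrable (\<mu> \<Otimes>\<^sub>M \<mu>) ?Q" using Q \<mu> by blast
    have c1: "continuous_on UNIV (\<lambda>z :: 'a \<times> 'a. 1 - \<zeta> k (fst z))"
      and c2: "continuous_on UNIV (\<lambda>z :: 'a \<times> 'a. 1 - \<zeta> k (snd z))"
      by (intro continuous_on_diff continuous_on_const continuous_on_compose2[OF \<zeta>(3)]
          continuous_on_fst continuous_on_snd continuous_on_id subset_UNIV)+
    have b1: "norm (1 - \<zeta> k (fst z)) \<le> 1" and b2: "norm (1 - \<zeta> k (snd z)) \<le> 1" for z :: "'a \<times> 'a"
      using \<zeta>(1,2)[of k "fst z"] \<zeta>(1,2)[of k "snd z"] by auto
    note i1 = P1_pair(1,2)[OF \<mu> c1 b1] and i2 = P1_pair(1,3)[OF \<mu> c2 b2]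
    have e1: "(\<integral>z. 1 - \<zeta> k (fst z) \<partial>(\<mu> \<Otimes>\<^sub>M \<mu>)) = (\<integral>x. 1 - \<zeta> k x \<partial>\<mu>)"
      using i1(2) by (simp add: prob_space)
    have e2: "(\<integral>z. 1 - \<zeta> k (snd z) \<partial>(\<mu> \<Otimes>\<^sub>M \<mu>)) = (\<integral>x. 1 - \<zeta> k x \<partial>\<mu>)"
      using i2(2) by (simp add: prob_space)
    have split: "(\<integral>z. B * a z + B * b z + \<gamma> \<partial>(\<mu> \<Otimes>\<^sub>M \<mu>)) =
        B * (\<integral>z. a z \<partial>(\<mu> \<Otimes>\<^sub>M \<mu>)) + B * (\<integral>z. b z \<partial>(\<mu> \<Otimes>\<^sub>M \<mu>)) + \<gamma>"
      if "integrable (\<mu> \<Otimes>\<^sub>M \<mu>) a" "integrable (\<mu> \<Otimes>\<^sub>M \<mu>) b" for a b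
      using that by (simp add: pp.prob_space)
    have pt: "\<bar>F z - ?Q z\<bar> \<le> B * (1 - \<zeta> k (fst z)) + B * (1 - \<zeta> k (snd z)) + \<gamma>" for z
    proof -
      let ?s = "\<zeta> k (fst z)" and ?t = "\<zeta> k (snd z)"
      have st: "0 \<le> ?s" "?s \<le> 1" "0 \<le> ?t" "?t \<le> 1" using \<zeta> by auto
      have "\<bar>F z * (1 - ?s * ?t)\<bar> \<le> B * ((1 - ?s) + (1 - ?t))"
      proof -
        have "0 \<le> (1 - ?s) * (1 - ?t)" using st by (intro mult_nonneg_nonneg) auto
        then have "1 - ?s * ?t \<le> (1 - ?s) + (1 - ?t)" by (simp add: algebra_simps)
        moreover have "0 \<le> 1 - ?s * ?t" using st by (simp add: mult_le_one)
        ultimately show ?thesis unfolding abs_mult using F(2)[of z] by (intro mult_mono) auto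
      qed
      moreover have "\<bar>(?s * ?t) * (F z - q z)\<bar> \<le> \<gamma>"
      proof (cases "z \<in> ?K")
        case True
        have "(?s * ?t) * \<bar>F z - q z\<bar> \<le> 1 * \<gamma>"
          using st q(2)[OF True] by (intro mult_mono) (auto simp: mult_le_one)
        then show ?thesis using st by (simp add: abs_mult)
      next
        case False
        then have "?s = 0 \<or> ?t = 0" by (cases z) (auto intro!: \<zeta>0)
        then show ?thesis using \<gamma> by auto
      qed
      moreover have "F z - ?Q z = F z * (1 - ?s * ?t) + (?s * ?t) * (F z - q z)"
        by (simp add: algebra_simps)
      ultimately show ?thesis by (simp only: distrib_left)
    qed
    have "\<bar>(\<integral>z. F z \<partial>(\<mu> \<Otimes>\<^sub>M \<mu>)) - (\<integral>z. ?Q z \<partial>(\<mu> \<Otimes>\<^sub>M \<mu>))\<bar> = \<bar>\<integral>z. F z - ?Q z \<partial>(\<mu> \<Otimes>\<^sub>M \<mu>)\<bar>"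
      using F_int Q_int by simp
    also have "\<dots> \<le> (\<integral>z. B * (1 - \<zeta> k (fst z)) + B * (1 - \<zeta> k (snd z)) + \<gamma> \<partial>(\<mu> \<Otimes>\<^sub>M \<mu>))"
      by (rule abs_integral_le[OF _ pt])
        (intro Bochner_Integration.integrable_add integrable_mult_right i1(1) i2(1) pp.integrable_const)
    also have "\<dots> = B * (\<integral>x. 1 - \<zeta> k x \<partial>\<mu>) + B * (\<integral>x. 1 - \<zeta> k x \<partial>\<mu>) + \<gamma>"
      unfolding split[OF i1(1) i2(1)] e1 e2 ..
    also have "\<dots> \<le> B * \<gamma> + B * \<gamma> + \<gamma>" using small B0 by (intro add_mono mult_left_mono) auto
    also have "\<dots> \<le> 2 * (B + 1) * \<gamma>" using \<gamma> by (simp add: algebra_simps)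
    also have "\<dots> = \<delta> / 4" using B0 by (simp add: \<gamma>_def field_simps)
    finally show ?thesis .
  qed
  obtain N2 where N2: "\<And>n. n \<ge> N2 \<Longrightarrow>
      norm ((\<integral>z. ?Q z \<partial>(\<kappa> n \<Otimes>\<^sub>M \<kappa> n)) - (\<integral>z. ?Q z \<partial>(\<nu> \<Otimes>\<^sub>M \<nu>))) < \<delta> / 4"
    using LIMSEQ_D[OF Q[THEN conjunct1], of "\<delta> / 4"] \<delta> by auto
  have "norm ((\<integral>z. F z \<partial>(\<kappa> n \<Otimes>\<^sub>M \<kappa> n)) - (\<integral>z. F z \<partial>(\<nu> \<Otimes>\<^sub>M \<nu>))) < \<delta>" if "n \<ge> max N1 N2" for n
    using N2[of n] close[OF \<kappa>(1) N1[of n]] close[OF \<kappa>(2) k] that \<delta>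
    unfolding real_norm_def abs_less_iff abs_le_iff by simp
  then show "\<exists>N. \<forall>n\<ge>N. norm ((\<integral>z. F z \<partial>(\<kappa> n \<Otimes>\<^sub>M \<kappa> n)) - (\<integral>z. F z \<partial>(\<nu> \<Otimes>\<^sub>M \<nu>))) < \<delta>" by blast
qed

section \<open>The grazing collision limit\<close>

lemma admissible_continuous:
  assumes "admissible_interaction f"
  shows "continuous_on UNIV f"
  using assms local_lipschitz_continuous_on[of UNIV UNIV "\<lambda>_ :: real. f" 0]
  by (simp add: admissible_interaction_def locally_lipschitz_def)

lemma interaction_kernel_continuous:
  assumes H: "admissible_interaction H" and G: "\<And>l. admissible_interaction (G l)"
  shows "continuous_on UNIV (\<lambda>z. interaction_kernel H G \<theta> \<theta>' v v' (fst z) (snd z))"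
  unfolding interaction_kernel_def
  by (intro continuous_intros continuous_on_compose2[OF admissible_continuous[OF H]]
      continuous_on_compose2[OF admissible_continuous[OF G]] subset_UNIV)

text \<open>The kernel depends on the controls in an affine way, with bounded coefficients; hence it converges
uniformly in \<open>x\<close> and \<open>y\<close>.\<close>

lemma interaction_kernel_control_continuous:
  assumes G: "\<And>l. admissible_interaction (G l)"
    and \<theta>: "\<theta> \<in> {0, 1}" "\<theta>' \<in> {0, 1}"
    and v: "v \<longlonglongrightarrow> v0" "v' \<longlonglongrightarrow> v0'"
  shows "\<exists>c. c \<longlonglongrightarrow> (0 :: real) \<and> (\<forall>n x y.
    norm (interaction_kernel H G \<theta> \<theta>' (v n) (v' n) x y - interaction_kernel H G \<theta> \<theta>' v0 v0' x y) \<le> c n)"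
proof -
  have "\<exists>B. \<forall>z. norm (G l z) \<le> B" for l
    using G[of l] by (auto simp: admissible_interaction_def bounded_iff)
  then obtain BG where BG: "\<And>l z. norm (G l z) \<le> BG l" by metis
  show ?thesis
  proof (intro exI[of _ "\<lambda>n. (\<Sum>l\<in>UNIV. \<bar>v' n $ l - v0' $ l\<bar> * BG l) + norm (v n - v0)"] conjI allI)
    have "(\<lambda>n. (\<Sum>l\<in>UNIV. \<bar>v' n $ l - v0' $ l\<bar> * BG l) + norm (v n - v0))
        \<longlonglongrightarrow> (\<Sum>l\<in>UNIV. \<bar>v0' $ l - v0' $ l\<bar> * BG l) + norm (v0 - v0)"
      by (intro tendsto_intros v)
    then show "(\<lambda>n. (\<Sum>l\<in>UNIV. \<bar>v' n $ l - v0' $ l\<bar> * BG l) + norm (v n - v0)) \<longlonglongrightarrow> 0" by simp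
    fix n x y
    have S: "norm ((\<Sum>l\<in>UNIV. (v' n $ l) *\<^sub>R G l (x - y)) - (\<Sum>l\<in>UNIV. (v0' $ l) *\<^sub>R G l (x - y)))
        \<le> (\<Sum>l\<in>UNIV. \<bar>v' n $ l - v0' $ l\<bar> * BG l)"
      unfolding sum_subtractf[symmetric] scaleR_diff_left[symmetric]
      by (intro sum_norm_le) (simp add: mult_left_mono BG)
    then have "0 \<le> (\<Sum>l\<in>UNIV. \<bar>v' n $ l - v0' $ l\<bar> * BG l)" using norm_ge_zero order_trans by blast
    then show "norm (interaction_kernel H G \<theta> \<theta>' (v n) (v' n) x y - interaction_kernel H G \<theta> \<theta>' v0 v0' x y)
        \<le> (\<Sum>l\<in>UNIV. \<bar>v' n $ l - v0' $ l\<bar> * BG l) + norm (v n - v0)"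
      using S \<theta> norm_ge_zero[of "v n - v0"] by (auto simp: interaction_kernel_def intro: add_increasing2)
  qed
qed

text \<open>The grazing limit at a fixed time.  By Taylor expansion the difference quotient of \<open>\<phi>\<close> along the jump is
\<open>gradient \<phi> x\<close> applied to the kernel, up to \<open>O (a n)\<close>; replacing the controls by their limits costs a
further \<open>c n\<close>.  What remains is a fixed bounded continuous integrand.\<close>

lemma collision_limit:
  fixes \<kappa> :: "nat \<Rightarrow> (real ^ 'd::finite) measure"
  assumes H: "admissible_interaction H" and G: "\<And>l. admissible_interaction (G l)"
    and \<theta>: "\<theta> \<in> {0, 1}" "\<theta>' \<in> {0, 1}"
    and v: "v \<longlonglongrightarrow> v0" "v' \<longlonglongrightarrow> v0'"
    and C: "\<And>n x y. norm (interaction_kernel H G \<theta> \<theta>' (v n) (v' n) x y) \<le> C"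
      "\<And>x y. norm (interaction_kernel H G \<theta> \<theta>' v0 v0' x y) \<le> C"
    and a: "\<And>n. a n > 0" "a \<longlonglongrightarrow> 0"
    and \<kappa>: "\<And>n. \<kappa> n \<in> P1" "\<nu> \<in> P1" "P1_tendsto \<kappa> \<nu>"
    and \<phi>: "\<phi> \<in> test_functions"
  shows "(\<lambda>n. 1 / a n * (\<integral>y. (\<integral>x. (\<phi> (post_interaction H G (a n) \<theta> \<theta>' (v n) (v' n) x y) - \<phi> x) \<partial>\<kappa> n) \<partial>\<kappa> n))
    \<longlonglongrightarrow> (\<integral>z. gradient \<phi> (fst z) \<bullet> interaction_kernel H G \<theta> \<theta>' v0 v0' (fst z) (snd z) \<partial>(\<nu> \<Otimes>\<^sub>M \<nu>))"
proof -
  let ?K = "\<lambda>n z. interaction_kernel H G \<theta> \<theta>' (v n) (v' n) (fst z) (snd z)"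
  let ?Klim = "\<lambda>z. interaction_kernel H G \<theta> \<theta>' v0 v0' (fst z) (snd z)"
  define F where "F z = gradient \<phi> (fst z) \<bullet> ?Klim z" for z
  define D where "D n z = \<phi> (fst z + a n *\<^sub>R ?K n z) - \<phi> (fst z)" for n z
  obtain B where B: "\<And>x. \<bar>\<phi> x\<bar> \<le> B" using test_function_bounded[OF \<phi>] by blast
  obtain L where L: "L \<ge> 0" "\<And>x. norm (gradient \<phi> x) \<le> L" using test_function_lipschitz[OF \<phi>] by blast
  obtain M where M: "M \<ge> 0" "\<And>x h. \<bar>\<phi> (x + h) - \<phi> x - gradient \<phi> x \<bullet> h\<bar> \<le> M * (norm h)\<^sup>2"
    using test_function_taylor[OF \<phi>] by blast
  obtain c where c: "c \<longlonglongrightarrow> 0" "\<And>n x y.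
      norm (interaction_kernel H G \<theta> \<theta>' (v n) (v' n) x y - interaction_kernel H G \<theta> \<theta>' v0 v0' x y) \<le> c n"
    using interaction_kernel_control_continuous[where G = G and H = H, OF G \<theta> v] by blast
  have grad: "continuous_on UNIV (gradient \<phi>)"
    unfolding gradient_def[abs_def]
    by (intro continuous_on_vec_lambda test_function_continuous test_function_partial_derivative \<phi>)
  note K_cont = interaction_kernel_continuous[where G = G and \<theta> = \<theta> and \<theta>' = \<theta>', OF H G]
  have F: "continuous_on UNIV F" "\<bar>F z\<bar> \<le> L * C" for z
  proof -
    show "continuous_on UNIV F"
      unfolding F_def
      by (intro continuous_on_inner K_cont continuous_on_compose2[OF grad] continuous_on_fst continuous_on_id subset_UNIV)
    have "\<bar>F z\<bar> \<le> norm (gradient \<phi> (fst z)) * norm (?Klim z)"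
      unfolding F_def by (rule Cauchy_Schwarz_ineq2)
    also have "\<dots> \<le> L * C" using L C(2) by (intro mult_mono) auto
    finally show "\<bar>F z\<bar> \<le> L * C" .
  qed
  have D: "continuous_on UNIV (D n)" "norm (D n z) \<le> 2 * B" for n z
  proof -
    show "continuous_on UNIV (D n)"
      unfolding D_def
      by (intro continuous_on_diff continuous_on_compose2[OF test_function_continuous[OF \<phi>]]
          continuous_on_add continuous_on_scaleR continuous_on_const K_cont
          continuous_on_fst continuous_on_id subset_UNIV)
    show "norm (D n z) \<le> 2 * B"
      unfolding D_def using B[of "fst z"] B[of "fst z + a n *\<^sub>R ?K n z"] by simp
  qed
  have iter: "(\<integral>y. (\<integral>x. (\<phi> (post_interaction H G (a n) \<theta> \<theta>' (v n) (v' n) x y) - \<phi> x) \<partial>\<kappa> n) \<partial>\<kappa> n)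
      = (\<integral>z. D n z \<partial>(\<kappa> n \<Otimes>\<^sub>M \<kappa> n))" for n
    using P1_pair(2)[OF \<kappa>(1) D] by (simp add: D_def post_interaction_def)
  have pt: "\<bar>1 / a n * D n z - F z\<bar> \<le> M * C\<^sup>2 * a n + L * c n" for n z
  proof -
    have "\<bar>D n z - gradient \<phi> (fst z) \<bullet> (a n *\<^sub>R ?K n z)\<bar> \<le> M * (norm (a n *\<^sub>R ?K n z))\<^sup>2"
      unfolding D_def by (rule M(2))
    also have "\<dots> \<le> M * (a n * C)\<^sup>2"
      using C(1) a(1)[of n] M(1) by (intro mult_left_mono power_mono) auto
    finally have "1 / a n * \<bar>D n z - gradient \<phi> (fst z) \<bullet> (a n *\<^sub>R ?K n z)\<bar> \<le> 1 / a n * (M * (a n * C)\<^sup>2)"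
      using a(1)[of n] by (intro mult_left_mono) auto
    moreover have "1 / a n * \<bar>D n z - gradient \<phi> (fst z) \<bullet> (a n *\<^sub>R ?K n z)\<bar> =
        \<bar>1 / a n * (D n z - gradient \<phi> (fst z) \<bullet> (a n *\<^sub>R ?K n z))\<bar>"
      using a(1)[of n] by (simp add: abs_mult)
    moreover have "1 / a n * (D n z - gradient \<phi> (fst z) \<bullet> (a n *\<^sub>R ?K n z)) =
        1 / a n * D n z - gradient \<phi> (fst z) \<bullet> ?K n z"
      using a(1)[of n] by (simp add: right_diff_distrib)
    moreover have "1 / a n * (M * (a n * C)\<^sup>2) = M * C\<^sup>2 * a n"
      using a(1)[of n] by (simp add: power2_eq_square)
    ultimately have 1: "\<bar>1 / a n * D n z - gradient \<phi> (fst z) \<bullet> ?K n z\<bar> \<le> M * C\<^sup>2 * a n" by metis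
    have "\<bar>gradient \<phi> (fst z) \<bullet> ?K n z - F z\<bar> \<le> norm (gradient \<phi> (fst z)) * norm (?K n z - ?Klim z)"
      unfolding F_def inner_diff_right[symmetric] by (rule Cauchy_Schwarz_ineq2)
    also have "\<dots> \<le> L * c n" using L c(2) by (intro mult_mono) auto
    finally show ?thesis using 1 by linarith
  qed
  have "(\<lambda>n. 1 / a n * (\<integral>z. D n z \<partial>(\<kappa> n \<Otimes>\<^sub>M \<kappa> n)) - (\<integral>z. F z \<partial>(\<kappa> n \<Otimes>\<^sub>M \<kappa> n))) \<longlonglongrightarrow> 0"
  proof (rule Lim_null_comparison)
    have "(\<lambda>n. M * C\<^sup>2 * a n + L * c n) \<longlonglongrightarrow> M * C\<^sup>2 * 0 + L * 0"
      by (intro tendsto_intros a c)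
    then show "(\<lambda>n. M * C\<^sup>2 * a n + L * c n) \<longlonglongrightarrow> 0" by simp
    show "\<forall>\<^sub>F n in sequentially. norm (1 / a n * (\<integral>z. D n z \<partial>(\<kappa> n \<Otimes>\<^sub>M \<kappa> n)) - (\<integral>z. F z \<partial>(\<kappa> n \<Otimes>\<^sub>M \<kappa> n)))
        \<le> M * C\<^sup>2 * a n + L * c n"
    proof (intro always_eventually allI)
      fix n
      interpret prob_space "\<kappa> n \<Otimes>\<^sub>M \<kappa> n" by (rule P1_pair_prob[OF \<kappa>(1)])
      have F_int: "integrable (\<kappa> n \<Otimes>\<^sub>M \<kappa> n) F" using P1_pair(1)[OF \<kappa>(1) F(1), of "L * C"] F(2) by simp
      have "1 / a n * (\<integral>z. D n z \<partial>(\<kappa> n \<Otimes>\<^sub>M \<kappa> n)) - (\<integral>z. F z \<partial>(\<kappa> n \<Otimes>\<^sub>M \<kappa> n)) =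
          (\<integral>z. 1 / a n * D n z - F z \<partial>(\<kappa> n \<Otimes>\<^sub>M \<kappa> n))"
        using P1_pair(1)[OF \<kappa>(1) D] F_int by simp
      then show "norm (1 / a n * (\<integral>z. D n z \<partial>(\<kappa> n \<Otimes>\<^sub>M \<kappa> n)) - (\<integral>z. F z \<partial>(\<kappa> n \<Otimes>\<^sub>M \<kappa> n)))
          \<le> M * C\<^sup>2 * a n + L * c n"
        using abs_integral_le_const[of "\<lambda>z. 1 / a n * D n z - F z"] pt[of n] by (simp del: Bochner_Integration.integral_diff)
    qed
  qed
  from tendsto_add[OF this P1_tendsto_pair[OF \<kappa> F]]
  show ?thesis unfolding iter F_def[symmetric] by simp
qed

lemma averaged_kernel_eq:
  assumes "prob_space P" "bernoulli_rv P p \<Theta>" "bernoulli_rv P p \<Theta>'"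
    "prob_space.indep_var P borel \<Theta> borel \<Theta>'"
  shows "averaged_kernel P \<Theta> \<Theta>' H G v v' x y =
    (1 - p)\<^sup>2 *\<^sub>R interaction_kernel H G 0 0 v v' x y + (p * (1 - p)) *\<^sub>R interaction_kernel H G 0 1 v v' x y
    + (p * (1 - p)) *\<^sub>R interaction_kernel H G 1 0 v v' x y + p\<^sup>2 *\<^sub>R interaction_kernel H G 1 1 v v' x y"
  unfolding averaged_kernel_def
  by (rule bernoulli_expectation[OF assms, of "\<lambda>\<theta> \<theta>'. interaction_kernel H G \<theta> \<theta>' v v' x y"])

text \<open>The velocity field, averaged over \<open>\<Theta>\<close> and \<open>\<Theta>'\<close>, is put into the form of a four-term combination of
integrals over the product measure, the form in which the limit of the collision terms appears.\<close>

lemma averaged_transport_integral: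
  fixes \<nu> :: "(real ^ 'd::finite) measure"
  assumes P: "prob_space P" "bernoulli_rv P p \<Theta>" "bernoulli_rv P p \<Theta>'"
      "prob_space.indep_var P borel \<Theta> borel \<Theta>'"
    and H: "admissible_interaction H" and G: "\<And>l. admissible_interaction (G l)"
    and \<nu>: "\<nu> \<in> P1" and \<phi>: "\<phi> \<in> test_functions"
    and C: "\<And>\<theta> \<theta>' x y. \<theta> \<in> {0, 1} \<Longrightarrow> \<theta>' \<in> {0, 1} \<Longrightarrow> norm (interaction_kernel H G \<theta> \<theta>' v v' x y) \<le> C"
  defines "J \<equiv> \<lambda>\<theta> \<theta>'. \<integral>z. gradient \<phi> (fst z) \<bullet> interaction_kernel H G \<theta> \<theta>' v v' (fst z) (snd z) \<partial>(\<nu> \<Otimes>\<^sub>M \<nu>)"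
  shows "(\<integral>x. gradient \<phi> x \<bullet> (\<integral>y. averaged_kernel P \<Theta> \<Theta>' H G v v' x y \<partial>\<nu>) \<partial>\<nu>) =
    (1 - p)\<^sup>2 * J 0 0 + (p * (1 - p)) * J 0 1 + (p * (1 - p)) * J 1 0 + p\<^sup>2 * J 1 1"
proof -
  interpret prob_space \<nu> using P1_simps(1)[OF \<nu>] .
  obtain L where L: "L \<ge> 0" "\<And>x. norm (gradient \<phi> x) \<le> L" using test_function_lipschitz[OF \<phi>] by blast
  have grad: "continuous_on UNIV (gradient \<phi>)"
    unfolding gradient_def[abs_def]
    by (intro continuous_on_vec_lambda test_function_continuous test_function_partial_derivative \<phi>)
  have K_int: "integrable \<nu> (\<lambda>y. interaction_kernel H G \<theta> \<theta>' v v' x y)" if "\<theta> \<in> {0, 1}" "\<theta>' \<in> {0, 1}" for \<theta> \<theta>' x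
  proof (rule P1_integrable_bounded[OF \<nu>])
    show "norm (interaction_kernel H G \<theta> \<theta>' v v' x y) \<le> C" for y by (rule C[OF that])
    show "continuous_on UNIV (\<lambda>y. interaction_kernel H G \<theta> \<theta>' v v' x y)"
      using continuous_on_compose2[OF interaction_kernel_continuous[where G = G, OF H G], of UNIV "\<lambda>y. (x, y)"]
      by (simp add: continuous_on_Pair)
  qed
  have pair: "integrable (\<nu> \<Otimes>\<^sub>M \<nu>) (\<lambda>z. gradient \<phi> (fst z) \<bullet> interaction_kernel H G \<theta> \<theta>' v v' (fst z) (snd z))"
    "(\<integral>x. (\<integral>y. gradient \<phi> x \<bullet> interaction_kernel H G \<theta> \<theta>' v v' x y \<partial>\<nu>) \<partial>\<nu>) = J \<theta> \<theta>'"
    "integrable \<nu> (\<lambda>x. \<integral>y. gradient \<phi> x \<bullet> interaction_kernel H G \<theta> \<theta>' v v' x y \<partial>\<nu>)"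
    if "\<theta> \<in> {0, 1}" "\<theta>' \<in> {0, 1}" for \<theta> \<theta>'
  proof -
    let ?F = "\<lambda>z. gradient \<phi> (fst z) \<bullet> interaction_kernel H G \<theta> \<theta>' v v' (fst z) (snd z)"
    have 1: "continuous_on UNIV ?F"
      by (intro continuous_on_inner interaction_kernel_continuous H G continuous_on_compose2[OF grad]
          continuous_on_fst continuous_on_id subset_UNIV)
    have 2: "norm (?F z) \<le> L * C" for z
      unfolding real_norm_def
      using L C[OF that] by (intro order_trans[OF Cauchy_Schwarz_ineq2] mult_mono) auto
    show int: "integrable (\<nu> \<Otimes>\<^sub>M \<nu>) ?F" by (rule P1_pair(1)[OF \<nu> 1 2])
    show "(\<integral>x. (\<integral>y. gradient \<phi> x \<bullet> interaction_kernel H G \<theta> \<theta>' v v' x y \<partial>\<nu>) \<partial>\<nu>) = J \<theta> \<theta>'"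
      using P1_pair(3)[OF \<nu> 1 2] by (simp add: J_def)
    interpret pair_prob_space \<nu> \<nu> ..
    show "integrable \<nu> (\<lambda>x. \<integral>y. gradient \<phi> x \<bullet> interaction_kernel H G \<theta> \<theta>' v v' x y \<partial>\<nu>)"
      using integrable_fst'[OF int] by simp
  qed
  have inner: "gradient \<phi> x \<bullet> (\<integral>y. averaged_kernel P \<Theta> \<Theta>' H G v v' x y \<partial>\<nu>) =
      (1 - p)\<^sup>2 * (\<integral>y. gradient \<phi> x \<bullet> interaction_kernel H G 0 0 v v' x y \<partial>\<nu>)
      + (p * (1 - p)) * (\<integral>y. gradient \<phi> x \<bullet> interaction_kernel H G 0 1 v v' x y \<partial>\<nu>)
      + (p * (1 - p)) * (\<integral>y. gradient \<phi> x \<bullet> interaction_kernel H G 1 0 v v' x y \<partial>\<nu>)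
      + p\<^sup>2 * (\<integral>y. gradient \<phi> x \<bullet> interaction_kernel H G 1 1 v v' x y \<partial>\<nu>)" for x
    unfolding averaged_kernel_eq[OF P] by (simp add: K_int inner_add_right)
  show ?thesis
    unfolding inner by (simp add: pair)
qed

theorem theorem4p2:
  fixes H :: "real ^ 'd \<Rightarrow> real ^ 'd"
    and G :: "'d::finite \<Rightarrow> real ^ 'd \<Rightarrow> real ^ 'd"
    and P :: "'w measure"
    and \<Theta> \<Theta>' :: "'w \<Rightarrow> real"
    and p T :: real
    and U :: "(real ^ 'd) set"
    and u u' :: "real \<Rightarrow> real \<Rightarrow> real ^ 'd"
    and ubar ubar' :: "real \<Rightarrow> real ^ 'd"
    and \<mu>0 :: "(real ^ 'd) measure"
    and \<mu>\<epsilon> :: "real \<Rightarrow> real \<Rightarrow> (real ^ 'd) measure"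
  assumes H: "admissible_interaction H"
    and G: "\<And>l. admissible_interaction (G l)"
    and P: "prob_space P"
    and p: "p \<in> {0..1}"
    and \<Theta>: "bernoulli_rv P p \<Theta>" "bernoulli_rv P p \<Theta>'"
    and indep: "prob_space.indep_var P borel \<Theta> borel \<Theta>'"
    and T: "T > 0"
    and U: "compact U"
    and u_measurable: "\<And>\<alpha>. \<alpha> > 0 \<Longrightarrow> u \<alpha> \<in> borel_measurable (lebesgue_on {0..T})"
      "\<And>\<alpha>. \<alpha> > 0 \<Longrightarrow> u' \<alpha> \<in> borel_measurable (lebesgue_on {0..T})"
    and u_values: "\<And>\<alpha> t. \<alpha> > 0 \<Longrightarrow> t \<in> {0..T} \<Longrightarrow> u \<alpha> t \<in> U"
      "\<And>\<alpha> t. \<alpha> > 0 \<Longrightarrow> t \<in> {0..T} \<Longrightarrow> u' \<alpha> t \<in> U"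
    and u_limit: "\<And>t. t \<in> {0..T} \<Longrightarrow> ((\<lambda>\<alpha>. u \<alpha> t) \<longlongrightarrow> ubar t) (at_right 0)"
      "\<And>t. t \<in> {0..T} \<Longrightarrow> ((\<lambda>\<alpha>. u' \<alpha> t) \<longlongrightarrow> ubar' t) (at_right 0)"
    and \<mu>0: "\<mu>0 \<in> P1"
    and \<mu>\<epsilon>: "\<And>\<epsilon>. \<epsilon> > 0 \<Longrightarrow>
      boltzmann_weak_solution P \<Theta> \<Theta>' H G \<epsilon> (1 / \<epsilon>) (u \<epsilon>) (u' \<epsilon>) T \<mu>0 (\<mu>\<epsilon> \<epsilon>)"
  shows "(\<forall>v v' x y. averaged_kernel P \<Theta> \<Theta>' H G v v' x y =
            (1 - p)\<^sup>2 *\<^sub>R H (x - y)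
            + (p * (1 - p)) *\<^sub>R (\<Sum>l\<in>UNIV. (v' $ l) *\<^sub>R G l (x - y))
            + p *\<^sub>R v) \<and>
         (\<forall>e :: nat \<Rightarrow> real. (\<forall>n. e n > 0) \<and> e \<longlonglongrightarrow> 0 \<longrightarrow>
            (\<exists>r \<mu>. strict_mono (r :: nat \<Rightarrow> nat) \<and>
               (\<forall>t\<in>{0..T}. P1_tendsto (\<lambda>n. \<mu>\<epsilon> (e (r n)) t) (\<mu> t)) \<and>
               mean_field_weak_solution
                 (\<lambda>t. averaged_kernel P \<Theta> \<Theta>' H G (ubar t) (ubar' t)) T \<mu>0 \<mu>))"
proof (intro conjI allI impI, goal_cases)
  case (1 v v' x y)
  have "p * (1 - p) + p\<^sup>2 = p" by (simp add: power2_eq_square algebra_simps)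
  then have "(p * (1 - p)) *\<^sub>R v + p\<^sup>2 *\<^sub>R v = p *\<^sub>R v"
    unfolding scaleR_add_left[symmetric] by simp
  then show ?case
    unfolding averaged_kernel_eq[OF P \<Theta> indep] by (simp add: interaction_kernel_def add.assoc)
next
  case (2 e)
  then have e: "\<And>n. e n > 0" "e \<longlonglongrightarrow> 0" by auto
  have \<Theta>01: "\<Theta> \<omega> \<in> {0, 1} \<and> \<Theta>' \<omega> \<in> {0, 1}" if "\<omega> \<in> space P" for \<omega>
    using \<Theta> that by (auto simp: bernoulli_rv_def)
  obtain C where C: "C \<ge> 0" and CU: "\<And>\<theta> \<theta>' v v' x y. \<theta> \<in> {0, 1} \<Longrightarrow> \<theta>' \<in> {0, 1} \<Longrightarrow> v \<in> U \<Longrightarrow> v' \<in> U \<Longrightarrow>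
      norm (interaction_kernel H G \<theta> \<theta>' v v' x y) \<le> C"
    using interaction_kernel_bounded[where G = G, OF H G compact_imp_bounded[OF U]] by blast
  have C\<epsilon>: "norm (interaction_kernel H G \<theta> \<theta>' (u \<epsilon> t) (u' \<epsilon> t) x y) \<le> C"
    if "\<theta> \<in> {0, 1}" "\<theta>' \<in> {0, 1}" "\<epsilon> > 0" "t \<in> {0..T}" for \<theta> \<theta>' \<epsilon> t x y
    using that by (intro CU u_values)
  have P1: "\<mu>\<epsilon> \<epsilon> t \<in> P1" if "\<epsilon> > 0" "t \<in> {0..T}" for \<epsilon> t
    using \<mu>\<epsilon>[OF that(1)] that(2) by (auto simp: boltzmann_weak_solution_def L2_P1_def)
  \<comment> \<open>the tail bounds are uniform on bounded intervals of \<open>\<epsilon>\<close>, and \<open>e\<close> is bounded\<close>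
  obtain E where E: "\<And>n. e n \<le> E"
    using convergent_imp_Bseq[OF convergentI[OF e(2)]] by (auto simp: Bseq_def) (metis abs_le_D1)
  have tails: "uniform_tails (\<Union>n. \<mu>\<epsilon> (e n) ` {0..T})"
    by (rule uniform_tails_subset[OF boltzmann_uniform_tails[OF P \<Theta>01 C C\<epsilon> \<mu>\<epsilon> \<mu>0, of E]])
      (use e(1) E in force)+
  obtain r \<mu> where r: "strict_mono r" and \<mu>: "\<mu> \<in> L2_P1 T" "\<mu> 0 = \<mu>0"
    and conv: "\<And>t. t \<in> {0..T} \<Longrightarrow> P1_tendsto (\<lambda>n. \<mu>\<epsilon> (e (r n)) t) (\<mu> t)"
  proof (rule P1_curves_compact[OF T _ _ tails])
    show "\<mu>\<epsilon> (e n) \<in> L2_P1 T" "\<mu>\<epsilon> (e n) 0 = \<mu>0" for n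
      using \<mu>\<epsilon>[OF e(1)[of n]] by (auto simp: boltzmann_weak_solution_def)
    fix \<phi> :: "real ^ 'd \<Rightarrow> real" assume \<phi>: "\<phi> \<in> test_functions"
    obtain L where L: "L \<ge> 0" "\<And>x y. \<bar>\<phi> x - \<phi> y\<bar> \<le> L * norm (x - y)"
      using test_function_lipschitz[OF \<phi>] by blast
    show "\<exists>L. \<forall>n. \<forall>s\<in>{0..T}. \<forall>t\<in>{0..T}.
        \<bar>(\<integral>x. \<phi> x \<partial>\<mu>\<epsilon> (e n) t) - (\<integral>x. \<phi> x \<partial>\<mu>\<epsilon> (e n) s)\<bar> \<le> L * \<bar>t - s\<bar>"
    proof (intro exI[of _ "L * C"] allI ballI)
      fix n s t assume "s \<in> {0..T}" "t \<in> {0..T}"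
      then show "\<bar>(\<integral>x. \<phi> x \<partial>\<mu>\<epsilon> (e n) t) - (\<integral>x. \<phi> x \<partial>\<mu>\<epsilon> (e n) s)\<bar> \<le> L * C * \<bar>t - s\<bar>"
        by (intro boltzmann_time_lipschitz[OF P \<Theta>01 C _ e(1) \<mu>\<epsilon>[OF e(1)] \<phi> L] C\<epsilon> e(1))
    qed
  qed blast
  define \<epsilon> where "\<epsilon> n = e (r n)" for n
  have \<epsilon>: "\<And>n. \<epsilon> n > 0" "\<epsilon> \<longlonglongrightarrow> 0"
    using e LIMSEQ_subseq_LIMSEQ[OF e(2) r] by (auto simp: \<epsilon>_def[abs_def] comp_def)
  have \<epsilon>_right: "filterlim \<epsilon> (at_right 0) sequentially"
    using \<epsilon> by (auto intro: tendsto_imp_filterlim_at_right)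
  have \<mu>_P1: "\<mu> t \<in> P1" if "t \<in> {0..T}" for t using \<mu>(1) that by (auto simp: L2_P1_def)
  have "mean_field_weak_solution (\<lambda>t. averaged_kernel P \<Theta> \<Theta>' H G (ubar t) (ubar' t)) T \<mu>0 \<mu>"
    unfolding mean_field_weak_solution_def has_time_derivative_def
  proof (intro conjI ballI \<mu>)
    fix \<phi> :: "real ^ 'd \<Rightarrow> real" and t assume \<phi>: "\<phi> \<in> test_functions" and t: "t \<in> {0..T}"
    obtain L where L: "L \<ge> 0" "\<And>x y. \<bar>\<phi> x - \<phi> y\<bar> \<le> L * norm (x - y)"
      using test_function_lipschitz[OF \<phi>] by blast
    obtain B where B: "\<And>x. \<bar>\<phi> x\<bar> \<le> B" using test_function_bounded[OF \<phi>] by blast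
    define f where "f n s = 1 / \<epsilon> n * (\<integral>\<omega>. (\<integral>y. (\<integral>x.
      (\<phi> (post_interaction H G (\<epsilon> n) (\<Theta> \<omega>) (\<Theta>' \<omega>) (u (\<epsilon> n) s) (u' (\<epsilon> n) s) x y) - \<phi> x)
        \<partial>\<mu>\<epsilon> (\<epsilon> n) s) \<partial>\<mu>\<epsilon> (\<epsilon> n) s) \<partial>P)" for n s
    define A where "A s = (\<integral>x. gradient \<phi> x \<bullet>
      (\<integral>y. averaged_kernel P \<Theta> \<Theta>' H G (ubar s) (ubar' s) x y \<partial>\<mu> s) \<partial>\<mu> s)" for s
    have I: "(f n has_integral ((\<integral>x. \<phi> x \<partial>\<mu>\<epsilon> (\<epsilon> n) t) - (\<integral>x. \<phi> x \<partial>\<mu>0))) {0..t}" for n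
      using \<mu>\<epsilon>[OF \<epsilon>(1)[of n]] \<phi> t
      unfolding boltzmann_weak_solution_def has_time_derivative_def f_def[abs_def] by auto
    have bound: "norm (f n s) \<le> L * C" if s: "s \<in> {0..t}" for n s
      unfolding f_def real_norm_def
      by (rule collision_integral_lipschitz_bound[OF P \<Theta>01 C\<epsilon> \<epsilon>(1) P1_simps(1)[OF P1] L])
        (use s t \<epsilon>(1) in auto)
    have lim: "(\<lambda>n. f n s) \<longlonglongrightarrow> A s" if "s \<in> {0..t}" for s
    proof -
      have s: "s \<in> {0..T}" using that t by auto
      have ulim: "(\<lambda>n. u (\<epsilon> n) s) \<longlonglongrightarrow> ubar s" "(\<lambda>n. u' (\<epsilon> n) s) \<longlonglongrightarrow> ubar' s"
        using filterlim_compose[OF u_limit(1)[OF s] \<epsilon>_right] filterlim_compose[OF u_limit(2)[OF s] \<epsilon>_right]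
        by auto
      \<comment> \<open>the limit controls stay in \<open>U\<close>, so the bound \<open>C\<close> on the kernel persists\<close>
      have "ubar s \<in> U" "ubar' s \<in> U"
        using closed_sequentially[OF compact_imp_closed[OF U] _ ulim(1)]
          closed_sequentially[OF compact_imp_closed[OF U] _ ulim(2)] u_values \<epsilon>(1) s by auto
      note Cbar = CU[OF _ _ this]
      define J where "J \<theta> \<theta>' = (\<integral>z. gradient \<phi> (fst z) \<bullet>
        interaction_kernel H G \<theta> \<theta>' (ubar s) (ubar' s) (fst z) (snd z) \<partial>(\<mu> s \<Otimes>\<^sub>M \<mu> s))" for \<theta> \<theta>'
      define g where "g n \<theta> \<theta>' = 1 / \<epsilon> n * (\<integral>y. (\<integral>x.
        (\<phi> (post_interaction H G (\<epsilon> n) \<theta> \<theta>' (u (\<epsilon> n) s) (u' (\<epsilon> n) s) x y) - \<phi> x)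
          \<partial>\<mu>\<epsilon> (\<epsilon> n) s) \<partial>\<mu>\<epsilon> (\<epsilon> n) s)" for n \<theta> \<theta>'
      have g: "(\<lambda>n. g n \<theta> \<theta>') \<longlonglongrightarrow> J \<theta> \<theta>'" if "\<theta> \<in> {0, 1}" "\<theta>' \<in> {0, 1}" for \<theta> \<theta>'
        unfolding g_def J_def
        by (rule collision_limit[OF H G that ulim C\<epsilon>[OF that \<epsilon>(1) s] Cbar[OF that] \<epsilon>
              P1[OF \<epsilon>(1) s] \<mu>_P1[OF s] _ \<phi>])
          (use conv[OF s] in \<open>simp add: \<epsilon>_def\<close>)
      have f_eq: "f n s = (1 - p)\<^sup>2 * g n 0 0 + (p * (1 - p)) * g n 0 1 + (p * (1 - p)) * g n 1 0 + p\<^sup>2 * g n 1 1" for n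
      proof -
        have "f n s = (\<integral>\<omega>. g n (\<Theta> \<omega>) (\<Theta>' \<omega>) \<partial>P)" by (simp add: f_def g_def)
        also have "\<dots> = (1 - p)\<^sup>2 *\<^sub>R g n 0 0 + (p * (1 - p)) *\<^sub>R g n 0 1 + (p * (1 - p)) *\<^sub>R g n 1 0 + p\<^sup>2 *\<^sub>R g n 1 1"
          by (rule bernoulli_expectation[OF P \<Theta> indep])
        finally show ?thesis by simp
      qed
      have "A s = (1 - p)\<^sup>2 * J 0 0 + (p * (1 - p)) * J 0 1 + (p * (1 - p)) * J 1 0 + p\<^sup>2 * J 1 1"
        unfolding A_def J_def
        by (rule averaged_transport_integral[OF P \<Theta> indep H G \<mu>_P1[OF s] \<phi> Cbar])
      then show ?thesis
        unfolding f_eq using g by (auto intro!: tendsto_intros)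
    qed
    have dom: "A integrable_on {0..t}" "(\<lambda>n. integral {0..t} (f n)) \<longlonglongrightarrow> integral {0..t} A"
      using dominated_convergence[OF has_integral_integrable[OF I] integrable_const_ivl bound lim] by auto
    have "(\<lambda>n. (\<integral>x. \<phi> x \<partial>\<mu>\<epsilon> (\<epsilon> n) t) - (\<integral>x. \<phi> x \<partial>\<mu>0)) \<longlonglongrightarrow> (\<integral>x. \<phi> x \<partial>\<mu> t) - (\<integral>x. \<phi> x \<partial>\<mu>0)"
      using P1_tendsto_bounded[OF conv[OF t] test_function_continuous[OF \<phi>] B]
      by (intro tendsto_diff tendsto_const) (simp add: \<epsilon>_def)
    then have "integral {0..t} A = (\<integral>x. \<phi> x \<partial>\<mu> t) - (\<integral>x. \<phi> x \<partial>\<mu>0)"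
      using dom(2) LIMSEQ_unique by (simp add: integral_unique[OF I])
    then show "(A has_integral (\<integral>x. \<phi> x \<partial>\<mu> t) - (\<integral>x. \<phi> x \<partial>\<mu> 0)) {0..t}"
      using dom(1) \<mu>(2) by (simp add: has_integral_iff)
  qed
  then show ?case using r conv by blast
qed

end
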